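(* Let $b\in C^2(\mathbb R^d;\mathbb R^d)$ satisfy: (a) $(b(x)-b(y),x-y)\le\lambda|x-y|^2$ for all $x,y\in\mathbb R^d$ and some $\lambda>0$; (b) $\|D^2b(x)\|\le C(|x|^M+1)$ for all $x\in\mathbb R^d$ and some $M\in\mathbb N$, $C\ge0$; (c) $b$ is eventually strictly monotone. Then for all sufficiently large noise intensities $\sigma>0$, synchronization occurs for the random dynamical system associated to the SDE $$dX_t=b(X_t)\,dt+\sigma\,dW_t\quad\text{on }\mathbb R^d.$$
   Context: A vector field $b:\mathbb R^d\to\mathbb R^d$ is eventually strictly monotone if there exist $R>0$ and $\lambda_1>0$ with $(b(x)-b(y),x-y)\le-\lambda_1|x-y|^2$ for all $|x|,|y|>R$. Canonical setup: $\Omega=C(\mathbb R;\mathbb R^d)$, $\mathcal F$ its Borel $\sigma$-field, $\mathbb P$ two-sided Wiener measure, $W_s(\omega)=\omega(s)$, $(\theta_t\omega)(s)=\omega(s+t)-\omega(t)$. The RDS associated to the SDE is the measurable map $\varphi:\mathbb R_+\times\Omega\times\mathbb R^d\to\mathbb R^d$, continuous in $x$, with $\varphi_0(\omega,x)=x$ and $\varphi_{t+s}(\omega,x)=\varphi_t(\theta_s\omega,\varphi_s(\omega,x))$, such that $\varphi_t(\cdot,x)$ solves the SDE with initial value $x$; it exists for locally Lipschitz $b$ satisfying (a). A random compact set is a family $A=\{A(\omega)\}$ of non-empty subsets of $\mathbb R^d$ that is a.s. compact with $\omega\mapsto d(x,A(\omega))$ measurable for each $x$, where $d(x,A)=\inf_{a\in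 A}|x-a|$. A weak attractor is a random compact set $A$ with (i) for all $t\ge0$, $\varphi_t(\omega,A(\omega))=A(\theta_t\omega)$ for a.a. $\omega$; (ii) for every compact $B\subset\mathbb R^d$, $\sup_{x\in B}d(\varphi_t(\theta_{-t}\omega,x),A(\omega))\to0$ in probability as $t\to\infty$. Synchronization occurs if there is a weak attractor $A(\omega)$ that is a singleton for $\mathbb P$-a.e. $\omega$. *)

theory Defs
  imports "HOL-Probability.Probability"
begin

section \<open>The drift\<close>

text \<open>
  The derivatives are passed as functions; being unique, they are determined by \<open>b\<close>.
  The norms on \<open>'a \<Rightarrow>\<^sub>L 'a\<close> and \<open>'a \<Rightarrow>\<^sub>L ('a \<Rightarrow>\<^sub>L 'a)\<close> are operator norms, so \<open>norm (D2b x)\<close> is the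
  norm of the second derivative at \<open>x\<close> as a bilinear map.
\<close>

definition C2_with_derivatives ::
  "('a::euclidean_space \<Rightarrow> 'a) \<Rightarrow> ('a \<Rightarrow> 'a \<Rightarrow>\<^sub>L 'a) \<Rightarrow> ('a \<Rightarrow> 'a \<Rightarrow>\<^sub>L ('a \<Rightarrow>\<^sub>L 'a)) \<Rightarrow> bool" where
  "C2_with_derivatives b Db D2b \<longleftrightarrow>
     (\<forall>x. (b has_derivative blinfun_apply (Db x)) (at x)) \<and>
     (\<forall>x. (Db has_derivative blinfun_apply (D2b x)) (at x)) \<and>
     continuous_on UNIV D2b"

definition eventually_strictly_monotone :: "('a::euclidean_space \<Rightarrow> 'a) \<Rightarrow> bool" where
  "eventually_strictly_monotone b \<longleftrightarrow>
     (\<exists>R>0. \<exists>l>0. \<forall>x y. norm x > R \<longrightarrow> norm y > R \<longrightarrow>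
        (b x - b y) \<bullet> (x - y) \<le> - l * (norm (x - y))\<^sup>2)"


section \<open>Two-sided Wiener measure on path space\<close>

definition paths :: "(real \<Rightarrow> 'a::euclidean_space) set" where
  "paths = {\<omega>. continuous_on UNIV \<omega>}"

text \<open>Open sets for the topology of uniform convergence on compact sets.\<close>

definition open_paths :: "(real \<Rightarrow> 'a::euclidean_space) set \<Rightarrow> bool" where
  "open_paths U \<longleftrightarrow> U \<subseteq> paths \<and>
     (\<forall>\<omega>\<in>U. \<exists>K \<epsilon>. compact K \<and> \<epsilon> > 0 \<and>
        {\<omega>' \<in> paths. \<forall>s\<in>K. dist (\<omega>' s) (\<omega> s) < \<epsilon>} \<subseteq> U)"

definition path_borel :: "(real \<Rightarrow> 'a::euclidean_space) measure" where
  "path_borel = sigma paths {U. open_paths U}"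

text \<open>
  The coordinate process vanishes at time 0 and has independent increments over all of \<open>\<real>\<close>, the
  increment over \<open>[s, t]\<close> being Gaussian with mean 0 and covariance matrix \<open>t - s\<close> times the
  identity.  (The second argument of \<open>normal_density\<close> is the standard deviation.)
\<close>

definition two_sided_wiener_measure :: "(real \<Rightarrow> 'a::euclidean_space) measure \<Rightarrow> bool" where
  "two_sided_wiener_measure P \<longleftrightarrow>
     prob_space P \<and> sets P = sets path_borel \<and>
     (AE \<omega> in P. \<omega> 0 = 0) \<and>
     (\<forall>s t. s < t \<longrightarrow>
        distributed P lborel (\<lambda>\<omega>. \<omega> t - \<omega> s)
          (\<lambda>x. ennreal (\<Prod>i\<in>Basis. normal_density 0 (sqrt (t - s)) (x \<bullet> i)))) \<and>
     (\<forall>n. \<forall>\<tau>::nat \<Rightarrow> real. (\<forall>i<n. \<tau> i < \<tau> (Suc i)) \<longrightarrow>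
        prob_space.indep_vars P (\<lambda>_. borel) (\<lambda>i \<omega>. \<omega> (\<tau> (Suc i)) - \<omega> (\<tau> i)) {..<n})"

definition shift :: "real \<Rightarrow> (real \<Rightarrow> 'a::euclidean_space) \<Rightarrow> (real \<Rightarrow> 'a)" where
  "shift t \<omega> = (\<lambda>s. \<omega> (s + t) - \<omega> t)"


section \<open>The random dynamical system of the SDE\<close>

text \<open>
  The noise is additive, so the stochastic integral of \<open>\<sigma>\<close> over \<open>[0, t]\<close> is \<open>\<sigma> (W\<^sub>t - W\<^sub>0)\<close> and the SDE
  is a pathwise integral equation.  Adaptedness of the solution is not required separately: \<open>b\<close> is
  locally Lipschitz here, so the equation determines the solution path from \<open>x\<close> and the increments
  of the noise on \<open>[0, t]\<close>.
\<close>

definition solves_sde ::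
  "('a::euclidean_space \<Rightarrow> 'a) \<Rightarrow> real \<Rightarrow> (real \<Rightarrow> 'a) measure \<Rightarrow> 'a \<Rightarrow>
     (real \<Rightarrow> (real \<Rightarrow> 'a) \<Rightarrow> 'a) \<Rightarrow> bool" where
  "solves_sde b \<sigma> P x X \<longleftrightarrow>
     (AE \<omega> in P. continuous_on {0..} (\<lambda>t. X t \<omega>) \<and>
        (\<forall>t\<ge>0. X t \<omega> = x + integral {0..t} (\<lambda>s. b (X s \<omega>)) + \<sigma> *\<^sub>R (\<omega> t - \<omega> 0)))"

text \<open>
  Only the values \<open>\<phi> t \<omega> x\<close> with \<open>t \<ge> 0\<close> and \<open>\<omega> \<in> paths\<close> are meaningful.
\<close>

definition sde_rds ::
  "('a::euclidean_space \<Rightarrow> 'a) \<Rightarrow> real \<Rightarrow> (real \<Rightarrow> 'a) measure \<Rightarrow>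
     (real \<Rightarrow> (real \<Rightarrow> 'a) \<Rightarrow> 'a \<Rightarrow> 'a) \<Rightarrow> bool" where
  "sde_rds b \<sigma> P \<phi> \<longleftrightarrow>
     (\<lambda>(t, \<omega>, x). \<phi> t \<omega> x) \<in>
       restrict_space borel {0..} \<Otimes>\<^sub>M (path_borel \<Otimes>\<^sub>M borel) \<rightarrow>\<^sub>M borel \<and>
     (\<forall>t\<ge>0. \<forall>\<omega>\<in>paths. continuous_on UNIV (\<phi> t \<omega>)) \<and>
     (\<forall>\<omega>\<in>paths. \<forall>x. \<phi> 0 \<omega> x = x) \<and>
     (\<forall>s\<ge>0. \<forall>t\<ge>0. \<forall>\<omega>\<in>paths. \<forall>x. \<phi> (t + s) \<omega> x = \<phi> t (shift s \<omega>) (\<phi> s \<omega> x)) \<and>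
     (\<forall>x. solves_sde b \<sigma> P x (\<lambda>t \<omega>. \<phi> t \<omega> x))"


section \<open>Weak attractors and synchronization\<close>

definition random_compact_set ::
  "(real \<Rightarrow> 'a::euclidean_space) measure \<Rightarrow> ((real \<Rightarrow> 'a) \<Rightarrow> 'a set) \<Rightarrow> bool" where
  "random_compact_set P A \<longleftrightarrow>
     (\<forall>\<omega>\<in>space P. A \<omega> \<noteq> {}) \<and>
     (AE \<omega> in P. compact (A \<omega>)) \<and>
     (\<forall>x. (\<lambda>\<omega>. infdist x (A \<omega>)) \<in> borel_measurable P)"

text \<open>
  In the attraction clause \<open>B = {}\<close> is excluded because the supremum of the empty set is not
  meaningful in \<open>real\<close>; for nonempty compact \<open>B\<close> the supremum is that of a continuous function.
\<close>

definition weak_attractor ::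
  "(real \<Rightarrow> 'a::euclidean_space) measure \<Rightarrow> (real \<Rightarrow> (real \<Rightarrow> 'a) \<Rightarrow> 'a \<Rightarrow> 'a) \<Rightarrow>
     ((real \<Rightarrow> 'a) \<Rightarrow> 'a set) \<Rightarrow> bool" where
  "weak_attractor P \<phi> A \<longleftrightarrow>
     random_compact_set P A \<and>
     (\<forall>t\<ge>0. AE \<omega> in P. \<phi> t \<omega> ` A \<omega> = A (shift t \<omega>)) \<and>
     (\<forall>B. compact B \<and> B \<noteq> {} \<longrightarrow>
        (\<forall>\<epsilon>>0. ((\<lambda>t. measure P {\<omega> \<in> space P.
             (SUP x\<in>B. infdist (\<phi> t (shift (- t) \<omega>) x) (A \<omega>)) > \<epsilon>}) \<longlongrightarrow> 0) at_top))"

definition synchronization ::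
  "(real \<Rightarrow> 'a::euclidean_space) measure \<Rightarrow> (real \<Rightarrow> (real \<Rightarrow> 'a) \<Rightarrow> 'a \<Rightarrow> 'a) \<Rightarrow> bool" where
  "synchronization P \<phi> \<longleftrightarrow>
     (\<exists>A. weak_attractor P \<phi> A \<and> (AE \<omega> in P. is_singleton (A \<omega>)))"

end

theory Submission
  imports Defs
begin

text \<open>
  The noise is additive, so the difference of two solutions driven by the same noise path is
  differentiable in time, and its norm obeys a pathwise differential inequality. Far from the
  origin the drift contracts. A long segment meets a fixed ball only in a short piece, so there
  are \<open>R\<close> and \<open>l > 0\<close> such that the drift contracts at rate \<open>l\<close> as soon as one of the two points
  lies outside the ball of radius \<open>R\<close> (\<open>monotone_if_one_point_far\<close>). Hence the distance of any solution to
  the solution \<open>X\<close> started at \<open>0\<close> shrinks by the factor \<open>exp (\<integral> h (X s) ds)\<close>, where the rate \<open>h\<close> is \<open>\<Lambda>\<close> near the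
  origin and \<open>- l\<close> away from it (\<open>solutions_distance\<close>): the factor depends on \<open>X\<close> alone.

  It remains to see that for strong noise \<open>X\<close> spends little time near the origin. Fix a length \<open>r\<close>
  much larger than \<open>R\<close> and look back in time by \<open>\<delta> = r\<^sup>2 / \<sigma>\<^sup>2\<close>. During this time the noise moves by
  about \<open>r\<close>, whatever \<open>\<sigma>\<close> is, while the drift, which is bounded on a fixed large ball, moves \<open>X\<close> by at
  most \<open>1\<close> once \<open>\<sigma>\<close> is large. So if \<open>X\<close> is near the origin at time \<open>t + \<delta>\<close>, then either the noise
  oscillated exceptionally on \<open>[t, t + \<delta>]\<close>, or a Gaussian increment of size \<open>r\<close> that is independent of the
  past hit a ball of radius about \<open>R\<close>. Both are unlikely, uniformly in the past
  (\<open>occupation_bound\<close>). Over successive unit intervals this makes the expected contraction factor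
  at time \<open>n\<close> at most \<open>exp (- l / 2) ^ n\<close> (\<open>expected_gain\<close>).

  Finally consider the pullback points \<open>\<phi> n (shift (- n) \<omega>) 0\<close>. Two consecutive ones differ by at most the size of one
  unit step of the flow times a contraction factor. By the polynomial growth of the drift, a unit step is at
  most polynomial in the supremum of the noise, hence rarely exponentially large, and the
  Borel-Cantelli lemma shows that the pullback points converge (\<open>pullback_rate\<close>). The limit
  is the single point of the attractor.

  The probabilistic input is the independence of the past and the future of the Wiener path, the
  invariance of its law under shifts, and a maximal inequality. The first two follow from the law of
  finitely many increments because the Borel sets of path space are generated by the evaluation maps
  (\<open>sets_path_borel_cylinders\<close>).
\<close>

section \<open>Solutions of an integral equation with additive noise\<close>

text \<open>
  Only the part of the segment from \<open>y\<close> to \<open>x\<close> inside the ball of radius \<open>R\<close> can fail to contract. That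
  part is an interval of length at most \<open>2 * R\<close>, whereas the segment is long because \<open>x\<close> is far out;
  the gain \<open>l\<close> on the rest beats the loss \<open>\<Lambda>\<close> on this piece. The increments of \<open>b\<close> over the three
  pieces are added along the direction of the segment.
\<close>

lemma monotone_if_one_point_far:
  fixes b :: "'a::euclidean_space \<Rightarrow> 'a"
  assumes cont: "continuous_on UNIV b"
    and L: "\<And>x y. (b x - b y) \<bullet> (x - y) \<le> \<Lambda> * (norm (x - y))\<^sup>2" and L0: "\<Lambda> > 0"
    and R0: "R > 0" and l0: "l > 0"
    and mono: "\<And>x y. norm x > R \<Longrightarrow> norm y > R \<Longrightarrow>
                 (b x - b y) \<bullet> (x - y) \<le> - l * (norm (x - y))\<^sup>2"
    and far: "norm x > R + 4 * R * (\<Lambda> + l) / l"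
  shows "(b x - b y) \<bullet> (x - y) \<le> - (l / 2) * (norm (x - y))\<^sup>2"
proof -
  define v where "v = x - y"
  define z where "z s = y + s *\<^sub>R v" for s
  have z0: "z 0 = y" and z1: "z 1 = x" by (auto simp: z_def v_def)
  have cz: "continuous_on UNIV z" unfolding z_def by (intro continuous_intros)
  have cbz: "continuous_on A (\<lambda>s. b (z s))" for A
    by (rule continuous_on_compose2[OF cont continuous_on_subset[OF cz]]) auto
  have zz: "z s' - z s = (s' - s) *\<^sub>R v" for s s' by (simp add: z_def algebra_simps)
  have nz: "(norm (z s' - z s))\<^sup>2 = (s' - s)\<^sup>2 * (norm v)\<^sup>2" for s s'
    by (simp add: zz power_mult_distrib)
  have step: "(b (z s') - b (z s)) \<bullet> v \<le> c * (s' - s) * (norm v)\<^sup>2"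
    if "(b (z s') - b (z s)) \<bullet> (z s' - z s) \<le> c * (norm (z s' - z s))\<^sup>2" "s < s'" for s s' c
  proof -
    have eq: "(b (z s') - b (z s)) \<bullet> (z s' - z s) = (s' - s) * ((b (z s') - b (z s)) \<bullet> v)"
      by (simp add: zz)
    have "(s' - s) * ((b (z s') - b (z s)) \<bullet> v) \<le> (s' - s) * (c * (s' - s) * (norm v)\<^sup>2)"
      using that(1) unfolding nz eq by (simp add: power2_eq_square mult_ac)
    thus ?thesis using that(2) by simp
  qed
  have Rx: "R < norm x" using far R0 l0 L0
    by (smt (verit) divide_pos_pos mult_pos_pos)
  define S where "S = {0..1} \<inter> {s. norm (z s) \<le> R}"
  have "(b x - b y) \<bullet> v \<le> - (l / 2) * (norm v)\<^sup>2"
  proof (cases "S = {}")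
    case True
    hence "norm (z 0) > R" by (force simp: S_def)
    hence "(b x - b y) \<bullet> (x - y) \<le> - l * (norm (x - y))\<^sup>2" using mono Rx z0 by auto
    also have "\<dots> \<le> - (l / 2) * (norm (x - y))\<^sup>2" using l0 by (simp add: mult_right_mono)
    finally show ?thesis by (simp add: v_def)
  next
    case False
    have "closed {s. norm (z s) \<le> R}"
      by (intro closed_Collect_le continuous_intros cz)
    hence compS: "compact S" unfolding S_def by (intro compact_Int_closed) auto
    \<comment> \<open>The segment is in the ball at most for parameters in \<open>{\<alpha>..\<beta>}\<close>, and at both ends of this interval.\<close>
    obtain \<alpha> where \<alpha>: "\<alpha> \<in> S" "\<And>s. s \<in> S \<Longrightarrow> \<alpha> \<le> s"
      using compact_attains_inf[OF compS False] by blast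
    obtain \<beta> where \<beta>: "\<beta> \<in> S" "\<And>s. s \<in> S \<Longrightarrow> s \<le> \<beta>"
      using compact_attains_sup[OF compS False] by blast
    have rng: "0 \<le> \<alpha>" "\<alpha> \<le> \<beta>" "\<beta> \<le> 1" using \<alpha> \<beta> by (auto simp: S_def)
    have \<beta>1: "\<beta> < 1" using \<beta>(1) Rx z1 rng by (cases "\<beta> = 1") (auto simp: S_def)
    \<comment> \<open>The point \<open>z \<beta>\<close> itself is not outside the ball, so the estimate is passed to the limit.\<close>
    have p1: "(b x - b (z \<beta>)) \<bullet> v - - l * (1 - \<beta>) * (norm v)\<^sup>2 \<le> 0"
    proof (rule continuous_le_on_closure[where S = "{\<beta><..1}"
          and f = "\<lambda>s. (b x - b (z s)) \<bullet> v - - l * (1 - s) * (norm v)\<^sup>2"])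
      show "continuous_on (closure {\<beta><..1}) (\<lambda>s. (b x - b (z s)) \<bullet> v - - l * (1 - s) * (norm v)\<^sup>2)"
        by (intro continuous_intros cbz)
      show "\<beta> \<in> closure {\<beta><..1}" using \<beta>1 by simp
      fix s assume s: "s \<in> {\<beta><..1}"
      have "R < norm (z s)" using s \<beta>(2)[of s] rng by (force simp: S_def)
      show "(b x - b (z s)) \<bullet> v - - l * (1 - s) * (norm v)\<^sup>2 \<le> 0"
      proof (cases "s = 1")
        case False
        thus ?thesis using step[of 1 s "-l"] mono[OF Rx \<open>R < norm (z s)\<close>] s z1 by auto
      qed (simp add: z1)
    qed
    have p2: "(b (z \<alpha>) - b y) \<bullet> v - - l * \<alpha> * (norm v)\<^sup>2 \<le> 0"
    proof (cases "\<alpha> = 0")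
      case False
      hence a0: "0 < \<alpha>" using rng by simp
      have Ry: "R < norm y" using \<alpha>(2)[of 0] a0 z0 by (force simp: S_def)
      show ?thesis
      proof (rule continuous_le_on_closure[where S = "{0..<\<alpha>}"
            and f = "\<lambda>s. (b (z s) - b y) \<bullet> v - - l * s * (norm v)\<^sup>2"])
        show "continuous_on (closure {0..<\<alpha>}) (\<lambda>s. (b (z s) - b y) \<bullet> v - - l * s * (norm v)\<^sup>2)"
          by (intro continuous_intros cbz)
        show "\<alpha> \<in> closure {0..<\<alpha>}" using a0 by simp
        fix s assume s: "s \<in> {0..<\<alpha>}"
        have "R < norm (z s)" using s \<alpha>(2)[of s] rng by (force simp: S_def)
        show "(b (z s) - b y) \<bullet> v - - l * s * (norm v)\<^sup>2 \<le> 0"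
        proof (cases "s = 0")
          case False
          thus ?thesis using step[of s 0 "-l"] mono[OF \<open>R < norm (z s)\<close> Ry] s z0 by auto
        qed (simp add: z0)
      qed
    qed (simp add: z0)
    have p3: "(b (z \<beta>) - b (z \<alpha>)) \<bullet> v \<le> \<Lambda> * (\<beta> - \<alpha>) * (norm v)\<^sup>2"
      by (cases "\<alpha> = \<beta>") (use step[of \<beta> \<alpha> \<Lambda>] L rng in auto)
    have n1: "(\<beta> - \<alpha>) * norm v \<le> 2 * R"
    proof -
      have "(\<beta> - \<alpha>) * norm v = norm (z \<beta> - z \<alpha>)" using rng by (simp add: zz)
      also have "\<dots> \<le> norm (z \<beta>) + norm (z \<alpha>)" by (rule norm_triangle_ineq4)
      finally show ?thesis using \<alpha>(1) \<beta>(1) by (simp add: S_def)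
    qed
    have n2: "norm v \<ge> 4 * R * (\<Lambda> + l) / l"
    proof -
      have "norm x - norm (z \<beta>) \<le> norm (z 1 - z \<beta>)" unfolding z1 by (rule norm_triangle_ineq2)
      also have "\<dots> = (1 - \<beta>) * norm v" using rng by (simp add: zz)
      also have "\<dots> \<le> 1 * norm v" using rng by (intro mult_right_mono) auto
      finally show ?thesis using \<beta>(1) far by (simp add: S_def)
    qed
    have v0: "norm v > 0" using n2 R0 L0 l0 by (smt (verit) divide_pos_pos mult_pos_pos)
    have "4 * R * (\<Lambda> + l) \<le> l * norm v" using n2 l0 by (simp add: field_simps)
    hence "2 * (\<Lambda> + l) * ((\<beta> - \<alpha>) * norm v) \<le> l * norm v"
      using mult_left_mono[OF n1, of "2 * (\<Lambda> + l)"] L0 l0 by (simp add: algebra_simps)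
    hence "(2 * ((\<Lambda> + l) * (\<beta> - \<alpha>))) * norm v \<le> l * norm v" by (simp only: mult.assoc)
    hence "2 * ((\<Lambda> + l) * (\<beta> - \<alpha>)) \<le> l" using v0 by (simp only: mult_le_cancel_right_pos)
    hence n3: "(\<Lambda> + l) * (\<beta> - \<alpha>) \<le> l / 2" by linarith
    have "(b x - b y) \<bullet> v = (b x - b (z \<beta>)) \<bullet> v + (b (z \<beta>) - b (z \<alpha>)) \<bullet> v + (b (z \<alpha>) - b y) \<bullet> v"
      by (simp add: inner_diff_left)
    also have "\<dots> \<le> - l * (1 - \<beta>) * (norm v)\<^sup>2 + \<Lambda> * (\<beta> - \<alpha>) * (norm v)\<^sup>2 + - l * \<alpha> * (norm v)\<^sup>2"
      using p1 p2 p3 by linarith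
    also have "\<dots> = ((\<Lambda> + l) * (\<beta> - \<alpha>) - l) * (norm v)\<^sup>2" by (simp add: algebra_simps)
    also have "\<dots> \<le> - (l / 2) * (norm v)\<^sup>2" using n3 by (intro mult_right_mono) auto
    finally show ?thesis .
  qed
  thus ?thesis by (simp add: v_def)
qed

text \<open>
  \<open>u s * exp (- \<integral> k)\<close> is nonincreasing. The rate \<open>k\<close> may have any sign, so the lemma serves both for
  growth and for decay.
\<close>

lemma gronwall:
  fixes u k :: "real \<Rightarrow> real"
  assumes contk: "continuous_on {0..T} k" and contu: "continuous_on {0..T} u"
    and der: "\<And>s. 0 < s \<Longrightarrow> s < T \<Longrightarrow> \<exists>d. (u has_real_derivative d) (at s) \<and> d \<le> k s * u s"
    and t: "t \<in> {0..T}"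
  shows "u t \<le> u 0 * exp (integral {0..t} k)"
proof -
  define I where "I s = integral {0..s} k" for s
  have cI: "continuous_on {0..T} I" unfolding I_def
    by (intro indefinite_integral_continuous_1 integrable_continuous_real contk)
  have dI: "(I has_real_derivative k s) (at s)" if "0 < s" "s < T" for s
  proof -
    have "(I has_real_derivative k s) (at s within {0..T})" unfolding I_def
      using that by (intro integral_has_real_derivative contk) auto
    thus ?thesis using that by (simp add: at_within_Icc_at)
  qed
  have "u t * exp (- I t) \<le> u 0 * exp (- I 0)"
  proof (rule DERIV_nonpos_imp_decreasing_open[where f = "\<lambda>s. u s * exp (- I s)"])
    show "0 \<le> t" using t by simp
    show "continuous_on {0..t} (\<lambda>s. u s * exp (- I s))"
      using t by (intro continuous_intros continuous_on_subset[OF contu] continuous_on_subset[OF cI]) auto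
    fix s assume s: "0 < s" "s < t"
    then obtain d where d: "(u has_real_derivative d) (at s)" "d \<le> k s * u s"
      using der[of s] t by auto
    have "((\<lambda>s. u s * exp (- I s)) has_real_derivative
        u s * (exp (- I s) * (- k s)) + d * exp (- I s)) (at s)"
      using d(1) dI[of s] s t by (auto intro!: derivative_eq_intros)
    moreover have "u s * (exp (- I s) * (- k s)) + d * exp (- I s) = (d - k s * u s) * exp (- I s)"
      by (simp add: algebra_simps)
    moreover have "\<dots> \<le> 0" using d(2) by (simp add: mult_nonpos_nonneg)
    ultimately show "\<exists>y. ((\<lambda>s. u s * exp (- I s)) has_real_derivative y) (at s) \<and> y \<le> 0"
      by metis
  qed
  hence "u t * exp (- I t) * exp (I t) \<le> u 0 * exp (I t)"
    by (intro mult_right_mono) (auto simp: I_def)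
  thus ?thesis by (simp add: I_def mult.assoc flip: exp_add)
qed

text \<open>
  The noise \<open>g\<close> enters as an arbitrary function of time, which makes all statements about solutions
  deterministic.
\<close>

definition solves_on :: "('a::euclidean_space \<Rightarrow> 'a) \<Rightarrow> real \<Rightarrow> (real \<Rightarrow> 'a) \<Rightarrow> 'a \<Rightarrow> (real \<Rightarrow> 'a) \<Rightarrow> bool"
  where "solves_on b T g x X \<longleftrightarrow> continuous_on {0..T} X \<and>
     (\<forall>t\<in>{0..T}. X t = x + integral {0..t} (\<lambda>s. b (X s)) + g t)"

lemma has_derivative_inner_self:
  fixes D :: "real \<Rightarrow> 'a::euclidean_space"
  assumes "(D has_vector_derivative d) (at s)"
  shows "((\<lambda>s. (norm (D s))\<^sup>2) has_real_derivative 2 * (d \<bullet> D s)) (at s)"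
proof -
  have "((\<lambda>s. D s \<bullet> D s) has_derivative (\<lambda>h. D s \<bullet> (h *\<^sub>R d) + (h *\<^sub>R d) \<bullet> D s)) (at s)"
    using assms unfolding has_vector_derivative_def by (intro has_derivative_inner) 
  moreover have "(\<lambda>h. D s \<bullet> (h *\<^sub>R d) + (h *\<^sub>R d) \<bullet> D s) = (*) (2 * (d \<bullet> D s))"
    by (auto simp: inner_commute)
  ultimately show ?thesis by (simp add: has_field_derivative_def power2_norm_eq_inner)
qed

text \<open>
  The solution itself is as rough as the noise; only \<open>X - g\<close> is differentiable.
\<close>

lemma solves_on_vector_derivative:
  assumes cb: "continuous_on UNIV b" and X: "solves_on b T g x X" and s: "0 < s" "s < T"
  shows "((\<lambda>s. X s - g s) has_vector_derivative b (X s)) (at s)"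
proof -
  have cX: "continuous_on {0..T} X" using X by (simp add: solves_on_def)
  have "continuous_on {0..T} (\<lambda>s. b (X s))"
    by (rule continuous_on_compose2[OF cb cX]) auto
  hence "((\<lambda>t. integral {0..t} (\<lambda>s. b (X s))) has_vector_derivative b (X s)) (at s within {0..T})"
    using s by (intro integral_has_vector_derivative) auto
  hence "((\<lambda>t. x + integral {0..t} (\<lambda>s. b (X s))) has_vector_derivative b (X s)) (at s within {0..T})"
    by (auto intro!: derivative_eq_intros)
  hence "((\<lambda>t. x + integral {0..t} (\<lambda>s. b (X s))) has_vector_derivative b (X s)) (at s)"
    using s by (simp add: at_within_Icc_at)
  thus ?thesis
    by (rule has_vector_derivative_transform_within_open[of _ _ _ "{0<..<T}"])
      (use s X in \<open>auto simp: solves_on_def\<close>)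
qed

lemma solves_on_continuous_diff:
  assumes cb: "continuous_on UNIV b" and X: "solves_on b T g x X"
  shows "continuous_on {0..T} (\<lambda>s. X s - g s)"
proof -
  have cX: "continuous_on {0..T} X" using X by (simp add: solves_on_def)
  have cbX: "continuous_on {0..T} (\<lambda>s. b (X s))"
    by (rule continuous_on_compose2[OF cb cX]) auto
  have "continuous_on {0..T} (\<lambda>t. x + integral {0..t} (\<lambda>s. b (X s)))"
    by (intro continuous_intros indefinite_integral_continuous_1 integrable_continuous_real cbX)
  thus ?thesis by (rule continuous_on_eq) (use X in \<open>auto simp: solves_on_def\<close>)
qed

text \<open>
  The noise cancels in the difference of two solutions, so Gronwall's inequality applies to its
  squared norm. The one-sided estimate uses the first argument of \<open>h\<close> only, hence the rate is read off
  from \<open>X\<close>. For \<open>x = y\<close> this is uniqueness of solutions.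
\<close>

lemma solutions_distance:
  assumes cb: "continuous_on UNIV b" and ch: "continuous_on UNIV h"
    and ineq: "\<And>u v. (b u - b v) \<bullet> (u - v) \<le> h u * (norm (u - v))\<^sup>2"
    and X: "solves_on b T g x X" and Y: "solves_on b T g y Y" and t: "t \<in> {0..T}" and g0: "g 0 = 0"
  shows "norm (X t - Y t) \<le> norm (x - y) * exp (integral {0..t} (\<lambda>s. h (X s)))"
proof -
  define D where "D s = (X s - g s) - (Y s - g s)" for s
  have D: "D s = X s - Y s" for s by (simp add: D_def)
  have cX: "continuous_on {0..T} X" using X by (simp add: solves_on_def)
  have chX: "continuous_on {0..T} (\<lambda>s. 2 * h (X s))"
    by (intro continuous_intros continuous_on_compose2[OF ch cX]) auto
  have "(norm (D t))\<^sup>2 \<le> (norm (D 0))\<^sup>2 * exp (integral {0..t} (\<lambda>s. 2 * h (X s)))"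
  proof (rule gronwall[OF chX _ _ t])
    show "continuous_on {0..T} (\<lambda>s. (norm (D s))\<^sup>2)" unfolding D_def
      by (intro continuous_intros solves_on_continuous_diff[OF cb X] solves_on_continuous_diff[OF cb Y])
    fix s assume s: "0 < s" "s < T"
    have "(D has_vector_derivative (b (X s) - b (Y s))) (at s)" unfolding D_def
      by (intro derivative_intros solves_on_vector_derivative[OF cb X s] solves_on_vector_derivative[OF cb Y s])
    from has_derivative_inner_self[OF this]
    have "((\<lambda>s. (norm (D s))\<^sup>2) has_real_derivative 2 * ((b (X s) - b (Y s)) \<bullet> D s)) (at s)" .
    moreover have "2 * ((b (X s) - b (Y s)) \<bullet> D s) \<le> 2 * h (X s) * (norm (D s))\<^sup>2"
      using ineq[of "X s" "Y s"] by (simp add: D)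
    ultimately show "\<exists>d. ((\<lambda>s. (norm (D s))\<^sup>2) has_real_derivative d) (at s) \<and> d \<le> 2 * h (X s) * (norm (D s))\<^sup>2"
      by blast
  qed
  also have "D 0 = x - y" using X Y t g0 by (simp add: solves_on_def D)
  also have "(norm (x - y))\<^sup>2 * exp (integral {0..t} (\<lambda>s. 2 * h (X s)))
      = (norm (x - y) * exp (integral {0..t} (\<lambda>s. h (X s))))\<^sup>2"
    by (simp add: power_mult_distrib exp_double)
  finally show ?thesis unfolding D by (rule power2_le_imp_le) simp
qed

text \<open>
  The drift at \<open>X\<close> is compared with the drift at \<open>g\<close> by the one-sided estimate, so the bound involves
  the size of \<open>b\<close> along the noise path only.
\<close>

lemma solution_bound:
  assumes cb: "continuous_on UNIV b"
    and L: "\<And>x y. (b x - b y) \<bullet> (x - y) \<le> \<Lambda> * (norm (x - y))\<^sup>2" and L0: "0 \<le> \<Lambda>"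
    and X: "solves_on b T g x X" and t: "t \<in> {0..T}" and g0: "g 0 = 0"
    and B: "\<And>s. s \<in> {0..T} \<Longrightarrow> norm (b (g s)) \<le> B"
  shows "(norm (X t - g t))\<^sup>2 \<le> ((norm x)\<^sup>2 + B\<^sup>2) * exp ((2 * \<Lambda> + 1) * t)"
proof -
  define V where "V s = X s - g s" for s
  have B0: "0 \<le> B" using B[OF t] norm_ge_zero order_trans by blast
  have "(norm (V t))\<^sup>2 + B\<^sup>2 \<le> ((norm (V 0))\<^sup>2 + B\<^sup>2) * exp (integral {0..t} (\<lambda>s. 2 * \<Lambda> + 1))"
  proof (rule gronwall[OF _ _ _ t])
    show "continuous_on {0..T} (\<lambda>s. (norm (V s))\<^sup>2 + B\<^sup>2)" unfolding V_def
      by (intro continuous_intros solves_on_continuous_diff[OF cb X])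
    fix s assume s: "0 < s" "s < T"
    have "(V has_vector_derivative b (X s)) (at s)" unfolding V_def
      by (intro solves_on_vector_derivative[OF cb X s])
    from has_derivative_inner_self[OF this]
    have "((\<lambda>s. (norm (V s))\<^sup>2 + B\<^sup>2) has_real_derivative 2 * (b (X s) \<bullet> V s)) (at s)"
      using DERIV_add[OF _ DERIV_const] by fastforce
    moreover have "2 * (b (X s) \<bullet> V s) \<le> (2 * \<Lambda> + 1) * ((norm (V s))\<^sup>2 + B\<^sup>2)"
    proof -
      have "(b (g s)) \<bullet> V s \<le> norm (b (g s)) * norm (V s)" by (rule norm_cauchy_schwarz)
      also have "\<dots> \<le> B * norm (V s)" using B[of s] s by (intro mult_right_mono) auto
      finally have "2 * (b (g s) \<bullet> V s) \<le> 2 * (B * norm (V s))" by simp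
      also have "\<dots> \<le> B\<^sup>2 + (norm (V s))\<^sup>2"
        using sum_squares_bound[of B "norm (V s)"] by simp
      finally have "2 * (b (g s) \<bullet> V s) \<le> B\<^sup>2 + (norm (V s))\<^sup>2" .
      moreover have "(b (X s) - b (g s)) \<bullet> V s \<le> \<Lambda> * (norm (V s))\<^sup>2"
        using L[of "X s" "g s"] by (simp add: V_def)
      moreover have "0 \<le> \<Lambda> * B\<^sup>2" using L0 by simp
      ultimately show ?thesis by (simp add: inner_diff_left algebra_simps)
    qed
    ultimately show "\<exists>d. ((\<lambda>s. (norm (V s))\<^sup>2 + B\<^sup>2) has_real_derivative d) (at s) \<and>
        d \<le> (2 * \<Lambda> + 1) * ((norm (V s))\<^sup>2 + B\<^sup>2)" by blast
  qed simp
  moreover have "V 0 = x" using X t g0 by (simp add: solves_on_def V_def)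
  ultimately show ?thesis using t by (simp add: V_def mult.commute) (smt (verit) zero_le_power2)
qed

text \<open>
  Suppose the solution is in the ball of radius \<open>R1\<close> at time \<open>s\<close>, and neither the noise nor a drift
  bounded by \<open>K\<close> can move it far during \<open>[t, s]\<close>. Then it has not left the ball of radius \<open>\<rho>\<close> since
  time \<open>t\<close>: after its last visit outside, it would have had to cover more distance than noise and
  drift allow. Hence the drift contributed at most \<open>1\<close>. This is why a bound of \<open>b\<close> on a ball is
  enough, however fast \<open>b\<close> grows outside.
\<close>

lemma solution_localized:
  assumes cb: "continuous_on UNIV b" and X: "solves_on b T g x X"
    and t: "0 \<le> t" "t \<le> s" "s \<le> T"
    and osc: "\<And>u. t \<le> u \<Longrightarrow> u \<le> s \<Longrightarrow> norm (g u - g t) \<le> m"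
    and K: "\<And>z. norm z \<le> \<rho> \<Longrightarrow> norm (b z) \<le> K" and Kt: "K * (s - t) \<le> 1" and K0: "0 \<le> K"
    and \<rho>: "R1 + 2 * m + 2 \<le> \<rho>" and s: "norm (X s) \<le> R1"
  shows "norm (X t + (g s - g t)) \<le> R1 + 1"
proof -
  have cX: "continuous_on {0..T} X" using X by (simp add: solves_on_def)
  have cbX: "continuous_on {0..T} (\<lambda>s. b (X s))"
    by (rule continuous_on_compose2[OF cb cX]) auto
  have m0: "0 \<le> m" using osc[of t] t by simp
  have R10: "0 \<le> R1" using s norm_ge_zero order_trans by blast
  have incr: "X s - X u = integral {u..s} (\<lambda>v. b (X v)) + (g s - g u)" if "t \<le> u" "u \<le> s" for u
  proof -
    have "integral {0..u} (\<lambda>v. b (X v)) + integral {u..s} (\<lambda>v. b (X v)) = integral {0..s} (\<lambda>v. b (X v))"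
      using that t by (intro Henstock_Kurzweil_Integration.integral_combine integrable_continuous_real
          continuous_on_subset[OF cbX]) auto
    moreover have "X s = x + integral {0..s} (\<lambda>v. b (X v)) + g s" "X u = x + integral {0..u} (\<lambda>v. b (X v)) + g u"
      using X that t by (auto simp: solves_on_def)
    ultimately show ?thesis by (simp add: algebra_simps)
  qed
  have ibd: "norm (integral {u..s} (\<lambda>v. b (X v))) \<le> 1"
    if u: "t \<le> u" "u \<le> s" and bd: "\<And>v. u \<le> v \<Longrightarrow> v \<le> s \<Longrightarrow> norm (X v) \<le> \<rho>" for u
  proof -
    have "norm (integral {u..s} (\<lambda>v. b (X v))) \<le> K * (s - u)"
      using u t by (intro integral_bound continuous_on_subset[OF cbX] K bd) auto
    also have "\<dots> \<le> K * (s - t)" using u K0 by (intro mult_left_mono) auto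
    finally show ?thesis using Kt by simp
  qed
  have bd: "norm (X v) < \<rho>" if "t \<le> v" "v \<le> s" for v
  proof (rule ccontr)
    assume nv: "\<not> ?thesis"
    define S where "S = {v \<in> {t..s}. \<rho> \<le> norm (X v)}"
    have "continuous_on {t..s} (\<lambda>v. norm (X v))"
      using t by (intro continuous_intros continuous_on_subset[OF cX]) auto
    hence "closed ({t..s} \<inter> (\<lambda>v. norm (X v)) -` {\<rho>..})"
      by (intro continuous_closed_preimage) auto
    moreover have "S = {t..s} \<inter> ({t..s} \<inter> (\<lambda>v. norm (X v)) -` {\<rho>..})" by (auto simp: S_def)
    ultimately have "compact S" using compact_Int_closed[of "{t..s}"] by (metis compact_Icc)
    moreover have "S \<noteq> {}" using nv that by (force simp: S_def)
    \<comment> \<open>the last time at which the solution is outside\<close>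
    ultimately obtain u where u: "u \<in> S" "\<And>v. v \<in> S \<Longrightarrow> v \<le> u"
      using compact_attains_sup by metis
    have ut: "t \<le> u" "u \<le> s" "\<rho> \<le> norm (X u)" using u by (auto simp: S_def)
    have us: "u < s" using ut s \<rho> m0 by (cases "u = s") auto
    have "norm (X v) \<le> \<rho>" if "u \<le> v" "v \<le> s" for v
    proof (rule continuous_le_on_closure[where S = "{u<..s}" and f = "\<lambda>v. norm (X v)"])
      show "continuous_on (closure {u<..s}) (\<lambda>v. norm (X v))"
        using us ut t by (intro continuous_intros continuous_on_subset[OF cX]) auto
      show "v \<in> closure {u<..s}" using us that by simp
      fix w assume "w \<in> {u<..s}"
      thus "norm (X w) \<le> \<rho>" using u(2)[of w] ut by (force simp: S_def)
    qed
    hence "norm (integral {u..s} (\<lambda>v. b (X v))) \<le> 1" using ibd ut by auto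
    moreover have "norm (g s - g u) \<le> 2 * m"
    proof -
      have "g s - g u = (g s - g t) - (g u - g t)" by simp
      thus ?thesis using norm_triangle_ineq4[of "g s - g t" "g u - g t"] osc[of s] osc[of u] ut t by simp
    qed
    moreover have "norm (X s - X u) \<le> norm (integral {u..s} (\<lambda>v. b (X v))) + norm (g s - g u)"
      unfolding incr[OF ut(1,2)] by (rule norm_triangle_ineq)
    moreover have "norm (X u) - norm (X s) \<le> norm (X s - X u)"
      by (metis norm_minus_commute norm_triangle_ineq2)
    ultimately show False using ut s \<rho> by linarith
  qed
  have "norm (integral {t..s} (\<lambda>v. b (X v))) \<le> 1" using bd t by (intro ibd) (auto intro: less_imp_le)
  moreover have "X t + (g s - g t) = X s - integral {t..s} (\<lambda>v. b (X v))"
    using incr[of t] t by (simp add: algebra_simps)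
  ultimately show ?thesis using s norm_triangle_ineq4[of "X s" "integral {t..s} (\<lambda>v. b (X v))"] by simp
qed

lemma polynomial_growth_of_C2:
  fixes b :: "'a::euclidean_space \<Rightarrow> 'a"
  assumes C2: "C2_with_derivatives b Db D2b"
    and D2: "\<And>x. norm (D2b x) \<le> C * (norm x ^ M + 1)" and C0: "0 \<le> C"
  obtains C' where "0 \<le> C'" "\<And>x. norm (b x) \<le> C' * (1 + norm x) ^ (M + 2)"
proof -
  have bnd: "norm x ^ M + 1 \<le> 2 * (1 + norm y) ^ M" if "norm x \<le> norm y" for x y :: 'a
  proof -
    have "norm x ^ M \<le> (1 + norm y) ^ M" using that by (intro power_mono) auto
    moreover have "1 \<le> (1 + norm y) ^ M" by (rule one_le_power) simp
    ultimately show ?thesis by linarith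
  qed
  have D1: "norm (Db x - Db 0) \<le> 2 * C * (1 + norm x) ^ (M + 1)" for x :: 'a
  proof -
    have "norm (Db x - Db 0) \<le> C * (2 * (1 + norm x) ^ M) * norm (x - 0)"
    proof (rule differentiable_bound[of "cball 0 (norm x)" Db "\<lambda>x. blinfun_apply (D2b x)"])
      fix y :: 'a assume "y \<in> cball 0 (norm x)"
      hence y: "norm y \<le> norm x" by simp
      show "(Db has_derivative blinfun_apply (D2b y)) (at y within cball 0 (norm x))"
        using C2 by (auto simp: C2_with_derivatives_def intro: has_derivative_at_withinI)
      show "onorm (blinfun_apply (D2b y)) \<le> C * (2 * (1 + norm x) ^ M)"
        using D2[of y] mult_left_mono[OF bnd[OF y] C0] by (simp add: norm_blinfun.rep_eq)
    qed auto
    also have "\<dots> \<le> C * (2 * (1 + norm x) ^ M) * (1 + norm x)"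
      using C0 by (intro mult_left_mono) auto
    finally show ?thesis by (simp add: algebra_simps)
  qed
  have D1': "norm (Db x) \<le> (2 * C + norm (Db 0)) * (1 + norm x) ^ (M + 1)" for x
  proof -
    have "norm (Db x) \<le> norm (Db x - Db 0) + norm (Db 0)" using norm_triangle_ineq[of "Db x - Db 0" "Db 0"] by simp
    also have "\<dots> \<le> 2 * C * (1 + norm x) ^ (M + 1) + norm (Db 0) * (1 + norm x) ^ (M + 1)"
      using D1[of x] mult_left_mono[OF one_le_power[of "1 + norm x" "M + 1"], of "norm (Db 0)"]
      by (simp del: power_Suc power_add)
    finally show ?thesis by (simp add: algebra_simps)
  qed
  define E where "E = 2 * C + norm (Db 0)"
  have E0: "0 \<le> E" using C0 by (simp add: E_def)
  have "norm (b x) \<le> (E + norm (b 0)) * (1 + norm x) ^ (M + 2)" for x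
  proof -
    have "norm (b x - b 0) \<le> E * (1 + norm x) ^ (M + 1) * norm (x - 0)"
    proof (rule differentiable_bound[of "cball 0 (norm x)" b "\<lambda>x. blinfun_apply (Db x)"])
      fix y :: 'a assume "y \<in> cball 0 (norm x)"
      hence y: "norm y \<le> norm x" by simp
      show "(b has_derivative blinfun_apply (Db y)) (at y within cball 0 (norm x))"
        using C2 by (auto simp: C2_with_derivatives_def intro: has_derivative_at_withinI)
      have "norm (Db y) \<le> E * (1 + norm y) ^ (M + 1)" using D1' by (simp add: E_def)
      also have "\<dots> \<le> E * (1 + norm x) ^ (M + 1)" using y E0 by (intro mult_left_mono power_mono) auto
      finally show "onorm (blinfun_apply (Db y)) \<le> E * (1 + norm x) ^ (M + 1)"
        by (simp add: norm_blinfun.rep_eq)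
    qed auto
    also have "\<dots> \<le> E * (1 + norm x) ^ (M + 1) * (1 + norm x)" using E0 by (intro mult_left_mono) auto
    also have "\<dots> = E * (1 + norm x) ^ (M + 2)" by simp
    finally have "norm (b x - b 0) \<le> E * (1 + norm x) ^ (M + 2)" .
    moreover have "norm (b x) \<le> norm (b x - b 0) + norm (b 0)" using norm_triangle_ineq[of "b x - b 0" "b 0"] by simp
    moreover have "norm (b 0) * 1 \<le> norm (b 0) * (1 + norm x) ^ (M + 2)"
      by (intro mult_left_mono one_le_power) auto
    ultimately show ?thesis unfolding distrib_right mult_1_right by linarith
  qed
  thus ?thesis using that[of "E + norm (b 0)"] E0 by simp
qed

section \<open>The Borel sets of path space\<close>

lemma space_path_borel [simp]: "space path_borel = paths"
proof -
  have "{U. open_paths U} \<subseteq> Pow (paths :: (real \<Rightarrow> 'a::euclidean_space) set)" by (auto simp: open_paths_def)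
  thus "space path_borel = (paths :: (real \<Rightarrow> 'a) set)" by (simp add: path_borel_def space_measure_of)
qed

lemma open_paths_in_sets: "open_paths U \<Longrightarrow> U \<in> sets path_borel"
  by (auto simp: path_borel_def open_paths_def)

lemma measurable_path_eval [measurable]:
  "(\<lambda>\<omega>. \<omega> s) \<in> borel_measurable (path_borel :: (real \<Rightarrow> 'a::euclidean_space) measure)"
proof (rule borel_measurableI)
  fix S :: "'a set" assume "open S"
  have "open_paths {\<omega> \<in> paths. \<omega> s \<in> S}"
    unfolding open_paths_def
  proof safe
    fix \<omega> :: "real \<Rightarrow> 'a" assume "\<omega> s \<in> S" "\<omega> \<in> paths"
    with \<open>open S\<close> obtain e where "e > 0" "\<And>y. dist y (\<omega> s) < e \<Longrightarrow> y \<in> S"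
      by (auto simp: open_dist)
    thus "\<exists>K e. compact K \<and> 0 < e \<and> {\<omega>' \<in> paths. \<forall>s\<in>K. dist (\<omega>' s) (\<omega> s) < e}
          \<subseteq> {\<omega> \<in> paths. \<omega> s \<in> S}"
      by (intro exI[of _ "{s}"] exI[of _ e]) auto
  qed
  from open_paths_in_sets[OF this]
  show "(\<lambda>\<omega>. \<omega> s) -` S \<inter> space path_borel \<in> sets path_borel"
    by (simp add: vimage_def Int_def conj_commute)
qed

text \<open>
  Tubes are tested at rational times only, so they belong to the sigma-algebra generated by the
  evaluation maps. Their axes \<open>c\<close> are step functions rather than paths.
\<close>

definition tube :: "(real \<Rightarrow> 'a::euclidean_space) \<Rightarrow> nat \<Rightarrow> nat \<Rightarrow> (real \<Rightarrow> 'a) set" where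
  "tube c n m = {\<omega> \<in> paths. \<forall>q\<in>\<rat> \<inter> {- real n..real n}. dist (\<omega> q) (c q) < 1 / Suc m}"

definition step_fun :: "nat \<Rightarrow> nat \<Rightarrow> 'a list \<Rightarrow> real \<Rightarrow> 'a" where
  "step_fun n k xs q = xs ! nat \<lfloor>(q + n) * k\<rfloor>"

text \<open>
  By uniform continuity a path is close to a step function with values in the dense set \<open>D\<close>, and
  closeness at rational times extends to all times by continuity. For countable \<open>D\<close> these tubes are
  countably many, so every open set is a countable union of tubes.
\<close>

lemma open_paths_contains_tube:
  fixes U :: "(real \<Rightarrow> 'a::euclidean_space) set"
  assumes U: "open_paths U" and \<omega>: "\<omega> \<in> U"
    and D: "\<And>S :: 'a set. open S \<Longrightarrow> S \<noteq> {} \<Longrightarrow> \<exists>d\<in>D. d \<in> S"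
  shows "\<exists>n k m. \<exists>xs\<in>lists D. \<omega> \<in> tube (step_fun n k xs) n m \<and> tube (step_fun n k xs) n m \<subseteq> U"
proof -
  have wp: "\<omega> \<in> paths" using U \<omega> by (auto simp: open_paths_def)
  obtain K e where K: "compact K" "e > 0" "{\<omega>' \<in> paths. \<forall>s\<in>K. dist (\<omega>' s) (\<omega> s) < e} \<subseteq> U"
    using U \<omega> unfolding open_paths_def by blast
  obtain r where r: "\<And>s. s \<in> K \<Longrightarrow> \<bar>s\<bar> \<le> r"
    using compact_imp_bounded[OF K(1)] by (auto simp: bounded_iff)
  obtain n :: nat where n: "r < n" using reals_Archimedean2 by blast
  obtain m :: nat where "inverse (real (Suc m)) < e / 3"
    using reals_Archimedean[of "e / 3"] K(2) by auto
  hence m: "1 / Suc m < e / 3" by (simp add: inverse_eq_divide)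
  define e' where "e' = 1 / real (Suc m)"
  have e': "e' > 0" by (simp add: e'_def)
  have "uniformly_continuous_on {- real n - 1..real n + 1} \<omega>"
    using wp by (intro compact_uniformly_continuous) (auto simp: paths_def intro: continuous_on_subset)
  then obtain d where d: "d > 0"
    "\<And>s s'. s \<in> {- real n - 1..real n + 1} \<Longrightarrow> s' \<in> {- real n - 1..real n + 1} \<Longrightarrow> dist s' s < d
       \<Longrightarrow> dist (\<omega> s') (\<omega> s) < e' / 2"
    unfolding uniformly_continuous_on_def using e' by (metis half_gt_zero)
  obtain k0 :: nat where "inverse (real (Suc k0)) < d" using reals_Archimedean[OF d(1)] by auto
  define k where "k = Suc k0"
  have k: "1 / real k < d" "k > 0" using \<open>inverse (real (Suc k0)) < d\<close> by (auto simp: k_def inverse_eq_divide)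
  have "\<exists>y\<in>D. dist y (\<omega> (- real n + j / k)) < e' / 2" for j :: nat
    using D[of "ball (\<omega> (- real n + j / k)) (e' / 2)"] e' by (auto simp: dist_commute)
  then obtain y where y: "\<And>j :: nat. y j \<in> D" "\<And>j. dist (y j) (\<omega> (- real n + j / k)) < e' / 2"
    by metis
  define xs where "xs = map y [0..<Suc (2 * n * k)]"
  have xsD: "xs \<in> lists D" using y by (auto simp: xs_def)
  have close: "dist (\<omega> q) (step_fun n k xs q) < e'" if q: "q \<in> {- real n..real n}" for q
  proof -
    define j where "j = nat \<lfloor>(q + n) * k\<rfloor>"
    have j0: "0 \<le> (q + n) * k" using q by simp
    have j1: "real j \<le> (q + n) * k" "(q + n) * k < real j + 1" using j0 by (auto simp: j_def)
    have "(q + n) * k \<le> (2 * real n) * real k" using q by (intro mult_right_mono) auto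
    hence "real j \<le> real (2 * n * k)" using j1 by simp
    hence "j \<le> 2 * n * k" by linarith
    hence s: "step_fun n k xs q = y j"
      unfolding step_fun_def j_def[symmetric] xs_def by (subst nth_map) (auto simp del: upt_Suc)
    have l1: "j / k \<le> q + n" and l2: "q + n < j / k + 1 / k"
      using j1 k(2) by (auto simp: field_simps)
    have "\<bar>q - (- real n + j / k)\<bar> \<le> 1 / k" using l1 l2 by linarith
    hence "dist q (- real n + j / k) < d" using k(1) by (simp add: dist_real_def)
    moreover have "0 \<le> real j / real k" by simp
    hence "- real n + j / k \<in> {- real n - 1..real n + 1}" using l1 q by (simp only: atLeastAtMost_iff) linarith
    moreover have "q \<in> {- real n - 1..real n + 1}"
      using q by auto
    ultimately have "dist (\<omega> q) (\<omega> (- real n + j / k)) < e' / 2" using d(2) by blast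
    moreover have "dist (y j) (\<omega> (- real n + j / k)) < e' / 2" by (rule y)
    ultimately show ?thesis unfolding s by (smt (verit) dist_triangle_half_r dist_commute)
  qed
  have "\<omega> \<in> tube (step_fun n k xs) n m" using close wp by (auto simp: tube_def e'_def)
  moreover have "tube (step_fun n k xs) n m \<subseteq> U"
  proof
    fix w assume w: "w \<in> tube (step_fun n k xs) n m"
    hence wP: "w \<in> paths" by (simp add: tube_def)
    have cont: "continuous_on UNIV (\<lambda>s. dist (w s) (\<omega> s))"
      using wP wp by (auto simp: paths_def intro!: continuous_intros)
    have "dist (w s) (\<omega> s) < e" if s: "s \<in> K" for s
    proof (rule ccontr)
      assume "\<not> ?thesis"
      hence gt: "2 * e' < dist (w s) (\<omega> s)" using m K(2) by (simp add: e'_def)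
      have "open {s. 2 * e' < dist (w s) (\<omega> s)}"
        by (intro open_Collect_less cont continuous_intros)
      hence "open ({s. 2 * e' < dist (w s) (\<omega> s)} \<inter> {- real n<..<real n})" by auto
      moreover have "s \<in> {s. 2 * e' < dist (w s) (\<omega> s)} \<inter> {- real n<..<real n}"
        using gt r[OF s] n by auto
      ultimately obtain d where d: "d > 0" "ball s d \<subseteq> {s. 2 * e' < dist (w s) (\<omega> s)} \<inter> {- real n<..<real n}"
        by (meson openE)
      obtain q where q: "q \<in> \<rat>" "s < q" "q < s + d" using Rats_dense_in_real[of s "s + d"] d(1) by auto
      have "q \<in> ball s d" using q by (simp add: dist_real_def)
      hence "2 * e' < dist (w q) (\<omega> q)" "q \<in> {- real n..real n}" using d by auto
      moreover have "dist (w q) (step_fun n k xs q) < e'" using w q calculation by (auto simp: tube_def e'_def)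
      moreover have "dist (\<omega> q) (step_fun n k xs q) < e'" using close calculation by blast
      ultimately show False using dist_triangle2[of "w q" "\<omega> q" "step_fun n k xs q"] by linarith
    qed
    thus "w \<in> U" using K(3) wP by auto
  qed
  ultimately show ?thesis using xsD by blast
qed

text \<open>
  The preimage of an open set is a countable union of preimages of tubes, and each of these involves
  countably many evaluations.
\<close>

lemma measurable_into_path_borel:
  fixes f :: "'b \<Rightarrow> real \<Rightarrow> 'a::euclidean_space"
  assumes f: "\<And>x. x \<in> space M \<Longrightarrow> f x \<in> paths"
    and ev: "\<And>s. (\<lambda>x. f x s) \<in> borel_measurable M"
  shows "f \<in> M \<rightarrow>\<^sub>M path_borel"
  unfolding path_borel_def
proof (rule measurable_measure_of)
  show "{U. open_paths U} \<subseteq> Pow paths" by (auto simp: open_paths_def)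
  show "f \<in> space M \<rightarrow> paths" using f by auto
  fix U :: "(real \<Rightarrow> 'a) set" assume "U \<in> {U. open_paths U}"
  hence U: "open_paths U" by simp
  obtain D :: "'a set" where D: "countable D" "\<And>S. open S \<Longrightarrow> S \<noteq> {} \<Longrightarrow> \<exists>d\<in>D. d \<in> S"
    using countable_dense_setE by blast
  define J where "J = {(n, k, m, xs). xs \<in> lists D \<and> tube (step_fun n k xs) n m \<subseteq> U}"
  have "J \<subseteq> UNIV \<times> UNIV \<times> UNIV \<times> lists D" by (auto simp: J_def)
  moreover have "countable (UNIV \<times> UNIV \<times> UNIV \<times> lists D :: (nat \<times> nat \<times> nat \<times> 'a list) set)"
    using D(1) by auto
  ultimately have cJ: "countable J" using countable_subset by blast
  have "U = (\<Union>(n, k, m, xs)\<in>J. tube (step_fun n k xs) n m)"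
  proof (intro equalityI subsetI)
    fix \<omega> assume "\<omega> \<in> U"
    from open_paths_contains_tube[OF U this D(2)]
    show "\<omega> \<in> (\<Union>(n, k, m, xs)\<in>J. tube (step_fun n k xs) n m)" by (auto simp: J_def)
  qed (auto simp: J_def)
  hence "f -` U \<inter> space M = (\<Union>(n, k, m, xs)\<in>J. f -` tube (step_fun n k xs) n m \<inter> space M)"
    by auto
  also have "\<dots> \<in> sets M"
  proof (rule sets.countable_UN'[OF cJ], clarify)
    fix n k m xs
    have "{x \<in> space M. \<forall>q\<in>\<rat> \<inter> {- real n..real n}. dist (f x q) (step_fun n k xs q) < 1 / Suc m} \<in> sets M"
      by (intro sets.sets_Collect_countable_All') (use ev in \<open>auto simp: countable_rat intro: countable_Int1\<close>)
    moreover have "f -` tube (step_fun n k xs) n m \<inter> space M =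
       {x \<in> space M. \<forall>q\<in>\<rat> \<inter> {- real n..real n}. dist (f x q) (step_fun n k xs q) < 1 / Suc m}"
      using f by (auto simp: tube_def)
    ultimately show "f -` tube (step_fun n k xs) n m \<inter> space M \<in> sets M" by simp
  qed
  finally show "f -` U \<inter> space M \<in> sets M" .
qed

definition cylinder :: "real set \<Rightarrow> (real \<Rightarrow> 'a::euclidean_space set) \<Rightarrow> (real \<Rightarrow> 'a) set" where
  "cylinder F A = {\<omega> \<in> paths. \<forall>u\<in>F. \<omega> u \<in> A u}"

definition cylinders :: "(real \<Rightarrow> 'a::euclidean_space) set set" where
  "cylinders = {cylinder F A | F A. finite F \<and> (\<forall>u. A u \<in> sets borel)}"

lemma Int_stable_cylinders: "Int_stable cylinders"
proof (rule Int_stableI)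
  fix a b :: "(real \<Rightarrow> 'a) set" assume "a \<in> cylinders" "b \<in> cylinders"
  then obtain F A G B where a: "a = cylinder F A" "finite F" "\<And>u. A u \<in> sets borel"
    and b: "b = cylinder G B" "finite G" "\<And>u. B u \<in> sets borel" by (auto simp: cylinders_def)
  have "a \<inter> b = cylinder (F \<union> G) (\<lambda>u. (if u \<in> F then A u else UNIV) \<inter> (if u \<in> G then B u else UNIV))"
    by (auto simp: a b cylinder_def)
  moreover have "finite (F \<union> G)" using a b by simp
  moreover have "(if u \<in> F then A u else UNIV) \<inter> (if u \<in> G then B u else UNIV) \<in> sets borel" for u
    using a(3)[of u] b(3)[of u] by auto
  ultimately show "a \<inter> b \<in> cylinders" unfolding cylinders_def by blast
qed

lemma cylinder_in_sets: "finite F \<Longrightarrow> (\<And>u. A u \<in> sets borel) \<Longrightarrow> cylinder F A \<in> sets path_borel"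
proof -
  assume F: "finite F" and A: "\<And>u. A u \<in> sets borel"
  have "{\<omega> \<in> space path_borel. \<forall>u\<in>F. \<omega> u \<in> A u} \<in> sets path_borel"
  proof (rule sets.sets_Collect_finite_All[OF _ F])
    fix u
    show "{\<omega> \<in> space path_borel. \<omega> u \<in> A u} \<in> sets path_borel"
      using measurable_sets[OF measurable_path_eval[of u] A[of u]]
      by (simp add: vimage_def Int_def conj_commute)
  qed
  thus ?thesis by (simp add: cylinder_def)
qed

lemma sets_path_borel_cylinders: "sets path_borel = sigma_sets paths cylinders"
proof
  have Pow: "cylinders \<subseteq> Pow paths" by (auto simp: cylinders_def cylinder_def)
  let ?N = "sigma paths cylinders :: (real \<Rightarrow> 'a) measure"
  have "(\<lambda>\<omega>. \<omega>) \<in> ?N \<rightarrow>\<^sub>M path_borel"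
  proof (rule measurable_into_path_borel)
    fix s :: real
    show "(\<lambda>\<omega>. \<omega> s) \<in> borel_measurable ?N"
    proof (rule measurableI)
      fix A :: "'a set" assume "A \<in> sets borel"
      hence "cylinder {s} (\<lambda>_. A) \<in> cylinders" unfolding cylinders_def by blast
      moreover have "(\<lambda>\<omega>. \<omega> s) -` A \<inter> space ?N = cylinder {s} (\<lambda>_. A)"
        unfolding space_measure_of[OF Pow] by (auto simp: cylinder_def)
      ultimately show "(\<lambda>\<omega>. \<omega> s) -` A \<inter> space ?N \<in> sets ?N" using Pow by (auto simp: sets_measure_of)
    qed auto
  qed (simp add: space_measure_of_conv)
  show "sets path_borel \<subseteq> sigma_sets paths (cylinders :: (real \<Rightarrow> 'a) set set)"
  proof
    fix A :: "(real \<Rightarrow> 'a) set" assume A: "A \<in> sets path_borel"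
    have "(\<lambda>\<omega>. \<omega>) -` A \<inter> space ?N \<in> sets ?N"
      using \<open>(\<lambda>\<omega>. \<omega>) \<in> ?N \<rightarrow>\<^sub>M path_borel\<close> A by (rule measurable_sets)
    moreover have "A \<subseteq> paths" using sets.sets_into_space[OF A] by simp
    ultimately show "A \<in> sigma_sets paths cylinders"
      by (simp add: space_measure_of_conv sets_measure_of[OF Pow] Int_absorb2)
  qed
  have "c \<in> sets (path_borel :: (real \<Rightarrow> 'a) measure)" if "c \<in> cylinders" for c
    using that cylinder_in_sets unfolding cylinders_def by blast
  hence "cylinders \<subseteq> sets (path_borel :: (real \<Rightarrow> 'a) measure)" by blast
  from sets.sigma_sets_subset[OF this]
  show "sigma_sets paths cylinders \<subseteq> sets (path_borel :: (real \<Rightarrow> 'a) measure)" by simp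
qed

lemma path_measure_eqI:
  fixes M N :: "(real \<Rightarrow> 'a::euclidean_space) measure"
  assumes "finite_measure M" and sets: "sets M = sets path_borel" "sets N = sets path_borel"
    and eq: "\<And>F A. finite F \<Longrightarrow> (\<And>u. A u \<in> sets borel) \<Longrightarrow> emeasure M (cylinder F A) = emeasure N (cylinder F A)"
  shows "M = N"
proof (rule measure_eqI_generator_eq[OF Int_stable_cylinders, where \<Omega> = paths and A = "\<lambda>_. paths"])
  show "cylinders \<subseteq> Pow paths" by (auto simp: cylinders_def cylinder_def)
  show "sets M = sigma_sets paths cylinders" "sets N = sigma_sets paths cylinders"
    using sets by (simp_all add: sets_path_borel_cylinders)
  have "paths = (cylinder {} (\<lambda>_. UNIV) :: (real \<Rightarrow> 'a) set)" by (simp add: cylinder_def)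
  also have "\<dots> \<in> cylinders" unfolding cylinders_def by (rule CollectI) (intro exI conjI, auto)
  finally show "range (\<lambda>_::nat. paths) \<subseteq> (cylinders :: (real \<Rightarrow> 'a) set set)" by blast
  show "\<Union> (range (\<lambda>_::nat. paths)) = (paths :: (real \<Rightarrow> 'a) set)" by simp
  show "emeasure M paths \<noteq> \<infinity>" using assms(1) by (simp add: finite_measure.emeasure_finite)
qed (use eq in \<open>auto simp: cylinders_def\<close>)

lemma (in prob_space) indep_var_path_borelI:
  fixes X Y :: "'a \<Rightarrow> real \<Rightarrow> 'b::euclidean_space"
  assumes X: "X \<in> M \<rightarrow>\<^sub>M path_borel" and Y: "Y \<in> M \<rightarrow>\<^sub>M path_borel"
    and eq: "\<And>F A G B. finite F \<Longrightarrow> (\<And>u. A u \<in> sets borel) \<Longrightarrow> finite G \<Longrightarrow> (\<And>u. B u \<in> sets borel) \<Longrightarrow>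
        prob ((X -` cylinder F A \<inter> space M) \<inter> (Y -` cylinder G B \<inter> space M)) =
        prob (X -` cylinder F A \<inter> space M) * prob (Y -` cylinder G B \<inter> space M)"
  shows "indep_var path_borel X path_borel Y"
proof -
  have gen: "{Z -` A \<inter> space M |A. A \<in> sets path_borel} = sigma_sets (space M) {Z -` A \<inter> space M |A. A \<in> cylinders}"
    if Z: "Z \<in> M \<rightarrow>\<^sub>M path_borel" for Z :: "'a \<Rightarrow> real \<Rightarrow> 'b"
    unfolding sets_path_borel_cylinders
    by (rule sigma_sets_vimage_commute) (use measurable_space[OF Z] in auto)
  have st: "Int_stable {Z -` A \<inter> space M |A. A \<in> cylinders}" for Z :: "'a \<Rightarrow> real \<Rightarrow> 'b"
  proof (rule Int_stableI)
    fix a b assume "a \<in> {Z -` A \<inter> space M |A. A \<in> cylinders}" "b \<in> {Z -` A \<inter> space M |A. A \<in> cylinders}"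
    then obtain A B where AB: "a = Z -` A \<inter> space M" "b = Z -` B \<inter> space M" "A \<in> cylinders" "B \<in> cylinders" by auto
    have "a \<inter> b = Z -` (A \<inter> B) \<inter> space M" using AB by auto
    moreover have "A \<inter> B \<in> cylinders" using Int_stable_cylinders AB by (auto simp: Int_stable_def)
    ultimately show "a \<inter> b \<in> {Z -` A \<inter> space M |A. A \<in> cylinders}" by blast
  qed
  have cs: "A \<in> cylinders \<Longrightarrow> A \<in> sets path_borel" for A :: "(real \<Rightarrow> 'b) set"
    using cylinder_in_sets by (auto simp: cylinders_def)
  have "indep_set {X -` A \<inter> space M |A. A \<in> cylinders} {Y -` A \<inter> space M |A. A \<in> cylinders}"
    unfolding indep_sets2_eq
  proof (intro conjI ballI)
    show "{X -` A \<inter> space M |A. A \<in> cylinders} \<subseteq> events" using measurable_sets[OF X] cs by auto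
    show "{Y -` A \<inter> space M |A. A \<in> cylinders} \<subseteq> events" using measurable_sets[OF Y] cs by auto
    fix a b assume "a \<in> {X -` A \<inter> space M |A. A \<in> cylinders}" "b \<in> {Y -` A \<inter> space M |A. A \<in> cylinders}"
    thus "prob (a \<inter> b) = prob a * prob b" using eq by (auto simp: cylinders_def)
  qed
  hence "indep_set (sigma_sets (space M) {X -` A \<inter> space M |A. A \<in> cylinders})
      (sigma_sets (space M) {Y -` A \<inter> space M |A. A \<in> cylinders})"
    by (intro indep_set_sigma_sets st)
  thus ?thesis unfolding indep_var_eq gen[OF X] gen[OF Y]
    using X Y by (subst (1 2) sigma_sets_sigma_sets_eq) auto
qed

section \<open>Shift invariance and independence of past and future\<close>

text \<open>
  The increments of a path over a finite set of times are those of an increasing enumeration \<open>\<tau>\<close>; \<open>k\<close>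
  finds the index of a time.
\<close>

lemma finite_set_increasing_enumeration:
  fixes G :: "real set"
  assumes "finite G" "x \<in> G" "y \<in> G" "x < y"
  obtains n \<tau> k where "n > 0" "\<And>i. i < n \<Longrightarrow> \<tau> i < \<tau> (Suc i)"
    "\<And>u. u \<in> G \<Longrightarrow> k u \<le> n \<and> \<tau> (k u) = (u :: real)"
    "\<And>u v. u \<in> G \<Longrightarrow> v \<in> G \<Longrightarrow> u \<le> v \<Longrightarrow> k u \<le> (k v :: nat)"
proof -
  define l where "l = sorted_list_of_set G"
  have l: "set l = G" "sorted_wrt (<) l" using assms by (auto simp: l_def)
  have "card G \<ge> 2"
    using assms card_mono[of G "{x, y}"] by auto
  hence len: "length l \<ge> 2" by (simp add: l_def)
  have "\<exists>i. i < length l \<and> l ! i = u" if "u \<in> G" for u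
    using that l by (metis in_set_conv_nth)
  then obtain k where k: "\<And>u. u \<in> G \<Longrightarrow> k u < length l \<and> l ! k u = u" by metis
  have mono: "k u \<le> k v" if "u \<in> G" "v \<in> G" "u \<le> v" for u v
    using sorted_wrt_nth_less[OF l(2), of "k v" "k u"] k[of u] k[of v] that by force
  show ?thesis
  proof (rule that[of "length l - 1" "\<lambda>i. l ! i" k])
    show "l ! i < l ! Suc i" if "i < length l - 1" for i
      using that by (intro sorted_wrt_nth_less[OF l(2)]) auto
  qed (use len k mono in fastforce)+
qed

lemma preimage_event:
  "f \<in> borel_measurable N \<Longrightarrow> A \<in> sets borel \<Longrightarrow> {d \<in> space N. f d \<in> A} \<in> sets N"
  using measurable_sets[of f N borel A] by (simp add: vimage_def Int_def conj_commute)

text \<open>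
  Past and future are normalised at time \<open>t\<close>, so that both are functions of increments and
  each is frozen on the other side of \<open>t\<close>.
\<close>

definition past :: "real \<Rightarrow> (real \<Rightarrow> 'a::euclidean_space) \<Rightarrow> real \<Rightarrow> 'a" where
  "past t \<omega> = (\<lambda>s. \<omega> (min s t) - \<omega> t)"

definition future :: "real \<Rightarrow> (real \<Rightarrow> 'a::euclidean_space) \<Rightarrow> real \<Rightarrow> 'a" where
  "future t \<omega> = (\<lambda>s. \<omega> (max s t) - \<omega> t)"

lemma paths_compose: "\<omega> \<in> paths \<Longrightarrow> continuous_on UNIV f \<Longrightarrow> (\<lambda>s. \<omega> (f s) - c) \<in> paths"
  unfolding paths_def by (auto intro!: continuous_intros continuous_on_compose2[of UNIV \<omega>])

lemma shift_in_paths [simp]: "\<omega> \<in> paths \<Longrightarrow> shift t \<omega> \<in> paths"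
  unfolding shift_def by (intro paths_compose continuous_intros)

lemma past_in_paths [simp]: "\<omega> \<in> paths \<Longrightarrow> past t \<omega> \<in> paths"
  unfolding past_def by (intro paths_compose continuous_intros)

lemma future_in_paths [simp]: "\<omega> \<in> paths \<Longrightarrow> future t \<omega> \<in> paths"
  unfolding future_def by (intro paths_compose continuous_intros)

lemma shift_shift: "shift s (shift t \<omega>) = shift (s + t) \<omega>"
  by (auto simp: shift_def fun_eq_iff add.assoc)

lemma measurable_shift [measurable]: "shift t \<in> path_borel \<rightarrow>\<^sub>M path_borel"
  by (rule measurable_into_path_borel) (simp, simp add: shift_def)

lemma measurable_past [measurable]: "past t \<in> path_borel \<rightarrow>\<^sub>M path_borel"
  by (rule measurable_into_path_borel) (simp, simp add: past_def)

lemma measurable_future [measurable]: "future t \<in> path_borel \<rightarrow>\<^sub>M path_borel"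
  by (rule measurable_into_path_borel) (simp, simp add: future_def)

locale wiener =
  fixes P :: "(real \<Rightarrow> 'a::euclidean_space) measure"
  assumes wiener: "two_sided_wiener_measure P"
begin

sublocale prob_space P using wiener by (simp add: two_sided_wiener_measure_def)

lemma sets_P [simp, measurable_cong]: "sets P = sets path_borel"
  using wiener by (simp add: two_sided_wiener_measure_def)

lemma space_P [simp]: "space P = paths"
  using sets_eq_imp_space_eq[OF sets_P] by simp

lemma AE_zero: "AE \<omega> in P. \<omega> 0 = 0"
  using wiener by (simp add: two_sided_wiener_measure_def)

definition gauss :: "real \<Rightarrow> 'a measure" where
  "gauss d = density lborel (\<lambda>x. ennreal (\<Prod>i\<in>Basis. normal_density 0 (sqrt d) (x \<bullet> i)))"

lemma distr_increment: "s < t \<Longrightarrow> distr P borel (\<lambda>\<omega>. \<omega> t - \<omega> s) = gauss (t - s)"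
proof -
  assume "s < t"
  hence "distributed P lborel (\<lambda>\<omega>. \<omega> t - \<omega> s)
          (\<lambda>x. ennreal (\<Prod>i\<in>Basis. normal_density 0 (sqrt (t - s)) (x \<bullet> i)))"
    using wiener by (simp add: two_sided_wiener_measure_def)
  from distributed_distr_eq_density[OF this] show ?thesis
    by (simp add: gauss_def cong: distr_cong)
qed

lemma indep_increments:
  "(\<And>i. i < n \<Longrightarrow> \<tau> i < \<tau> (Suc i)) \<Longrightarrow> indep_vars (\<lambda>_. borel) (\<lambda>i \<omega>. \<omega> (\<tau> (Suc i)) - \<omega> (\<tau> i)) {..<n}"
  using wiener by (simp add: two_sided_wiener_measure_def)

definition increments :: "(nat \<Rightarrow> real) \<Rightarrow> nat set \<Rightarrow> (real \<Rightarrow> 'a) \<Rightarrow> nat \<Rightarrow> 'a" where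
  "increments \<tau> I \<omega> = (\<lambda>i\<in>I. \<omega> (\<tau> (Suc i)) - \<omega> (\<tau> i))"

lemma measurable_increments [measurable]: "increments \<tau> I \<in> path_borel \<rightarrow>\<^sub>M PiM I (\<lambda>_. borel)"
  unfolding increments_def by (intro measurable_restrict) measurable

lemma distr_increments:
  assumes "n > 0" "\<And>i. i < n \<Longrightarrow> \<tau> i < \<tau> (Suc i)"
  shows "distr P (PiM {..<n} (\<lambda>_. borel)) (increments \<tau> {..<n}) = PiM {..<n} (\<lambda>i. gauss (\<tau> (Suc i) - \<tau> i))"
proof -
  have "distr P (PiM {..<n} (\<lambda>_. borel)) (increments \<tau> {..<n})
      = PiM {..<n} (\<lambda>i. distr P borel (\<lambda>\<omega>. \<omega> (\<tau> (Suc i)) - \<omega> (\<tau> i)))"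
    unfolding increments_def
    using indep_increments[of n \<tau>] assms
    by (subst indep_vars_iff_distr_eq_PiM[symmetric]) auto
  also have "\<dots> = PiM {..<n} (\<lambda>i. gauss (\<tau> (Suc i) - \<tau> i))"
    using assms by (intro PiM_cong distr_increment) auto
  finally show ?thesis .
qed

lemma sum_increments:
  assumes "a \<le> b"
  shows "(\<Sum>i\<in>{a..<b}. \<omega> (\<tau> (Suc i)) - \<omega> (\<tau> i)) = \<omega> (\<tau> b) - (\<omega> (\<tau> a) :: 'a)"
  using sum_Suc_diff'[OF assms, of "\<lambda>i. \<omega> (\<tau> i)"] .

text \<open>
  The shifted path is a fixed function of the increments over the shifted times, and their joint law depends on the
  differences of the times only.
\<close>

lemma emeasure_shift_cylinder:
  fixes A :: "real \<Rightarrow> 'a set"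
  assumes F: "finite F" and A: "\<And>u. A u \<in> sets borel"
  shows "emeasure (distr P path_borel (shift s)) (cylinder F A) = emeasure (distr P path_borel (shift 0)) (cylinder F A)"
proof -
  obtain n \<tau> k where n: "n > 0" and \<tau>: "\<And>i. i < n \<Longrightarrow> \<tau> i < \<tau> (Suc i)"
    and k: "\<And>u. u \<in> F \<union> {0, 1} \<Longrightarrow> k u \<le> n \<and> \<tau> (k u) = u"
  proof (rule finite_set_increasing_enumeration[of "F \<union> {0, 1}" 0 1])
    show "finite (F \<union> {0, 1})" using F by simp
  qed (use that in auto)
  define C where "C = {d \<in> space (PiM {..<n} (\<lambda>_. borel)). \<forall>u\<in>F. (\<Sum>i<k u. d i) - (\<Sum>i<k 0. d i) \<in> A u}"
  have C: "C \<in> sets (PiM {..<n} (\<lambda>_. borel))"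
    unfolding C_def
  proof (rule sets.sets_Collect_finite_All[OF _ F])
    fix u assume u: "u \<in> F"
    show "{d \<in> space (PiM {..<n} (\<lambda>_. borel)). (\<Sum>i<k u. d i) - (\<Sum>i<k 0. d i) \<in> A u} \<in> sets (PiM {..<n} (\<lambda>_. borel))"
      using k[of u] k[of 0] u by (intro preimage_event A borel_measurable_diff borel_measurable_sum measurable_component_singleton) auto
  qed
  have "emeasure (distr P path_borel (shift s)) (cylinder F A) =
      emeasure (PiM {..<n} (\<lambda>i. gauss (\<tau> (Suc i) - \<tau> i))) C" for s
  proof -
    define \<tau>' where "\<tau>' i = \<tau> i + s" for i
    have iff: "shift s \<omega> \<in> cylinder F A \<longleftrightarrow> increments \<tau>' {..<n} \<omega> \<in> C" if "\<omega> \<in> paths" for \<omega>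
    proof -
      have s1: "(\<Sum>i<k u. increments \<tau>' {..<n} \<omega> i) = \<omega> (u + s) - \<omega> (\<tau>' 0)" if "u \<in> F \<union> {0}" for u
      proof -
        have ku: "k u \<le> n" "\<tau> (k u) = u" using k[of u] that by auto
        have "(\<Sum>i<k u. increments \<tau>' {..<n} \<omega> i) = (\<Sum>i\<in>{0..<k u}. \<omega> (\<tau>' (Suc i)) - \<omega> (\<tau>' i))"
          using ku by (intro sum.cong) (auto simp: increments_def)
        also have "\<dots> = \<omega> (\<tau>' (k u)) - \<omega> (\<tau>' 0)" by (rule sum_increments) simp
        finally show ?thesis using ku by (simp add: \<tau>'_def)
      qed
      have "increments \<tau>' {..<n} \<omega> \<in> space (PiM {..<n} (\<lambda>_. borel))"
        using measurable_space[OF measurable_increments] that by simp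
      moreover have "(\<Sum>i<k u. increments \<tau>' {..<n} \<omega> i) - (\<Sum>i<k 0. increments \<tau>' {..<n} \<omega> i) = shift s \<omega> u" if "u \<in> F" for u
        using s1[of u] s1[of 0] that by (simp add: shift_def)
      ultimately show ?thesis using that by (auto simp: C_def cylinder_def)
    qed
    have "emeasure (distr P path_borel (shift s)) (cylinder F A) = emeasure P (shift s -` cylinder F A \<inter> space P)"
      using cylinder_in_sets[OF F A] by (intro emeasure_distr) auto
    also have "shift s -` cylinder F A \<inter> space P = increments \<tau>' {..<n} -` C \<inter> space P"
      using iff by auto
    also have "emeasure P \<dots> = emeasure (distr P (PiM {..<n} (\<lambda>_. borel)) (increments \<tau>' {..<n})) C"
      using C by (intro emeasure_distr[symmetric]) auto
    also have "distr P (PiM {..<n} (\<lambda>_. borel)) (increments \<tau>' {..<n}) = PiM {..<n} (\<lambda>i. gauss (\<tau>' (Suc i) - \<tau>' i))"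
      using \<tau> by (intro distr_increments n) (auto simp: \<tau>'_def)
    finally show ?thesis by (simp add: \<tau>'_def)
  qed
  thus ?thesis by metis
qed

lemma distr_shift: "distr P P (shift t) = P"
proof -
  have "distr P path_borel (shift t) = distr P path_borel (shift 0)"
    by (rule path_measure_eqI)
      (auto intro!: prob_space.finite_measure prob_space_distr emeasure_shift_cylinder)
  also have "\<dots> = distr P path_borel (\<lambda>\<omega>. \<omega>)"
    using AE_zero by (intro distr_cong_AE) (auto simp: shift_def)
  also have "\<dots> = P" by (rule distr_id2) simp
  finally show ?thesis by (simp cong: distr_cong)
qed

lemma AE_shift: "(AE \<omega> in P. Q \<omega>) \<Longrightarrow> AE \<omega> in P. Q (shift t \<omega>)"
proof -
  assume Q: "AE \<omega> in P. Q \<omega>"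
  have m: "shift t \<in> P \<rightarrow>\<^sub>M P" by simp
  show "AE \<omega> in P. Q (shift t \<omega>)" by (rule AE_distrD[OF m]) (simp only: distr_shift Q)
qed

lemma emeasure_shift: "A \<in> sets P \<Longrightarrow> emeasure P (shift t -` A \<inter> space P) = emeasure P A"
  using emeasure_distr[of "shift t" P P A] by (simp add: distr_shift del: sets_P)

lemma prob_shift: "A \<in> sets P \<Longrightarrow> prob (shift t -` A \<inter> space P) = prob A"
  using emeasure_shift[of A t] by (simp add: measure_def)

text \<open>
  On cylinders, the past is a function of the increments before \<open>t\<close> and the future of those after \<open>t\<close>;
  the time \<open>t\<close> is made one of the grid points.
\<close>

lemma past_future_independent: "indep_var path_borel (past t) path_borel (future t)"
proof (rule indep_var_path_borelI)
  fix F G :: "real set" and A B :: "real \<Rightarrow> 'a set"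
  assume F: "finite F" and A: "\<And>u. A u \<in> sets borel" and G: "finite G" and B: "\<And>u. B u \<in> sets borel"
  define H where "H = (\<lambda>u. min u t) ` F \<union> (\<lambda>u. max u t) ` G \<union> {t, t + 1}"
  have H: "finite H" "t \<in> H" "t + 1 \<in> H" using F G by (auto simp: H_def)
  obtain n \<tau> k where n: "n > 0" and \<tau>: "\<And>i. i < n \<Longrightarrow> \<tau> i < \<tau> (Suc i)"
    and k: "\<And>u. u \<in> H \<Longrightarrow> k u \<le> n \<and> \<tau> (k u) = u"
    and km: "\<And>u v. u \<in> H \<Longrightarrow> v \<in> H \<Longrightarrow> u \<le> v \<Longrightarrow> k u \<le> k v"
    using finite_set_increasing_enumeration[OF H] by (metis less_add_one)
  define m where "m = k t"
  have m: "m \<le> n" "\<tau> m = t" using k[of t] H by (auto simp: m_def)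
  define I J where "I = {..<m}" and "J = {m..<n}"
  define C where "C = {d \<in> space (PiM I (\<lambda>_. borel)). \<forall>u\<in>F. - (\<Sum>i\<in>{k (min u t)..<m}. d i) \<in> A u}"
  define D where "D = {d \<in> space (PiM J (\<lambda>_. borel)). \<forall>u\<in>G. (\<Sum>i\<in>{m..<k (max u t)}. d i) \<in> B u}"
  have C: "C \<in> sets (PiM I (\<lambda>_. borel))"
    unfolding C_def
  proof (rule sets.sets_Collect_finite_All[OF _ F])
    fix u assume u: "u \<in> F"
    show "{d \<in> space (PiM I (\<lambda>_. borel)). - (\<Sum>i\<in>{k (min u t)..<m}. d i) \<in> A u} \<in> sets (PiM I (\<lambda>_. borel))"
      by (intro preimage_event A borel_measurable_uminus borel_measurable_sum measurable_component_singleton) (auto simp: I_def)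
  qed
  have D: "D \<in> sets (PiM J (\<lambda>_. borel))"
    unfolding D_def
  proof (rule sets.sets_Collect_finite_All[OF _ G])
    fix u assume u: "u \<in> G"
    show "{d \<in> space (PiM J (\<lambda>_. borel)). (\<Sum>i\<in>{m..<k (max u t)}. d i) \<in> B u} \<in> sets (PiM J (\<lambda>_. borel))"
      using k[of "max u t"] u
      by (intro preimage_event B borel_measurable_sum measurable_component_singleton) (auto simp: J_def H_def)
  qed
  have iC: "past t \<omega> \<in> cylinder F A \<longleftrightarrow> increments \<tau> I \<omega> \<in> C" if w: "\<omega> \<in> paths" for \<omega>
  proof -
    have "- (\<Sum>i\<in>{k (min u t)..<m}. increments \<tau> I \<omega> i) = past t \<omega> u" if "u \<in> F" for u
    proof -
      have uH: "min u t \<in> H" using that by (auto simp: H_def)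
      have ku: "k (min u t) \<le> m" "\<tau> (k (min u t)) = min u t"
        using k[OF uH] km[OF uH H(2)] by (auto simp: m_def)
      have "(\<Sum>i\<in>{k (min u t)..<m}. increments \<tau> I \<omega> i) = (\<Sum>i\<in>{k (min u t)..<m}. \<omega> (\<tau> (Suc i)) - \<omega> (\<tau> i))"
        by (intro sum.cong) (auto simp: increments_def I_def)
      also have "\<dots> = \<omega> (\<tau> m) - \<omega> (\<tau> (k (min u t)))" using ku by (intro sum_increments) simp
      finally show ?thesis using ku m by (simp add: past_def)
    qed
    moreover have "increments \<tau> I \<omega> \<in> space (PiM I (\<lambda>_. borel))"
      using measurable_space[OF measurable_increments] w by simp
    ultimately show ?thesis using w by (auto simp: C_def cylinder_def)
  qed
  have iD: "future t \<omega> \<in> cylinder G B \<longleftrightarrow> increments \<tau> J \<omega> \<in> D" if w: "\<omega> \<in> paths" for \<omega>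
  proof -
    have "(\<Sum>i\<in>{m..<k (max u t)}. increments \<tau> J \<omega> i) = future t \<omega> u" if "u \<in> G" for u
    proof -
      have uH: "max u t \<in> H" using that by (auto simp: H_def)
      have ku: "m \<le> k (max u t)" "k (max u t) \<le> n" "\<tau> (k (max u t)) = max u t"
        using k[OF uH] km[OF H(2) uH] by (auto simp: m_def)
      have "(\<Sum>i\<in>{m..<k (max u t)}. increments \<tau> J \<omega> i) = (\<Sum>i\<in>{m..<k (max u t)}. \<omega> (\<tau> (Suc i)) - \<omega> (\<tau> i))"
        using ku by (intro sum.cong) (auto simp: increments_def J_def)
      also have "\<dots> = \<omega> (\<tau> (k (max u t))) - \<omega> (\<tau> m)" using ku by (intro sum_increments) simp
      finally show ?thesis using ku m by (simp add: future_def)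
    qed
    moreover have "increments \<tau> J \<omega> \<in> space (PiM J (\<lambda>_. borel))"
      using measurable_space[OF measurable_increments] w by simp
    ultimately show ?thesis using w by (auto simp: D_def cylinder_def)
  qed
  have ind: "indep_var (PiM I (\<lambda>_. borel)) (increments \<tau> I) (PiM J (\<lambda>_. borel)) (increments \<tau> J)"
    unfolding increments_def
    by (rule indep_var_restrict[OF indep_increments[of n \<tau>]]) (use \<tau> m in \<open>auto simp: I_def J_def\<close>)
  have "past t -` cylinder F A \<inter> space P = increments \<tau> I -` C \<inter> space P"
    "future t -` cylinder G B \<inter> space P = increments \<tau> J -` D \<inter> space P" using iC iD by auto
  moreover have "increments \<tau> I -` C \<inter> space P \<inter> (increments \<tau> J -` D \<inter> space P) =
     (\<lambda>x. (increments \<tau> I x, increments \<tau> J x)) -` (C \<times> D) \<inter> space P" by auto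
  ultimately show "prob (past t -` cylinder F A \<inter> space P \<inter> (future t -` cylinder G B \<inter> space P)) =
        prob (past t -` cylinder F A \<inter> space P) * prob (future t -` cylinder G B \<inter> space P)"
    using indep_varD[OF ind C D] by simp
qed simp_all

text \<open>
  The form in which independence is used: the future may be replaced by an independent copy.
\<close>

lemma nn_integral_past_future:
  assumes "f \<in> borel_measurable (path_borel \<Otimes>\<^sub>M path_borel)"
  shows "(\<integral>\<^sup>+\<omega>. f (past t \<omega>, future t \<omega>) \<partial>P) = (\<integral>\<^sup>+\<omega>. (\<integral>\<^sup>+\<omega>'. f (past t \<omega>, future t \<omega>') \<partial>P) \<partial>P)"
proof -
  let ?p = "distr P path_borel (past t)" and ?f = "distr P path_borel (future t)"
  interpret p: prob_space ?p by (rule prob_space_distr) simp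
  interpret f: prob_space ?f by (rule prob_space_distr) simp
  have eq: "distr P (path_borel \<Otimes>\<^sub>M path_borel) (\<lambda>\<omega>. (past t \<omega>, future t \<omega>)) = ?p \<Otimes>\<^sub>M ?f"
    using past_future_independent[of t] by (simp add: indep_var_distribution_eq)
  have f': "f \<in> borel_measurable (?p \<Otimes>\<^sub>M ?f)" using assms by simp
  have "(\<integral>\<^sup>+\<omega>. f (past t \<omega>, future t \<omega>) \<partial>P) = integral\<^sup>N (?p \<Otimes>\<^sub>M ?f) f"
    unfolding eq[symmetric] using assms by (subst nn_integral_distr) auto
  also have "\<dots> = (\<integral>\<^sup>+x. \<integral>\<^sup>+y. f (x, y) \<partial>?f \<partial>?p)"
    by (rule f.nn_integral_fst[symmetric, OF f'])
  also have "\<dots> = (\<integral>\<^sup>+\<omega>. \<integral>\<^sup>+y. f (past t \<omega>, y) \<partial>?f \<partial>P)"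
    using f.borel_measurable_nn_integral_fst[OF f'] by (subst nn_integral_distr) auto
  also have "\<dots> = (\<integral>\<^sup>+\<omega>. \<integral>\<^sup>+\<omega>'. f (past t \<omega>, future t \<omega>') \<partial>P \<partial>P)"
  proof (rule nn_integral_cong)
    fix \<omega> assume "\<omega> \<in> space P"
    hence "(\<lambda>y. f (past t \<omega>, y)) \<in> borel_measurable path_borel"
      using assms by (intro measurable_compose[OF measurable_Pair1' assms]) simp
    thus "(\<integral>\<^sup>+y. f (past t \<omega>, y) \<partial>?f) = (\<integral>\<^sup>+\<omega>'. f (past t \<omega>, future t \<omega>') \<partial>P)"
      by (subst nn_integral_distr) auto
  qed
  finally show ?thesis .
qed

end

section \<open>Tails and oscillations of the Wiener path\<close>

lemma product_of_single:
  assumes "finite B" "i \<in> B" "\<And>j. j \<in> B \<Longrightarrow> j \<noteq> i \<Longrightarrow> f j = 1"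
  shows "prod f B = f i"
proof -
  have "prod f (B - {i}) = 1" using assms(3) by (intro prod.neutral) auto
  thus ?thesis by (simp only: prod.remove[OF assms(1,2), of f]) simp
qed

context wiener
begin

lemma nn_integral_increment_component:
  fixes g :: "real \<Rightarrow> ennreal"
  assumes st: "s < t" and i: "i \<in> Basis" and g: "g \<in> borel_measurable borel"
  shows "(\<integral>\<^sup>+\<omega>. g ((\<omega> t - \<omega> s) \<bullet> i) \<partial>P) = (\<integral>\<^sup>+x. ennreal (normal_density 0 (sqrt (t - s)) x) * g x \<partial>lborel)"
proof -
  define N where "N = normal_density 0 (sqrt (t - s))"
  have N: "N \<in> borel_measurable borel" "\<And>x. 0 \<le> N x" by (auto simp: N_def)
  have N1: "(\<integral>\<^sup>+x. ennreal (N x) \<partial>lborel) = 1"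
  proof -
    interpret n: prob_space "density lborel (\<lambda>x. ennreal (N x))"
      unfolding N_def using st by (intro prob_space_normal_density) simp
    have "(\<integral>\<^sup>+x. ennreal (N x) \<partial>lborel) = emeasure (density lborel (\<lambda>x. ennreal (N x))) UNIV"
      using N by (subst emeasure_density) auto
    thus ?thesis using n.emeasure_space_1 by simp
  qed
  define h where "h j = (\<lambda>x. ennreal (N x) * (if j = i then g x else 1))" for j :: 'a
  have h: "h j \<in> borel_measurable borel" for j unfolding h_def using N(1) g by measurable
  have dist: "distributed P lborel (\<lambda>\<omega>. \<omega> t - \<omega> s) (\<lambda>x. ennreal (\<Prod>i\<in>Basis. N (x \<bullet> i)))"
    using wiener st by (simp add: two_sided_wiener_measure_def N_def)
  have "(\<lambda>x. g (x \<bullet> i)) \<in> borel_measurable lborel" using g by simp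
  from distributed_nn_integral[OF dist this]
  have "(\<integral>\<^sup>+\<omega>. g ((\<omega> t - \<omega> s) \<bullet> i) \<partial>P) = (\<integral>\<^sup>+x. ennreal (\<Prod>i\<in>Basis. N (x \<bullet> i)) * g (x \<bullet> i) \<partial>lborel)" by simp
  also have "\<dots> = (\<integral>\<^sup>+x. (\<Prod>j\<in>Basis. h j (x \<bullet> j)) \<partial>lborel)"
  proof (rule nn_integral_cong)
    fix x :: 'a
    have "(\<Prod>j\<in>Basis. (if j = i then g (x \<bullet> j) else 1)) = g (x \<bullet> i)"
      using i by (subst product_of_single[of _ i]) auto
    thus "ennreal (\<Prod>i\<in>Basis. N (x \<bullet> i)) * g (x \<bullet> i) = (\<Prod>j\<in>Basis. h j (x \<bullet> j))"
      using N(2) by (simp add: h_def prod.distrib prod_ennreal)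
  qed
  also have "\<dots> = (\<Prod>j\<in>Basis. \<integral>\<^sup>+x. h j x \<partial>lborel)"
    by (rule nn_integral_lborel_prod) (use h in auto)
  also have "\<dots> = (\<integral>\<^sup>+x. h i x \<partial>lborel)"
    using i N1 by (intro product_of_single) (auto simp: h_def)
  finally show ?thesis by (simp add: h_def N_def)
qed

lemma increment_second_moment:
  fixes s t :: real
  assumes "s < t"
  shows "(\<integral>\<^sup>+\<omega>. ennreal ((norm (\<omega> t - \<omega> s))\<^sup>2) \<partial>P) = ennreal (DIM('a) * (t - s))"
proof -
  have comp: "(\<integral>\<^sup>+\<omega>. ennreal (((\<omega> t - \<omega> s) \<bullet> i)\<^sup>2) \<partial>P) = ennreal (t - s)" if i: "i \<in> Basis" for i
  proof -
    have "(\<integral>\<^sup>+\<omega>. ennreal (((\<omega> t - \<omega> s) \<bullet> i)\<^sup>2) \<partial>P) = (\<integral>\<^sup>+x. ennreal (normal_density 0 (sqrt (t - s)) x) * ennreal (x\<^sup>2) \<partial>lborel)"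
      by (rule nn_integral_increment_component[OF assms i]) simp
    also have "\<dots> = (\<integral>\<^sup>+x. ennreal (normal_density 0 (sqrt (t - s)) x * (x - 0) ^ (2 * 1)) \<partial>lborel)"
      by (intro nn_integral_cong) (simp add: ennreal_mult)
    also have "\<dots> = ennreal (fact (2 * 1) / ((2 / (sqrt (t - s))\<^sup>2) ^ 1 * fact 1))"
      using has_bochner_integral_nn_integral normal_moment_even[of "sqrt (t - s)" 0 1] assms
      by (subst nn_integral_eq_integral) (auto simp: has_bochner_integral_iff)
    also have "fact (2 * 1) / ((2 / (sqrt (t - s))\<^sup>2) ^ 1 * fact 1) = t - s" using assms by (simp add: fact_2)
    finally show ?thesis .
  qed
  have "(norm x)\<^sup>2 = (\<Sum>i\<in>Basis. (x \<bullet> i)\<^sup>2)" for x :: 'a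
    by (metis (no_types, lifting) euclidean_inner power2_eq_square power2_norm_eq_inner sum.cong)
  hence "(\<integral>\<^sup>+\<omega>. ennreal ((norm (\<omega> t - \<omega> s))\<^sup>2) \<partial>P) = (\<integral>\<^sup>+\<omega>. (\<Sum>i\<in>Basis. ennreal (((\<omega> t - \<omega> s) \<bullet> i)\<^sup>2)) \<partial>P)"
    by (simp add: sum_ennreal)
  also have "\<dots> = (\<Sum>i\<in>Basis. \<integral>\<^sup>+\<omega>. ennreal (((\<omega> t - \<omega> s) \<bullet> i)\<^sup>2) \<partial>P)"
    by (rule nn_integral_sum) simp
  also have "\<dots> = (\<Sum>i\<in>(Basis :: 'a set). ennreal (t - s))" by (intro sum.cong comp) auto
  also have "\<dots> = ennreal (DIM('a) * (t - s))" using assms by (simp add: ennreal_mult ennreal_of_nat_eq_real_of_nat)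
  finally show ?thesis .
qed

lemma large_increment_measurable: "{\<omega> \<in> paths. a < norm (\<omega> t - (\<omega> s :: 'a))} \<in> sets path_borel"
proof -
  have "{\<omega> \<in> space path_borel. a < norm (\<omega> t - (\<omega> s :: 'a))} \<in> sets path_borel" by measurable
  thus ?thesis by simp
qed

lemma increment_tail:
  fixes s t a :: real
  assumes "s < t" "0 < a"
  shows "prob {\<omega> \<in> paths. a < norm (\<omega> t - \<omega> s)} \<le> DIM('a) * (t - s) / a\<^sup>2"
proof -
  let ?S = "{\<omega> \<in> paths. a < norm (\<omega> t - (\<omega> s :: 'a))}"
  have m: "?S \<in> sets P" by (simp add: large_increment_measurable)
  have "emeasure P ?S = (\<integral>\<^sup>+\<omega>. indicator ?S \<omega> \<partial>P)"
    using m by simp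
  also have "\<dots> \<le> (\<integral>\<^sup>+\<omega>. ennreal (1 / a\<^sup>2) * ennreal ((norm (\<omega> t - \<omega> s))\<^sup>2) \<partial>P)"
  proof (rule nn_integral_mono)
    fix \<omega> :: "real \<Rightarrow> 'a"
    have "1 \<le> 1 / a\<^sup>2 * (norm (\<omega> t - \<omega> s))\<^sup>2" if "a < norm (\<omega> t - \<omega> s)"
      using power_mono[of a "norm (\<omega> t - \<omega> s)" 2] that assms by (simp add: field_simps)
    thus "indicator ?S \<omega> \<le> ennreal (1 / a\<^sup>2) * ennreal ((norm (\<omega> t - \<omega> s))\<^sup>2)"
      by (auto simp: indicator_def ennreal_mult[symmetric] simp del: ennreal_1 simp flip: ennreal_1)
  qed
  also have "\<dots> = ennreal (1 / a\<^sup>2) * ennreal (DIM('a) * (t - s))"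
    using increment_second_moment[OF assms(1)] by (subst nn_integral_cmult) auto
  also have "\<dots> = ennreal (DIM('a) * (t - s) / a\<^sup>2)" using assms by (subst ennreal_mult[symmetric]) auto
  finally have "ennreal (prob ?S) \<le> ennreal (DIM('a) * (t - s) / a\<^sup>2)"
    by (simp add: emeasure_eq_measure)
  thus ?thesis using assms by (subst (asm) ennreal_le_iff) auto
qed

text \<open>
  One coordinate suffices: its density is at most \<open>1 / (2 * sqrt (t - s))\<close>.
\<close>

lemma increment_small_ball:
  fixes s t \<sigma> \<rho> :: real
  assumes "s < t" "0 < \<sigma>" "0 \<le> \<rho>"
  shows "prob {\<omega> \<in> paths. norm (z + \<sigma> *\<^sub>R (\<omega> t - \<omega> s)) \<le> \<rho>} \<le> \<rho> / (\<sigma> * sqrt (t - s))"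
proof -
  let ?S = "{\<omega> \<in> paths. norm (z + \<sigma> *\<^sub>R (\<omega> t - (\<omega> s :: 'a))) \<le> \<rho>}"
  obtain i :: 'a where i: "i \<in> Basis" by (meson nonempty_Basis ex_in_conv)
  define l where "l = (- \<rho> - z \<bullet> i) / \<sigma>"
  define v where "v = sqrt (t - s)"
  have v: "v > 0" using assms by (simp add: v_def)
  have m: "?S \<in> sets P"
  proof -
    have "{\<omega> \<in> space P. norm (z + \<sigma> *\<^sub>R (\<omega> t - \<omega> s)) \<le> \<rho>} \<in> sets P" by measurable
    thus ?thesis by simp
  qed
  have "emeasure P ?S
      = (\<integral>\<^sup>+\<omega>. indicator ?S \<omega> \<partial>P)"
    using m by simp
  also have "\<dots> \<le> (\<integral>\<^sup>+\<omega>. indicator {l..l + 2 * \<rho> / \<sigma>} ((\<omega> t - \<omega> s) \<bullet> i) \<partial>P)"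
  proof (rule nn_integral_mono)
    fix \<omega> :: "real \<Rightarrow> 'a"
    have "(\<omega> t - \<omega> s) \<bullet> i \<in> {l..l + 2 * \<rho> / \<sigma>}" if "norm (z + \<sigma> *\<^sub>R (\<omega> t - \<omega> s)) \<le> \<rho>"
    proof -
      have "\<bar>(z + \<sigma> *\<^sub>R (\<omega> t - \<omega> s)) \<bullet> i\<bar> \<le> \<rho>" using Basis_le_norm[OF i] that order_trans by blast
      hence "\<bar>z \<bullet> i + \<sigma> * ((\<omega> t - \<omega> s) \<bullet> i)\<bar> \<le> \<rho>" by (simp add: inner_add_left)
      thus ?thesis using assms unfolding l_def by (auto simp: field_simps abs_le_iff)
    qed
    thus "indicator ?S \<omega>
        \<le> (indicator {l..l + 2 * \<rho> / \<sigma>} ((\<omega> t - \<omega> s) \<bullet> i) :: ennreal)"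
      by (auto simp: indicator_def)
  qed
  also have "\<dots> = (\<integral>\<^sup>+x. ennreal (normal_density 0 v x) * indicator {l..l + 2 * \<rho> / \<sigma>} x \<partial>lborel)"
    unfolding v_def by (rule nn_integral_increment_component[OF assms(1) i]) simp
  also have "\<dots> \<le> (\<integral>\<^sup>+x. ennreal (1 / (2 * v)) * indicator {l..l + 2 * \<rho> / \<sigma>} x \<partial>lborel)"
  proof (intro nn_integral_mono mult_right_mono ennreal_leI)
    fix x
    have "normal_density 0 v x \<le> 1 / sqrt (2 * pi * v\<^sup>2) * 1"
      unfolding normal_density_def by (intro mult_left_mono) auto
    also have "\<dots> \<le> 1 / (2 * v)"
    proof -
      have "2 * v = sqrt ((2 * v)\<^sup>2)" using v by (subst real_sqrt_abs) simp
      also have "\<dots> \<le> sqrt (2 * pi * v\<^sup>2)" using pi_gt3 by (intro real_sqrt_le_mono) (simp add: power_mult_distrib mult_right_mono)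
      finally show ?thesis using v by (simp add: frac_le)
    qed
    finally show "normal_density 0 v x \<le> 1 / (2 * v)" .
  qed simp
  also have "\<dots> = ennreal (1 / (2 * v)) * ennreal (2 * \<rho> / \<sigma>)"
    using assms by (subst nn_integral_cmult_indicator) auto
  also have "\<dots> = ennreal (\<rho> / (\<sigma> * v))" using assms v by (subst ennreal_mult[symmetric]) auto
  finally have "ennreal (prob ?S) \<le> ennreal (\<rho> / (\<sigma> * v))"
    by (simp add: emeasure_eq_measure)
  thus ?thesis using assms v by (subst (asm) ennreal_le_iff) (auto simp: v_def)
qed

lemma prob_past_inter_future:
  assumes A: "A \<in> sets path_borel" and B: "B \<in> sets path_borel"
  shows "prob (past t -` A \<inter> space P \<inter> (future t -` B \<inter> space P)) =
    prob (past t -` A \<inter> space P) * prob (future t -` B \<inter> space P)"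
proof -
  have "past t -` A \<inter> space P \<inter> (future t -` B \<inter> space P) = (\<lambda>x. (past t x, future t x)) -` (A \<times> B) \<inter> space P" by auto
  thus ?thesis using indep_varD[OF past_future_independent A B] by simp
qed

text \<open>
  Ottaviani's inequality. At the first grid time at which the path is further than \<open>2 * a\<close> from its
  start, the remaining increment is independent of the past and at most \<open>a\<close> with probability at least
  \<open>1 / 2\<close>, in which case the path ends further than \<open>a\<close> from its start.
\<close>

lemma ottaviani_grid:
  fixes \<tau> :: "nat \<Rightarrow> real"
  assumes inc: "\<And>i j. i \<le> j \<Longrightarrow> \<tau> i \<le> \<tau> j" and a: "0 < a"
    and half: "\<And>j. j \<le> n \<Longrightarrow> prob {\<omega> \<in> paths. a < norm (\<omega> (\<tau> n) - \<omega> (\<tau> j))} \<le> 1 / 2"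
  shows "prob {\<omega> \<in> paths. \<exists>j\<le>n. 2 * a < norm (\<omega> (\<tau> j) - \<omega> (\<tau> 0))}
    \<le> 2 * prob {\<omega> \<in> paths. a < norm (\<omega> (\<tau> n) - \<omega> (\<tau> 0))}"
proof -
  let ?S = "{\<omega> \<in> paths. a < norm (\<omega> (\<tau> n) - (\<omega> (\<tau> 0) :: 'a))}"
  define L where "L j = {\<omega> \<in> paths. 2 * a < norm (\<omega> (\<tau> j) - (\<omega> (\<tau> 0) :: 'a))}" for j
  \<comment> \<open>\<open>j\<close> is the first index at which the threshold is exceeded.\<close>
  define E where "E j = L j - (\<Union>i<j. L i)" for j
  define H where "H j = {\<omega> \<in> paths. norm (\<omega> (\<tau> n) - (\<omega> (\<tau> j) :: 'a)) \<le> a}" for j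
  have "L j \<in> sets path_borel" for j unfolding L_def by (rule large_increment_measurable)
  hence E: "E j \<in> sets path_borel" for j unfolding E_def by (intro sets.Diff sets.finite_UN) auto
  have H: "H j \<in> sets path_borel" for j
  proof -
    have "{\<omega> \<in> space path_borel. norm (\<omega> (\<tau> n) - (\<omega> (\<tau> j) :: 'a)) \<le> a} \<in> sets path_borel" by measurable
    thus ?thesis by (simp add: H_def)
  qed
  have EH: "prob (E j) \<le> 2 * prob (E j \<inter> H j)" if j: "j \<le> n" for j
  proof -
    have pastE: "past (\<tau> j) -` E j \<inter> space P = E j"
    proof -
      have "past (\<tau> j) \<omega> \<in> L i \<longleftrightarrow> \<omega> \<in> L i" if "i \<le> j" "\<omega> \<in> paths" for i \<omega>
      proof -
        have "past (\<tau> j) \<omega> (\<tau> i) - past (\<tau> j) \<omega> (\<tau> 0) = \<omega> (\<tau> i) - \<omega> (\<tau> 0)"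
          using that inc[of i j] inc[of 0 j] by (simp add: past_def)
        thus ?thesis using that(2) by (simp only: L_def mem_Collect_eq past_in_paths)
      qed
      hence "past (\<tau> j) \<omega> \<in> E j \<longleftrightarrow> \<omega> \<in> E j" if "\<omega> \<in> paths" for \<omega>
        using that by (simp add: E_def)
      moreover have "E j \<subseteq> paths" by (auto simp: E_def L_def)
      ultimately show ?thesis by auto
    qed
    have futH: "future (\<tau> j) -` H j \<inter> space P = H j"
    proof -
      have "future (\<tau> j) \<omega> (\<tau> n) - future (\<tau> j) \<omega> (\<tau> j) = \<omega> (\<tau> n) - \<omega> (\<tau> j)" for \<omega> :: "real \<Rightarrow> 'a"
        using inc[OF j] by (simp add: future_def)
      thus ?thesis by (auto simp: H_def)
    qed
    have "prob (E j \<inter> H j) = prob (E j) * prob (H j)"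
      using prob_past_inter_future[OF E[of j] H[of j], of "\<tau> j"] unfolding pastE futH .
    moreover have "prob (H j) \<ge> 1 / 2"
    proof -
      have "H j = space P - {\<omega> \<in> paths. a < norm (\<omega> (\<tau> n) - \<omega> (\<tau> j))}" by (auto simp: H_def)
      hence "prob (H j) = 1 - prob {\<omega> \<in> paths. a < norm (\<omega> (\<tau> n) - \<omega> (\<tau> j))}"
        using prob_compl large_increment_measurable by simp
      thus ?thesis using half[OF j] by simp
    qed
    ultimately show ?thesis using mult_left_mono[of "1 / 2" "prob (H j)" "prob (E j)"] by simp
  qed
  have disj: "disjoint_family_on E {..n}"
  proof (clarsimp simp: disjoint_family_on_def)
    fix i j :: nat assume "i \<noteq> j"
    thus "E i \<inter> E j = {}"
      by (cases i j rule: linorder_cases) (auto simp: E_def)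
  qed
  have "{\<omega> \<in> paths. \<exists>j\<le>n. 2 * a < norm (\<omega> (\<tau> j) - (\<omega> (\<tau> 0) :: 'a))} \<subseteq> (\<Union>j\<in>{..n}. E j)"
  proof clarify
    fix \<omega> :: "real \<Rightarrow> 'a" and j assume w: "\<omega> \<in> paths" and j: "j \<le> n" "2 * a < norm (\<omega> (\<tau> j) - \<omega> (\<tau> 0))"
    define j0 where "j0 = (LEAST j. \<omega> \<in> L j)"
    have jL: "\<omega> \<in> L j" using w j by (simp add: L_def)
    have "\<omega> \<in> L j0" unfolding j0_def by (rule LeastI[of "\<lambda>j. \<omega> \<in> L j", OF jL])
    moreover have "j0 \<le> j" unfolding j0_def by (rule Least_le[of "\<lambda>j. \<omega> \<in> L j", OF jL])
    moreover have "\<omega> \<notin> L i" if "i < j0" for i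
      using not_less_Least[of i "\<lambda>j. \<omega> \<in> L j"] that by (simp add: j0_def)
    ultimately show "\<omega> \<in> (\<Union>j\<in>{..n}. E j)" using j by (auto simp: E_def intro!: bexI[of _ j0])
  qed
  hence "prob {\<omega> \<in> paths. \<exists>j\<le>n. 2 * a < norm (\<omega> (\<tau> j) - \<omega> (\<tau> 0))} \<le> prob (\<Union>j\<in>{..n}. E j)"
    using E by (intro finite_measure_mono) auto
  also have "\<dots> = (\<Sum>j\<in>{..n}. prob (E j))" using E disj by (intro finite_measure_finite_Union) auto
  also have "\<dots> \<le> (\<Sum>j\<in>{..n}. 2 * prob (E j \<inter> H j))" by (intro sum_mono EH) auto
  also have "\<dots> = 2 * (\<Sum>j\<in>{..n}. prob (E j \<inter> H j))" by (rule sum_distrib_left[symmetric])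
  also have "(\<Sum>j\<in>{..n}. prob (E j \<inter> H j)) = prob (\<Union>j\<in>{..n}. E j \<inter> H j)"
  proof (rule finite_measure_finite_Union[symmetric])
    show "disjoint_family_on (\<lambda>j. E j \<inter> H j) {..n}" using disj unfolding disjoint_family_on_def by blast
  qed (use E H in auto)
  also have "\<dots> \<le> prob ?S"
  proof (rule finite_measure_mono)
    show "?S \<in> events" by (simp add: large_increment_measurable)
    show "(\<Union>j\<in>{..n}. E j \<inter> H j) \<subseteq> ?S"
    proof clarify
      fix j \<omega> assume "\<omega> \<in> E j" "\<omega> \<in> H j"
      hence w: "\<omega> \<in> paths" "2 * a < norm (\<omega> (\<tau> j) - \<omega> (\<tau> 0))" "norm (\<omega> (\<tau> n) - \<omega> (\<tau> j)) \<le> a"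
        by (auto simp: E_def L_def H_def)
      have "norm (\<omega> (\<tau> j) - \<omega> (\<tau> 0)) \<le> norm (\<omega> (\<tau> n) - \<omega> (\<tau> 0)) + norm (\<omega> (\<tau> n) - \<omega> (\<tau> j))"
        using norm_triangle_ineq4[of "\<omega> (\<tau> n) - \<omega> (\<tau> 0)" "\<omega> (\<tau> n) - \<omega> (\<tau> j)"] by simp
      thus "\<omega> \<in> paths \<and> a < norm (\<omega> (\<tau> n) - \<omega> (\<tau> 0))" using w by simp
    qed
  qed
  finally show ?thesis by simp
qed

definition oscillates :: "real \<Rightarrow> real \<Rightarrow> real \<Rightarrow> (real \<Rightarrow> 'a) set" where
  "oscillates t d a = {\<omega> \<in> paths. \<exists>u\<in>{t..t + d}. a < norm (\<omega> u - \<omega> t)}"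

definition dyadic :: "real \<Rightarrow> real \<Rightarrow> nat \<Rightarrow> nat \<Rightarrow> real" where
  "dyadic t d m j = t + d * j / 2 ^ m"

lemma oscillates_dyadic:
  assumes d: "0 < d"
  shows "oscillates t d a = (\<Union>m. {\<omega> \<in> paths. \<exists>j\<le>2 ^ m. a < norm (\<omega> (dyadic t d m j) - \<omega> t)})"
proof (intro equalityI subsetI)
  fix \<omega> assume "\<omega> \<in> oscillates t d a"
  then obtain u where w: "\<omega> \<in> paths" and u: "t \<le> u" "u \<le> t + d" "a < norm (\<omega> u - \<omega> t)"
    by (auto simp: oscillates_def)
  define x where "x = (u - t) / d"
  have x: "0 \<le> x" "x \<le> 1" "u = t + d * x" using u d by (auto simp: x_def field_simps)
  define j where "j m = nat \<lfloor>x * 2 ^ m\<rfloor>" for m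
  have j: "real (j m) \<le> x * 2 ^ m" "x * 2 ^ m < real (j m) + 1" for m using x by (auto simp: j_def)
  have jm: "j m \<le> 2 ^ m" for m
  proof -
    have "real (j m) \<le> 1 * 2 ^ m" 
      by (rule order_trans[OF j(1) mult_right_mono[OF x(2)]]) simp
    hence "real (j m) \<le> real (2 ^ m)" by simp
    thus ?thesis by (simp only: of_nat_le_iff)
  qed
  have "(\<lambda>m. real (j m) / 2 ^ m) \<longlonglongrightarrow> x"
  proof (rule tendsto_sandwich)
    show "\<forall>\<^sub>F m in sequentially. x - (1 / 2) ^ m \<le> real (j m) / 2 ^ m"
    proof (intro always_eventually allI)
      fix m
      have "x * 2 ^ m - 1 \<le> j m" using j(2)[of m] by simp
      hence "(x * 2 ^ m - 1) / 2 ^ m \<le> j m / 2 ^ m" by (intro divide_right_mono) auto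
      thus "x - (1 / 2) ^ m \<le> real (j m) / 2 ^ m" by (simp add: diff_divide_distrib power_one_over)
    qed
    show "\<forall>\<^sub>F m in sequentially. real (j m) / 2 ^ m \<le> x"
      using j(1) by (intro always_eventually allI) (simp add: divide_le_eq)
    have "(\<lambda>m. (1 / 2 :: real) ^ m) \<longlonglongrightarrow> 0" by (rule LIMSEQ_power_zero) simp
    from tendsto_diff[OF tendsto_const[of x] this] show "(\<lambda>m. x - (1 / 2) ^ m) \<longlonglongrightarrow> x" by simp
  qed simp
  hence "(\<lambda>m. t + d * (real (j m) / 2 ^ m)) \<longlonglongrightarrow> t + d * x" by (intro tendsto_intros)
  hence lim: "(\<lambda>m. dyadic t d m (j m)) \<longlonglongrightarrow> u" by (simp add: dyadic_def x)
  have "isCont \<omega> u" using w by (simp add: paths_def continuous_on_eq_continuous_at)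
  hence "(\<lambda>m. norm (\<omega> (dyadic t d m (j m)) - \<omega> t)) \<longlonglongrightarrow> norm (\<omega> u - \<omega> t)"
    using lim by (intro tendsto_intros isCont_tendsto_compose[of u \<omega>])
  hence "\<forall>\<^sub>F m in sequentially. a < norm (\<omega> (dyadic t d m (j m)) - \<omega> t)" using u(3) by (rule order_tendstoD)
  then obtain m where "a < norm (\<omega> (dyadic t d m (j m)) - \<omega> t)" by (auto simp: eventually_sequentially)
  thus "\<omega> \<in> (\<Union>m. {\<omega> \<in> paths. \<exists>j\<le>2 ^ m. a < norm (\<omega> (dyadic t d m j) - \<omega> t)})" using w jm by blast
next
  fix \<omega> :: "real \<Rightarrow> 'a" assume "\<omega> \<in> (\<Union>m. {\<omega> \<in> paths. \<exists>j\<le>2 ^ m. a < norm (\<omega> (dyadic t d m j) - \<omega> t)})"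
  then obtain m j where w: "\<omega> \<in> paths" and j: "j \<le> 2 ^ m" "a < norm (\<omega> (dyadic t d m j) - \<omega> t)" by blast
  have "real j \<le> real (2 ^ m)" using j(1) by (simp only: of_nat_le_iff)
  hence "d * j / 2 ^ m \<le> d" "0 \<le> d * j / 2 ^ m" using d by (auto simp: divide_le_eq)
  hence "dyadic t d m j \<in> {t..t + d}" by (auto simp: dyadic_def)
  thus "\<omega> \<in> oscillates t d a" using w j by (auto simp: oscillates_def)
qed

lemma dyadic_event_measurable:
  "{\<omega> \<in> paths. \<exists>j\<le>2 ^ m. a < norm (\<omega> (dyadic t d m j) - (\<omega> t :: 'a))} \<in> sets path_borel"
proof -
  have "(\<Union>j\<in>{..2 ^ m}. {\<omega> \<in> paths. a < norm (\<omega> (dyadic t d m j) - (\<omega> t :: 'a))}) \<in> sets path_borel"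
    by (intro sets.finite_UN large_increment_measurable) simp
  also have "(\<Union>j\<in>{..2 ^ m}. {\<omega> \<in> paths. a < norm (\<omega> (dyadic t d m j) - (\<omega> t :: 'a))})
      = {\<omega> \<in> paths. \<exists>j\<le>2 ^ m. a < norm (\<omega> (dyadic t d m j) - (\<omega> t :: 'a))}" by auto
  finally show ?thesis .
qed

lemma oscillates_measurable: "0 < d \<Longrightarrow> oscillates t d a \<in> sets path_borel"
proof -
  assume d: "0 < d"
  show ?thesis unfolding oscillates_dyadic[OF d]
    by (rule sets.countable_UN) (use dyadic_event_measurable in blast)
qed

text \<open>
  If the right-hand side is below \<open>1\<close>, Chebyshev's inequality makes every increment over a part of
  the interval small with probability at least \<open>1 / 2\<close>, as Ottaviani's inequality requires; otherwise there is nothing to prove.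
\<close>

lemma oscillation_tail:
  fixes t d a :: real
  assumes d: "0 < d" and a: "0 < a"
  shows "prob (oscillates t d a) \<le> 8 * DIM('a) * d / a\<^sup>2"
proof (cases "8 * DIM('a) * d / a\<^sup>2 \<ge> 1")
  case True thus ?thesis using prob_le_1 order_trans by blast
next
  case False
  define c where "c = a / 2"
  have c: "0 < c" using a by (simp add: c_def)
  have tail: "DIM('a) * d / c\<^sup>2 = 4 * DIM('a) * d / a\<^sup>2" by (simp add: c_def power_divide)
  define G where "G m = {\<omega> \<in> paths. \<exists>j\<le>2 ^ m. a < norm (\<omega> (dyadic t d m j) - (\<omega> t :: 'a))}" for m
  have inc: "incseq G"
  proof (rule incseq_SucI, rule subsetI)
    fix m \<omega> assume "\<omega> \<in> G m"
    then obtain j where j: "\<omega> \<in> paths" "j \<le> 2 ^ m" "a < norm (\<omega> (dyadic t d m j) - \<omega> t)" by (auto simp: G_def)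
    have "dyadic t d (Suc m) (2 * j) = dyadic t d m j" by (simp add: dyadic_def)
    thus "\<omega> \<in> G (Suc m)" using j by (auto simp: G_def intro!: exI[of _ "2 * j"])
  qed
  have Gb: "prob (G m) \<le> 8 * DIM('a) * d / a\<^sup>2" for m
  proof -
    define \<tau> where "\<tau> = dyadic t d m"
    have \<tau>0: "\<tau> 0 = t" and \<tau>n: "\<tau> (2 ^ m) = t + d" by (auto simp: \<tau>_def dyadic_def)
    have mono: "\<tau> i \<le> \<tau> j" if "i \<le> j" for i j
      using that d by (auto simp: \<tau>_def dyadic_def intro!: divide_right_mono)
    have half: "prob {\<omega> \<in> paths. c < norm (\<omega> (\<tau> (2 ^ m)) - \<omega> (\<tau> j))} \<le> 4 * DIM('a) * d / a\<^sup>2"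
      if "j \<le> 2 ^ m" for j
    proof (cases "\<tau> j < t + d")
      case True
      hence "prob {\<omega> \<in> paths. c < norm (\<omega> (t + d) - \<omega> (\<tau> j))} \<le> DIM('a) * (t + d - \<tau> j) / c\<^sup>2"
        by (rule increment_tail) (rule c)
      also have "\<dots> \<le> DIM('a) * d / c\<^sup>2"
        using mono[of 0 j] by (intro divide_right_mono mult_left_mono) (auto simp: \<tau>0)
      finally show ?thesis unfolding \<tau>n tail .
    next
      case False
      hence "\<tau> j = t + d" using mono[OF that] by (simp add: \<tau>n)
      hence "{\<omega> \<in> paths. c < norm (\<omega> (\<tau> (2 ^ m)) - (\<omega> (\<tau> j) :: 'a))} = {}" using c by (auto simp: \<tau>n)
      hence "prob {\<omega> \<in> paths. c < norm (\<omega> (\<tau> (2 ^ m)) - \<omega> (\<tau> j))} = 0" by (simp only: measure_empty)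
      moreover have "0 \<le> 4 * DIM('a) * d / a\<^sup>2" using d by simp
      ultimately show ?thesis by linarith
    qed
    have "prob (G m) \<le> 2 * prob {\<omega> \<in> paths. c < norm (\<omega> (\<tau> (2 ^ m)) - \<omega> (\<tau> 0))}"
    proof -
      have h2: "prob {\<omega> \<in> paths. c < norm (\<omega> (\<tau> (2 ^ m)) - \<omega> (\<tau> j))} \<le> 1 / 2" if "j \<le> 2 ^ m" for j
        using half[OF that] False by linarith
      have "G m = {\<omega> \<in> paths. \<exists>j\<le>2 ^ m. 2 * c < norm (\<omega> (\<tau> j) - \<omega> (\<tau> 0))}"
        by (simp only: G_def \<tau>0) (simp add: c_def \<tau>_def)
      thus ?thesis using ottaviani_grid[of \<tau> c "2 ^ m", OF mono c h2] by simp
    qed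
    also have "\<dots> \<le> 2 * (4 * DIM('a) * d / a\<^sup>2)" using half[of 0] by simp
    finally show ?thesis by simp
  qed
  have "(\<lambda>m. prob (G m)) \<longlonglongrightarrow> prob (\<Union>m. G m)"
  proof (rule finite_Lim_measure_incseq[OF _ inc])
    show "range G \<subseteq> events" unfolding G_def sets_P using dyadic_event_measurable by blast
  qed
  hence "prob (\<Union>m. G m) \<le> 8 * DIM('a) * d / a\<^sup>2"
    by (rule LIMSEQ_le_const2) (use Gb in auto)
  thus ?thesis unfolding oscillates_dyadic[OF d] G_def .
qed

end

section \<open>Pathwise properties of the flow\<close>

text \<open>
  The solution property holds almost surely for each initial value. This lemma moves its consequences
  from a countable dense set of initial values to all of them, outside one null set.
\<close>

lemma le_if_le_on_dense:
  fixes F G :: "'a::euclidean_space \<Rightarrow> real"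
  assumes D: "\<And>S :: 'a set. open S \<Longrightarrow> S \<noteq> {} \<Longrightarrow> \<exists>d\<in>D. d \<in> S"
    and F: "continuous_on UNIV F" and G: "continuous_on UNIV G"
    and le: "\<And>d. d \<in> D \<Longrightarrow> F d \<le> G d"
  shows "F y \<le> G y"
proof (rule ccontr)
  assume "\<not> F y \<le> G y"
  hence "y \<in> {y. G y < F y}" by simp
  moreover have "open {y. G y < F y}" by (intro open_Collect_less F G)
  ultimately obtain d where "d \<in> D" "G d < F d" using D[of "{y. G y < F y}"] by blast
  thus False using le[of d] by simp
qed

lemma solves_on_cong:
  "solves_on b T g x X \<Longrightarrow> (\<And>s. s \<in> {0..T} \<Longrightarrow> g s = g' s) \<Longrightarrow> solves_on b T g' x X"
  unfolding solves_on_def by auto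

locale sde_flow = wiener P for P :: "(real \<Rightarrow> 'a::euclidean_space) measure" +
  fixes b :: "'a \<Rightarrow> 'a" and \<Lambda> \<sigma> :: real and \<phi> :: "real \<Rightarrow> (real \<Rightarrow> 'a) \<Rightarrow> 'a \<Rightarrow> 'a"
  assumes cont_b: "continuous_on UNIV b"
    and one_sided: "\<And>x y. (b x - b y) \<bullet> (x - y) \<le> \<Lambda> * (norm (x - y))\<^sup>2"
    and \<Lambda>_pos: "0 < \<Lambda>" and \<sigma>_pos: "0 < \<sigma>"
    and rds: "sde_rds b \<sigma> P \<phi>"
begin

definition noise :: "(real \<Rightarrow> 'a) \<Rightarrow> real \<Rightarrow> 'a" where
  "noise \<omega> s = \<sigma> *\<^sub>R (\<omega> s - \<omega> 0)"

definition solution :: "(real \<Rightarrow> 'a) \<Rightarrow> 'a \<Rightarrow> bool" where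
  "solution \<omega> x \<longleftrightarrow> (\<forall>T\<ge>0. solves_on b T (noise \<omega>) x (\<lambda>t. \<phi> t \<omega> x))"

lemma noise_0 [simp]: "noise \<omega> 0 = 0" by (simp add: noise_def)

lemma AE_solution: "AE \<omega> in P. solution \<omega> x"
proof -
  have "solves_sde b \<sigma> P x (\<lambda>t \<omega>. \<phi> t \<omega> x)" using rds by (simp add: sde_rds_def)
  thus ?thesis unfolding solves_sde_def
  proof eventually_elim
    case (elim \<omega>)
    have "continuous_on {0..T} (\<lambda>t. \<phi> t \<omega> x)" for T
      using elim by (auto intro: continuous_on_subset)
    thus ?case using elim by (auto simp: solution_def solves_on_def noise_def)
  qed
qed

lemma cont_flow: "0 \<le> t \<Longrightarrow> \<omega> \<in> paths \<Longrightarrow> continuous_on UNIV (\<phi> t \<omega>)"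
  using rds by (simp add: sde_rds_def)

lemma cocycle: "0 \<le> s \<Longrightarrow> 0 \<le> t \<Longrightarrow> \<omega> \<in> paths \<Longrightarrow> \<phi> (t + s) \<omega> x = \<phi> t (shift s \<omega>) (\<phi> s \<omega> x)"
  using rds by (simp add: sde_rds_def)

lemma flow_measurable:
  assumes T: "T \<in> borel_measurable N" and T0: "\<And>z. z \<in> space N \<Longrightarrow> 0 \<le> T z"
    and w: "w \<in> N \<rightarrow>\<^sub>M path_borel" and x: "x \<in> borel_measurable N"
  shows "(\<lambda>z. \<phi> (T z) (w z) (x z)) \<in> borel_measurable N"
proof -
  have m: "(\<lambda>(t, \<omega>, x). \<phi> t \<omega> x) \<in> restrict_space borel {0..} \<Otimes>\<^sub>M (path_borel \<Otimes>\<^sub>M borel) \<rightarrow>\<^sub>M borel"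
    using rds by (simp add: sde_rds_def)
  have T': "T \<in> N \<rightarrow>\<^sub>M restrict_space borel {0..}"
    using T T0 by (intro measurable_restrict_space2) auto
  have "(\<lambda>z. (T z, w z, x z)) \<in> N \<rightarrow>\<^sub>M restrict_space borel {0..} \<Otimes>\<^sub>M (path_borel \<Otimes>\<^sub>M borel)"
    using T' w x by (intro measurable_Pair)
  from measurable_compose[OF this m] show ?thesis by simp
qed

lemma flow_measurable_path: "0 \<le> t \<Longrightarrow> (\<lambda>\<omega>. \<phi> t \<omega> x) \<in> borel_measurable path_borel"
  by (rule flow_measurable) auto

lemma AE_flow_distance:
  assumes ch: "continuous_on UNIV h"
    and ineq: "\<And>u v. (b u - b v) \<bullet> (u - v) \<le> h u * (norm (u - v))\<^sup>2"
  shows "AE \<omega> in P. \<forall>y. \<forall>t\<ge>0. norm (\<phi> t \<omega> y - \<phi> t \<omega> 0) \<le> norm y * exp (integral {0..t} (\<lambda>s. h (\<phi> s \<omega> 0)))"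
proof -
  obtain D :: "'a set" where D: "countable D" "\<And>S. open S \<Longrightarrow> S \<noteq> {} \<Longrightarrow> \<exists>d\<in>D. d \<in> S"
    using countable_dense_setE by blast
  have "AE \<omega> in P. \<forall>d\<in>D. solution \<omega> d" using D(1) AE_solution by (simp add: AE_ball_countable)
  with AE_solution[of 0] AE_space show ?thesis
  proof eventually_elim
    case (elim \<omega>)
    hence w: "\<omega> \<in> paths" by simp
    show ?case
    proof (intro allI impI)
      fix y :: 'a and t :: real assume t: "0 \<le> t"
      show "norm (\<phi> t \<omega> y - \<phi> t \<omega> 0) \<le> norm y * exp (integral {0..t} (\<lambda>s. h (\<phi> s \<omega> 0)))"
      proof (rule le_if_le_on_dense[OF D(2), where F = "\<lambda>y. norm (\<phi> t \<omega> y - \<phi> t \<omega> 0)"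
            and G = "\<lambda>y. norm y * exp (integral {0..t} (\<lambda>s. h (\<phi> s \<omega> 0)))"])
        fix d assume d: "d \<in> D"
        have "norm (\<phi> t \<omega> 0 - \<phi> t \<omega> d) \<le> norm (0 - d) * exp (integral {0..t} (\<lambda>s. h (\<phi> s \<omega> 0)))"
          using elim d t
          by (intro solutions_distance[OF cont_b ch ineq, where T = t and g = "noise \<omega>"]) (auto simp: solution_def)
        thus "norm (\<phi> t \<omega> d - \<phi> t \<omega> 0) \<le> norm d * exp (integral {0..t} (\<lambda>s. h (\<phi> s \<omega> 0)))"
          by (simp add: norm_minus_commute)
      qed (use cont_flow[OF t w] in \<open>auto intro!: continuous_intros\<close>)
    qed
  qed
qed

text \<open>
  A unit step of the flow is polynomially bounded in a number \<open>L\<close> that dominates both the initial value and the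
  oscillation of the noise. Only the polynomial dependence matters: in the end \<open>L\<close> grows
  exponentially with a small rate.
\<close>

lemma AE_flow_bound:
  assumes growth: "\<And>x. norm (b x) \<le> C * (1 + norm x) ^ r" and C0: "0 \<le> C"
  shows "\<exists>C'\<ge>0. AE \<omega> in P. \<forall>L y t. 1 \<le> L \<longrightarrow> norm y \<le> L \<longrightarrow> \<omega> \<notin> oscillates 0 1 L \<longrightarrow> t \<in> {0..1} \<longrightarrow>
      norm (\<phi> t \<omega> y) \<le> C' * L ^ (r + 1)"
    (is "\<exists>C'\<ge>0. AE \<omega> in P. ?bounded C' \<omega>")
proof -
  obtain D :: "'a set" where D: "countable D" "\<And>S. open S \<Longrightarrow> S \<noteq> {} \<Longrightarrow> \<exists>d\<in>D. d \<in> S"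
    using countable_dense_setE by blast
  define E where "E = exp (2 * \<Lambda> + 1)"
  have E1: "1 \<le> E" using \<Lambda>_pos by (simp add: E_def)
  define C' where "C' = \<sigma> + (1 + C * (1 + \<sigma>) ^ r) * E"
  have "AE \<omega> in P. \<forall>d\<in>D. solution \<omega> d" using D(1) AE_solution by (simp add: AE_ball_countable)
  with AE_space have "AE \<omega> in P. ?bounded C' \<omega>"
  proof eventually_elim
    case (elim \<omega>)
    hence w: "\<omega> \<in> paths" by simp
    show ?case
    proof (intro allI impI)
      fix L :: real and y :: 'a and t :: real
      assume L: "1 \<le> L" and y: "norm y \<le> L" and osc: "\<omega> \<notin> oscillates 0 1 L" and t: "t \<in> {0..1}"
      have g: "norm (noise \<omega> s) \<le> \<sigma> * L" if "s \<in> {0..1}" for s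
      proof -
        have "norm (\<omega> s - \<omega> 0) \<le> L" using osc w that by (auto simp: oscillates_def not_less)
        thus ?thesis using \<sigma>_pos by (simp add: noise_def)
      qed
      define B where "B = C * ((1 + \<sigma>) ^ r * L ^ r)"
      have B0: "0 \<le> B" using C0 \<sigma>_pos L by (simp add: B_def)
      have B: "norm (b (noise \<omega> s)) \<le> B" if "s \<in> {0..1}" for s
      proof -
        have "1 + norm (noise \<omega> s) \<le> (1 + \<sigma>) * L" using g[OF that] L by (simp add: algebra_simps)
        hence "(1 + norm (noise \<omega> s)) ^ r \<le> ((1 + \<sigma>) * L) ^ r" by (intro power_mono) auto
        hence "C * (1 + norm (noise \<omega> s)) ^ r \<le> B" unfolding B_def using C0
          by (intro mult_left_mono) (auto simp: power_mult_distrib)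
        thus ?thesis using growth[of "noise \<omega> s"] by linarith
      qed
      have "(norm (\<phi> t \<omega> y - noise \<omega> t))\<^sup>2 \<le> ((norm y)\<^sup>2 + B\<^sup>2) * exp ((2 * \<Lambda> + 1) * t)"
      proof (rule le_if_le_on_dense[OF D(2), where F = "\<lambda>y. (norm (\<phi> t \<omega> y - noise \<omega> t))\<^sup>2"
            and G = "\<lambda>y. ((norm y)\<^sup>2 + B\<^sup>2) * exp ((2 * \<Lambda> + 1) * t)"])
        fix d assume "d \<in> D"
        thus "(norm (\<phi> t \<omega> d - noise \<omega> t))\<^sup>2 \<le> ((norm d)\<^sup>2 + B\<^sup>2) * exp ((2 * \<Lambda> + 1) * t)"
          using elim t B \<Lambda>_pos
          by (intro solution_bound[OF cont_b one_sided, where T = 1]) (auto simp: solution_def)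
      qed (use cont_flow[of t \<omega>] t w in \<open>auto intro!: continuous_intros\<close>)
      also have "\<dots> \<le> (L + B)\<^sup>2 * E\<^sup>2"
      proof (rule mult_mono)
        have "(norm y)\<^sup>2 \<le> L\<^sup>2" using y by (intro power_mono) auto
        thus "(norm y)\<^sup>2 + B\<^sup>2 \<le> (L + B)\<^sup>2" using L B0 by (simp add: power2_sum add_increasing2)
        have "(2 * \<Lambda> + 1) * t \<le> (2 * \<Lambda> + 1) * 1" using t \<Lambda>_pos by (intro mult_left_mono) auto
        hence "exp ((2 * \<Lambda> + 1) * t) \<le> E" by (simp add: E_def)
        also have "E \<le> E\<^sup>2" using E1 by (simp add: power2_eq_square)
        finally show "exp ((2 * \<Lambda> + 1) * t) \<le> E\<^sup>2" .
      qed auto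
      finally have "(norm (\<phi> t \<omega> y - noise \<omega> t))\<^sup>2 \<le> ((L + B) * E)\<^sup>2" by (simp add: power_mult_distrib)
      hence "norm (\<phi> t \<omega> y - noise \<omega> t) \<le> (L + B) * E"
        by (rule power2_le_imp_le) (use L B0 E1 in simp)
      moreover have "norm (\<phi> t \<omega> y) \<le> norm (\<phi> t \<omega> y - noise \<omega> t) + norm (noise \<omega> t)"
        using norm_triangle_ineq[of "\<phi> t \<omega> y - noise \<omega> t" "noise \<omega> t"] by simp
      ultimately have "norm (\<phi> t \<omega> y) \<le> \<sigma> * L + (L + B) * E" using g[OF t] by linarith
      also have "\<dots> \<le> \<sigma> * L ^ (r + 1) + (L ^ (r + 1) + C * (1 + \<sigma>) ^ r * L ^ (r + 1)) * E"
      proof (intro add_mono mult_left_mono mult_right_mono)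
        show LL: "L \<le> L ^ (r + 1)" "L \<le> L ^ (r + 1)" using L power_increasing[of 1 "r + 1" L] by auto
        have "L ^ r \<le> L ^ (r + 1)" using L by (intro power_increasing) auto
        thus "B \<le> C * (1 + \<sigma>) ^ r * L ^ (r + 1)" unfolding B_def mult.assoc
          using C0 \<sigma>_pos by (intro mult_left_mono) auto
      qed (use \<sigma>_pos E1 in auto)
      also have "\<dots> = C' * L ^ (r + 1)" by (simp add: C'_def algebra_simps)
      finally show "norm (\<phi> t \<omega> y) \<le> C' * L ^ (r + 1)" .
    qed
  qed
  moreover have "0 \<le> C'" using C0 \<sigma>_pos E1 by (simp add: C'_def)
  ultimately show ?thesis by blast
qed


subsection \<open>Adaptedness\<close>

text \<open>
  Subtracting the value at \<open>0\<close> makes the glued path vanish there, as almost every Wiener path does.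
\<close>

definition glue :: "(real \<Rightarrow> 'a) \<Rightarrow> (real \<Rightarrow> 'a) \<Rightarrow> real \<Rightarrow> 'a" where
  "glue p f = (\<lambda>s. (p s + f s) - (p 0 + f 0))"

lemma glue_in_paths: "p \<in> paths \<Longrightarrow> f \<in> paths \<Longrightarrow> glue p f \<in> paths"
  unfolding glue_def paths_def by (auto intro!: continuous_intros)

lemma measurable_glue: "(\<lambda>(p, f). glue p f) \<in> path_borel \<Otimes>\<^sub>M path_borel \<rightarrow>\<^sub>M path_borel"
proof (rule measurable_into_path_borel)
  show "(case x of (p, f) \<Rightarrow> glue p f) \<in> paths" if "x \<in> space (path_borel \<Otimes>\<^sub>M path_borel)" for x
    using that glue_in_paths by (auto simp: space_pair_measure)
  show "(\<lambda>x. (case x of (p, f) \<Rightarrow> glue p f) s) \<in> borel_measurable (path_borel \<Otimes>\<^sub>M path_borel)" for s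
    unfolding glue_def case_prod_beta
    by (intro borel_measurable_diff borel_measurable_add measurable_compose[OF measurable_fst measurable_path_eval]
        measurable_compose[OF measurable_snd measurable_path_eval])
qed

lemma glue_past_future: "glue (past t \<omega>) (future t \<omega>) = shift 0 \<omega>"
proof
  fix s
  have "past t \<omega> s + future t \<omega> s = \<omega> s - \<omega> t" for s
    by (cases "s \<le> t") (auto simp: past_def future_def min_def max_def)
  thus "glue (past t \<omega>) (future t \<omega>) s = shift 0 \<omega> s" by (simp add: glue_def shift_def)
qed

text \<open>
  Since past and future are independent, gluing the past of one path to the future of an independent
  one produces the law of the Wiener path again. By Fubini some fixed future is typical for almost every past.
\<close>

lemma AE_glue_typical:
  assumes Q: "AE \<omega> in P. Q \<omega>"
  shows "\<exists>f \<in> paths. (\<forall>u\<le>t. f u = 0) \<and> (AE \<omega> in P. Q (glue (past t \<omega>) f))"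
proof -
  obtain N where N: "{\<omega> \<in> space P. \<not> Q \<omega>} \<subseteq> N" "N \<in> sets P" "emeasure P N = 0"
    using Q by (rule AE_E)
  interpret PP: pair_sigma_finite P P ..
  define g where "g = (\<lambda>z. indicator N (case z of (p, f) \<Rightarrow> glue p f) :: ennreal)"
  have gm: "g \<in> borel_measurable (path_borel \<Otimes>\<^sub>M path_borel)"
    unfolding g_def using N(2) by (intro measurable_compose[OF measurable_glue]) auto
  have "AE \<omega> in P. \<omega> \<notin> N" using N by (intro AE_not_in) (auto simp: null_sets_def)
  hence "AE \<omega> in P. shift 0 \<omega> \<notin> N" by (rule AE_shift)
  hence "(\<integral>\<^sup>+\<omega>. g (past t \<omega>, future t \<omega>) \<partial>P) = (\<integral>\<^sup>+\<omega>. 0 \<partial>P)"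
    by (intro nn_integral_cong_AE) (auto simp: g_def glue_past_future)
  hence 0: "(\<integral>\<^sup>+\<omega>. (\<integral>\<^sup>+\<omega>'. g (past t \<omega>, future t \<omega>') \<partial>P) \<partial>P) = 0"
    using nn_integral_past_future[OF gm, of t] by simp
  have m2: "(\<lambda>(\<omega>, \<omega>'). g (past t \<omega>, future t \<omega>')) \<in> borel_measurable (P \<Otimes>\<^sub>M P)"
  proof -
    have 1: "(\<lambda>(\<omega>, \<omega>'). (past t \<omega>, future t \<omega>')) \<in> P \<Otimes>\<^sub>M P \<rightarrow>\<^sub>M path_borel \<Otimes>\<^sub>M path_borel"
      unfolding case_prod_beta by measurable
    show ?thesis using measurable_compose[OF 1 gm] by (simp add: case_prod_beta)
  qed
  have "(\<integral>\<^sup>+\<omega>'. (\<integral>\<^sup>+\<omega>. g (past t \<omega>, future t \<omega>') \<partial>P) \<partial>P) = 0"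
    using PP.Fubini'[OF m2] 0 by simp
  moreover have "(\<lambda>\<omega>'. \<integral>\<^sup>+\<omega>. g (past t \<omega>, future t \<omega>') \<partial>P) \<in> borel_measurable P"
    by (rule borel_measurable_nn_integral) (use measurable_compose[OF measurable_pair_swap' m2] in \<open>simp add: case_prod_beta\<close>)
  ultimately have "AE \<omega>' in P. (\<integral>\<^sup>+\<omega>. g (past t \<omega>, future t \<omega>') \<partial>P) = 0"
    by (subst (asm) nn_integral_0_iff_AE) auto
  with AE_space have "AE \<omega>' in P. \<omega>' \<in> paths \<and> (\<integral>\<^sup>+\<omega>. g (past t \<omega>, future t \<omega>') \<partial>P) = 0"
    by eventually_elim simp
  note typical = this
  have "\<exists>\<omega>'. \<omega>' \<in> paths \<and> (\<integral>\<^sup>+\<omega>. g (past t \<omega>, future t \<omega>') \<partial>P) = 0"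
  proof (rule ccontr)
    assume no: "\<not> ?thesis"
    have "AE \<omega>' in P. False" by (rule eventually_mono[OF typical]) (use no in blast)
    thus False by simp
  qed
  then obtain \<omega>' where w': "\<omega>' \<in> paths" "(\<integral>\<^sup>+\<omega>. g (past t \<omega>, future t \<omega>') \<partial>P) = 0"
    by blast
  have "(\<lambda>\<omega>. g (past t \<omega>, future t \<omega>')) \<in> borel_measurable P"
    using measurable_compose[OF measurable_Pair1'[of \<omega>' P P] measurable_compose[OF measurable_pair_swap' m2]] w' by simp
  hence "AE \<omega> in P. g (past t \<omega>, future t \<omega>') = 0" using w'(2) by (subst (asm) nn_integral_0_iff_AE) auto
  with AE_space have "AE \<omega> in P. Q (glue (past t \<omega>) (future t \<omega>'))"
  proof eventually_elim
    case (elim \<omega>)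
    hence "glue (past t \<omega>) (future t \<omega>') \<in> paths" "glue (past t \<omega>) (future t \<omega>') \<notin> N"
      using w' glue_in_paths by (auto simp: g_def indicator_def split: if_splits)
    thus ?case using N(1) by auto
  qed
  moreover have "\<forall>u\<le>t. future t \<omega>' u = 0" by (simp add: future_def)
  ultimately show ?thesis using w' by (intro bexI[of _ "future t \<omega>'"]) auto
qed

text \<open>
  The solution up to time \<open>t\<close> is almost surely a measurable function of the past. With the future
  replaced by a fixed typical one, the flow still solves the equation, driven by the same noise on
  \<open>[0, t]\<close>, so uniqueness applies.
\<close>

lemma adapted:
  assumes t: "0 \<le> t"
  shows "\<exists>e. e \<in> path_borel \<rightarrow>\<^sub>M path_borel \<and> (AE \<omega> in P. \<forall>u\<in>{0..t}. \<phi> u (e (past t \<omega>)) 0 = \<phi> u \<omega> 0)"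
proof -
  obtain f where f: "f \<in> paths" "\<And>u. u \<le> t \<Longrightarrow> f u = 0" "AE \<omega> in P. solution (glue (past t \<omega>) f) 0"
    using AE_glue_typical[OF AE_solution] by blast
  have "AE \<omega> in P. \<forall>u\<in>{0..t}. \<phi> u (glue (past t \<omega>) f) 0 = \<phi> u \<omega> 0"
    using f(3) AE_solution[of 0]
  proof eventually_elim
    case (elim \<omega>)
    have "noise (glue (past t \<omega>) f) s = noise \<omega> s" if "s \<in> {0..t}" for s
      using that t f(2) by (simp add: noise_def glue_def past_def min_def)
    hence 1: "solves_on b t (noise \<omega>) 0 (\<lambda>u. \<phi> u (glue (past t \<omega>) f) 0)"
      using elim(1) t unfolding solution_def by (blast intro: solves_on_cong)
    have 2: "solves_on b t (noise \<omega>) 0 (\<lambda>u. \<phi> u \<omega> 0)" using elim(2) t by (simp add: solution_def)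
    show ?case
    proof
      fix u assume u: "u \<in> {0..t}"
      have "norm (\<phi> u (glue (past t \<omega>) f) 0 - \<phi> u \<omega> 0) \<le> norm (0 - 0 :: 'a) * exp (integral {0..u} (\<lambda>s. \<Lambda>))"
        by (rule solutions_distance[OF cont_b _ one_sided 1 2 u]) (auto intro: continuous_intros)
      thus "\<phi> u (glue (past t \<omega>) f) 0 = \<phi> u \<omega> 0" by simp
    qed
  qed
  moreover have "(\<lambda>p. glue p f) \<in> path_borel \<rightarrow>\<^sub>M path_borel"
    using measurable_compose[OF measurable_Pair2'[of f path_borel path_borel] measurable_glue] f(1)
    by simp
  ultimately show ?thesis by (intro exI[of _ "\<lambda>p. glue p f"]) simp
qed

end

section \<open>Occupation of a neighbourhood of the origin\<close>

text \<open>
  Turns the exponential of an occupation time into an expression linear in the occupation time, whose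
  expectation can be computed by Fubini.
\<close>

lemma exp_chord:
  fixes c \<tau> :: real
  assumes "0 \<le> \<tau>" "\<tau> \<le> 1"
  shows "exp (c * \<tau>) \<le> 1 + (exp c - 1) * \<tau>"
  using convex_onD[OF exp_convex assms, of 0 c] by (simp add: algebra_simps)

context sde_flow
begin

text \<open>
  The weight \<open>G\<close> is any functional of the solution up to time \<open>t\<close>; the bound says that, conditionally on the past,
  the solution is unlikely to be near the origin at time \<open>t + \<delta>\<close>. By \<open>solution_localized\<close> this event
  requires a large oscillation of the noise or that the position at time \<open>t\<close> plus the Gaussian increment be near the
  origin. Both events involve the future only through its law once the position at time \<open>t\<close> is fixed.
\<close>

lemma occupation_bound:
  fixes t \<delta> m \<rho> K R1 :: real
  assumes t: "0 \<le> t" and \<delta>: "0 < \<delta>" and m: "0 < m" and R1: "0 \<le> R1"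
    and K: "\<And>z. norm z \<le> \<rho> \<Longrightarrow> norm (b z) \<le> K" "0 \<le> K" "K * \<delta> \<le> 1"
    and \<rho>: "R1 + 2 * m + 2 \<le> \<rho>"
    and G: "G \<in> borel_measurable path_borel"
    and Gt: "\<And>\<omega> \<omega>'. (\<And>u. u \<in> {0..t} \<Longrightarrow> \<phi> u \<omega> 0 = \<phi> u \<omega>' 0) \<Longrightarrow> G \<omega> = (G \<omega>' :: ennreal)"
  shows "(\<integral>\<^sup>+\<omega>. G \<omega> * indicator {..R1} (norm (\<phi> (t + \<delta>) \<omega> 0)) \<partial>P)
    \<le> ennreal (8 * DIM('a) * \<delta> * \<sigma>\<^sup>2 / m\<^sup>2 + (R1 + 1) / (\<sigma> * sqrt \<delta>)) * (\<integral>\<^sup>+\<omega>. G \<omega> \<partial>P)"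
proof -
  obtain e where e: "e \<in> path_borel \<rightarrow>\<^sub>M path_borel" "AE \<omega> in P. \<forall>u\<in>{0..t}. \<phi> u (e (past t \<omega>)) 0 = \<phi> u \<omega> 0"
    using adapted[OF t] by blast
  define Osc where "Osc = oscillates t \<delta> (m / \<sigma>)"
  define Y where "Y = (\<lambda>p. \<phi> t (e p) 0)"
  define near where "near = (\<lambda>x (\<omega> :: real \<Rightarrow> 'a). norm (x + \<sigma> *\<^sub>R (\<omega> (t + \<delta>) - \<omega> t)))"
  define I1 where "I1 = (\<lambda>\<omega>. indicator Osc \<omega> :: ennreal)"
  define I2 where "I2 = (\<lambda>x (\<omega> :: real \<Rightarrow> 'a). indicator {..R1 + 1} (near x \<omega>) :: ennreal)"
  define \<eta>1 where "\<eta>1 = 8 * DIM('a) * \<delta> * \<sigma>\<^sup>2 / m\<^sup>2"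
  define \<eta>2 where "\<eta>2 = (R1 + 1) / (\<sigma> * sqrt \<delta>)"
  have \<eta>: "0 \<le> \<eta>1" "0 \<le> \<eta>2" using \<delta> \<sigma>_pos R1 by (auto simp: \<eta>1_def \<eta>2_def)
  have Osc: "Osc \<in> sets path_borel" unfolding Osc_def by (rule oscillates_measurable[OF \<delta>])
  have Ym: "Y \<in> borel_measurable path_borel"
    unfolding Y_def by (rule measurable_compose[OF e(1) flow_measurable_path[OF t]])
  have Gem: "(\<lambda>p. G (e p)) \<in> borel_measurable path_borel" by (rule measurable_compose[OF e(1) G])
  have nearm: "near x \<in> borel_measurable path_borel" for x unfolding near_def by measurable
  have pastO: "future t \<omega> \<in> Osc \<longleftrightarrow> \<omega> \<in> Osc" if "\<omega> \<in> paths" for \<omega>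
  proof -
    have "future t \<omega> u - future t \<omega> t = \<omega> u - \<omega> t" if "u \<in> {t..t + \<delta>}" for u
      using that by (cases "u = t") (auto simp: future_def max_def)
    hence "(\<exists>u\<in>{t..t + \<delta>}. m / \<sigma> < norm (future t \<omega> u - future t \<omega> t)) \<longleftrightarrow>
        (\<exists>u\<in>{t..t + \<delta>}. m / \<sigma> < norm (\<omega> u - \<omega> t))" by (intro bex_cong refl) simp
    thus ?thesis using that by (simp add: Osc_def oscillates_def)
  qed
  have near_fut: "near x (future t \<omega>) = near x \<omega>" for x \<omega>
    using \<delta> by (simp add: near_def future_def)
  \<comment> \<open>a bound for the integrand on the left that separates past \<open>p\<close> and future \<open>f\<close>\<close>
  define F where "F = (\<lambda>(p, f). G (e p) * (I1 f + I2 (Y p) f))"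
  let ?PP = "path_borel \<Otimes>\<^sub>M path_borel :: ((real \<Rightarrow> 'a) \<times> (real \<Rightarrow> 'a)) measure"
  have Fm: "F \<in> borel_measurable ?PP"
  proof -
    have 1: "(\<lambda>z. G (e (fst z))) \<in> borel_measurable ?PP"
      by (rule measurable_compose[OF measurable_fst Gem])
    have 2: "(\<lambda>z. I1 (snd z)) \<in> borel_measurable ?PP"
      unfolding I1_def using Osc by (intro measurable_compose[OF measurable_snd]) simp
    have 3: "(\<lambda>z. near (Y (fst z)) (snd z)) \<in> borel_measurable ?PP"
    proof -
      have [measurable]: "(\<lambda>z. Y (fst z)) \<in> borel_measurable ?PP"
        by (rule measurable_compose[OF measurable_fst Ym])
      have [measurable]: "(\<lambda>z. snd z s) \<in> borel_measurable ?PP" for s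
        by (rule measurable_compose[OF measurable_snd measurable_path_eval])
      show ?thesis unfolding near_def by measurable
    qed
    have 4: "(\<lambda>z. I2 (Y (fst z)) (snd z)) \<in> borel_measurable ?PP"
      unfolding I2_def by (rule measurable_compose[OF 3]) simp
    have "(\<lambda>z. G (e (fst z)) * (I1 (snd z) + I2 (Y (fst z)) (snd z))) \<in> borel_measurable ?PP"
      by (intro borel_measurable_times_ennreal borel_measurable_add 1 2 4)
    thus ?thesis by (simp add: F_def case_prod_beta)
  qed
  have inner: "(\<integral>\<^sup>+\<omega>'. F (p, future t \<omega>') \<partial>P) \<le> G (e p) * ennreal (\<eta>1 + \<eta>2)" for p
  proof -
    have I1m: "I1 \<in> borel_measurable P" using Osc by (simp add: I1_def)
    have I2m: "I2 x \<in> borel_measurable P" for x unfolding I2_def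
      by (rule measurable_compose[of _ _ borel]) (use nearm in auto)
    have "(\<integral>\<^sup>+\<omega>'. F (p, future t \<omega>') \<partial>P) = (\<integral>\<^sup>+\<omega>'. G (e p) * (I1 \<omega>' + I2 (Y p) \<omega>') \<partial>P)"
      by (intro nn_integral_cong) (simp add: F_def I1_def I2_def near_fut pastO indicator_def)
    also have "\<dots> = G (e p) * ((\<integral>\<^sup>+\<omega>'. I1 \<omega>' \<partial>P) + (\<integral>\<^sup>+\<omega>'. I2 (Y p) \<omega>' \<partial>P))"
      using I1m I2m by (simp add: nn_integral_cmult nn_integral_add)
    also have "\<dots> \<le> G (e p) * (ennreal \<eta>1 + ennreal \<eta>2)"
    proof (intro mult_left_mono add_mono)
      have "(\<integral>\<^sup>+\<omega>'. I1 \<omega>' \<partial>P) = ennreal (prob Osc)" using Osc by (simp add: I1_def emeasure_eq_measure)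
      also have "\<dots> \<le> ennreal (8 * DIM('a) * \<delta> / (m / \<sigma>)\<^sup>2)" unfolding Osc_def
        using m \<sigma>_pos by (intro ennreal_leI oscillation_tail \<delta>) auto
      also have "8 * DIM('a) * \<delta> / (m / \<sigma>)\<^sup>2 = \<eta>1" by (simp add: \<eta>1_def power_divide)
      finally show "(\<integral>\<^sup>+\<omega>'. I1 \<omega>' \<partial>P) \<le> ennreal \<eta>1" .
      have set: "{\<omega> \<in> paths. near (Y p) \<omega> \<le> R1 + 1} \<in> sets P"
      proof -
        have "{\<omega> \<in> space path_borel. near (Y p) \<omega> \<le> R1 + 1} \<in> sets path_borel"
          using nearm by (intro borel_measurable_le) auto
        thus ?thesis by simp
      qed
      have "(\<integral>\<^sup>+\<omega>'. I2 (Y p) \<omega>' \<partial>P) = (\<integral>\<^sup>+\<omega>'. indicator {\<omega> \<in> paths. near (Y p) \<omega> \<le> R1 + 1} \<omega>' \<partial>P)"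
        by (intro nn_integral_cong) (auto simp: I2_def indicator_def)
      also have "\<dots> = ennreal (prob {\<omega> \<in> paths. near (Y p) \<omega> \<le> R1 + 1})"
        using set by (simp add: emeasure_eq_measure)
      also have "\<dots> \<le> ennreal ((R1 + 1) / (\<sigma> * sqrt (t + \<delta> - t)))" unfolding near_def
        using R1 \<delta> \<sigma>_pos by (intro ennreal_leI increment_small_ball) auto
      finally show "(\<integral>\<^sup>+\<omega>'. I2 (Y p) \<omega>' \<partial>P) \<le> ennreal \<eta>2" by (simp add: \<eta>2_def)
    qed auto
    finally show ?thesis using \<eta> by simp
  qed
  have "(\<integral>\<^sup>+\<omega>. G \<omega> * indicator {..R1} (norm (\<phi> (t + \<delta>) \<omega> 0)) \<partial>P) \<le> (\<integral>\<^sup>+\<omega>. F (past t \<omega>, future t \<omega>) \<partial>P)"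
  proof (rule nn_integral_mono_AE)
    show "AE \<omega> in P. G \<omega> * indicator {..R1} (norm (\<phi> (t + \<delta>) \<omega> 0)) \<le> F (past t \<omega>, future t \<omega>)"
      using e(2) AE_solution[of 0] AE_space
    proof eventually_elim
      case (elim \<omega>)
      hence w: "\<omega> \<in> paths" by simp
      have Ge: "G (e (past t \<omega>)) = G \<omega>" using elim(1) by (intro Gt) auto
      have Ye: "Y (past t \<omega>) = \<phi> t \<omega> 0" using elim(1) t by (simp add: Y_def)
      have "near (\<phi> t \<omega> 0) \<omega> \<le> R1 + 1" if far: "norm (\<phi> (t + \<delta>) \<omega> 0) \<le> R1" and no: "\<omega> \<notin> Osc"
      proof -
        have gg: "noise \<omega> u - noise \<omega> t = \<sigma> *\<^sub>R (\<omega> u - \<omega> t)" for u by (simp add: noise_def algebra_simps)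
        have "norm (\<phi> t \<omega> 0 + (noise \<omega> (t + \<delta>) - noise \<omega> t)) \<le> R1 + 1"
        proof (rule solution_localized[OF cont_b, where T = "t + \<delta>" and X = "\<lambda>t. \<phi> t \<omega> 0" and m = m and \<rho> = \<rho> and K = K])
          show "solves_on b (t + \<delta>) (noise \<omega>) 0 (\<lambda>t. \<phi> t \<omega> 0)" using elim(2) t \<delta> by (simp add: solution_def)
          fix u assume "t \<le> u" "u \<le> t + \<delta>"
          hence "norm (\<omega> u - \<omega> t) \<le> m / \<sigma>" using no w by (auto simp: Osc_def oscillates_def not_less)
          thus "norm (noise \<omega> u - noise \<omega> t) \<le> m" using \<sigma>_pos unfolding gg by (simp add: pos_le_divide_eq mult.commute)
        qed (use K t \<delta> \<rho> far in auto)
        thus ?thesis by (simp add: near_def gg)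
      qed
      hence "indicator {..R1} (norm (\<phi> (t + \<delta>) \<omega> 0)) \<le> I1 (future t \<omega>) + I2 (Y (past t \<omega>)) (future t \<omega>)"
        using w by (auto simp: I1_def I2_def near_fut pastO Ye indicator_def)
      thus ?case unfolding F_def by (simp add: Ge mult_left_mono)
    qed
  qed
  also have "\<dots> = (\<integral>\<^sup>+\<omega>. (\<integral>\<^sup>+\<omega>'. F (past t \<omega>, future t \<omega>') \<partial>P) \<partial>P)" by (rule nn_integral_past_future[OF Fm])
  also have "\<dots> \<le> (\<integral>\<^sup>+\<omega>. G (e (past t \<omega>)) * ennreal (\<eta>1 + \<eta>2) \<partial>P)" by (intro nn_integral_mono inner)
  also have "\<dots> = (\<integral>\<^sup>+\<omega>. G \<omega> * ennreal (\<eta>1 + \<eta>2) \<partial>P)"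
  proof (rule nn_integral_cong_AE)
    show "AE \<omega> in P. G (e (past t \<omega>)) * ennreal (\<eta>1 + \<eta>2) = G \<omega> * ennreal (\<eta>1 + \<eta>2)"
      using e(2) by eventually_elim (use Gt in metis)
  qed
  also have "\<dots> = ennreal (\<eta>1 + \<eta>2) * (\<integral>\<^sup>+\<omega>. G \<omega> \<partial>P)" using G by (simp add: nn_integral_multc mult.commute)
  finally show ?thesis by (simp add: \<eta>1_def \<eta>2_def)
qed

end

text \<open>
  The two terms in the last assumption besides \<open>\<delta>\<close> are the bounds of \<open>occupation_bound\<close>. The assumption says that the
  expected share of a unit interval that the solution spends near the origin is so small that
  contraction wins.
\<close>

locale contracting_flow = sde_flow P b \<Lambda> \<sigma> \<phi>
  for P :: "(real \<Rightarrow> 'a::euclidean_space) measure" and b \<Lambda> \<sigma> \<phi> +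
  fixes R l \<delta> m \<rho> K :: real
  assumes far: "\<And>x y. R < norm x \<Longrightarrow> (b x - b y) \<bullet> (x - y) \<le> - l * (norm (x - y))\<^sup>2"
    and R_pos: "0 < R" and l_pos: "0 < l" and \<delta>: "0 < \<delta>" "\<delta> < 1" and m_pos: "0 < m"
    and K: "\<And>z. norm z \<le> \<rho> \<Longrightarrow> norm (b z) \<le> K" "0 \<le> K" "K * \<delta> \<le> 1"
    and \<rho>: "(R + 1) + 2 * m + 2 \<le> \<rho>"
    and rate: "exp (- l) * (1 + (exp (\<Lambda> + l) - 1) *
        (\<delta> + (8 * DIM('a) * \<delta> * \<sigma>\<^sup>2 / m\<^sup>2 + ((R + 1) + 1) / (\<sigma> * sqrt \<delta>)))) \<le> exp (- l / 2)"
begin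

text \<open>
  A continuous substitute for the indicator of the ball of radius \<open>R\<close>, so that the resulting rate can
  be used in Gronwall's inequality.
\<close>

definition bump :: "'a \<Rightarrow> real" where "bump x = max 0 (min 1 (R + 1 - norm x))"

definition rate_at :: "'a \<Rightarrow> real" where "rate_at x = - l + (\<Lambda> + l) * bump x"

text \<open>
  The flow is measurable for nonnegative times; \<open>max 0 u\<close> makes the integrand
  measurable on all of \<open>\<real>\<close> and does not change it on the interval of integration.
\<close>

definition occupation_time :: "nat \<Rightarrow> (real \<Rightarrow> 'a) \<Rightarrow> ennreal" where
  "occupation_time j \<omega> = (\<integral>\<^sup>+u. ennreal (bump (\<phi> (max 0 u) \<omega> 0)) * indicator {real j..real j + 1} u \<partial>lborel)"

definition \<kappa> :: real where "\<kappa> = exp (\<Lambda> + l) - 1"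

text \<open>
  An upper bound for the exponential of the integral of \<open>rate_at\<close> along the solution over
  \<open>[0, n]\<close>, in which each unit interval contributes a factor linear in its occupation time.
\<close>

definition gain :: "nat \<Rightarrow> (real \<Rightarrow> 'a) \<Rightarrow> ennreal" where
  "gain n \<omega> = (\<Prod>j<n. ennreal (exp (- l)) * (1 + ennreal \<kappa> * occupation_time j \<omega>))"

lemma \<kappa>_nonneg: "0 \<le> \<kappa>" using \<Lambda>_pos l_pos by (simp add: \<kappa>_def)

lemma bump_range: "0 \<le> bump x" "bump x \<le> 1" by (auto simp: bump_def)

lemma cont_bump: "continuous_on A bump" unfolding bump_def by (intro continuous_intros)

lemma bump_le_indicator: "ennreal (bump x) \<le> indicator {..R + 1} (norm x)"
  by (auto simp: bump_def indicator_def ennreal_neg)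

lemma rate_at_bound: "(b x - b y) \<bullet> (x - y) \<le> rate_at x * (norm (x - y))\<^sup>2"
proof (cases "R < norm x")
  case True
  have "- l \<le> rate_at x" using bump_range[of x] \<Lambda>_pos l_pos by (simp add: rate_at_def)
  thus ?thesis using far[OF True, of y] mult_right_mono[of "- l" "rate_at x" "(norm (x - y))\<^sup>2"] by simp
next
  case False
  hence "rate_at x = \<Lambda>" by (simp add: rate_at_def bump_def)
  thus ?thesis using one_sided by simp
qed

lemma bump_flow_measurable:
  "(\<lambda>(\<omega>, u). ennreal (bump (\<phi> (max 0 u) \<omega> 0)) * indicator {a..c} u) \<in> borel_measurable (path_borel \<Otimes>\<^sub>M lborel)"
proof -
  have 1: "(\<lambda>z. \<phi> (max 0 (snd z)) (fst z) 0) \<in> borel_measurable (path_borel \<Otimes>\<^sub>M lborel)"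
    by (rule flow_measurable) auto
  have 2: "bump \<in> borel_measurable borel" by (rule borel_measurable_continuous_onI[OF cont_bump])
  have 3: "(\<lambda>z. ennreal (bump (\<phi> (max 0 (snd z)) (fst z) 0))) \<in> borel_measurable (path_borel \<Otimes>\<^sub>M lborel)"
    using measurable_compose[OF 1 2] by simp
  have 4: "(\<lambda>z. indicator {a..c} (snd z) :: ennreal) \<in> borel_measurable (path_borel \<Otimes>\<^sub>M lborel)"
    by (rule measurable_compose[OF measurable_snd]) simp
  show ?thesis unfolding case_prod_beta by (intro borel_measurable_times_ennreal 3 4)
qed

lemma occupation_time_measurable: "occupation_time j \<in> borel_measurable path_borel"
  unfolding occupation_time_def by (rule lborel.borel_measurable_nn_integral[OF bump_flow_measurable])

lemma gain_measurable: "gain n \<in> borel_measurable path_borel"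
  unfolding gain_def using occupation_time_measurable by (intro borel_measurable_prod_ennreal) auto

lemma occupation_time_depends:
  assumes "\<And>u. u \<in> {0..t} \<Longrightarrow> \<phi> u \<omega> 0 = \<phi> u \<omega>' 0" "real j + 1 \<le> t"
  shows "occupation_time j \<omega> = occupation_time j \<omega>'"
  unfolding occupation_time_def using assms by (intro nn_integral_cong) (auto simp: indicator_def)

lemma gain_depends:
  assumes "\<And>u. u \<in> {0..t} \<Longrightarrow> \<phi> u \<omega> 0 = \<phi> u \<omega>' 0" "real n \<le> t"
  shows "gain n \<omega> = gain n \<omega>'"
  unfolding gain_def
proof (rule prod.cong[OF refl])
  fix j assume "j \<in> {..<n}"
  hence "real j + 1 \<le> t" using assms(2) by simp
  hence "occupation_time j \<omega> = occupation_time j \<omega>'" using assms(1) by (rule occupation_time_depends[rotated])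
  thus "ennreal (exp (- l)) * (1 + ennreal \<kappa> * occupation_time j \<omega>) = ennreal (exp (- l)) * (1 + ennreal \<kappa> * occupation_time j \<omega>')" by simp
qed

text \<open>
  The factor of the interval \<open>[n, n + 1]\<close> is integrated against the earlier factors. At times
  before \<open>n + \<delta>\<close> the occupation is bounded trivially, which costs \<open>\<delta>\<close>; at later times \<open>u\<close> the earlier factors
  are determined by the solution up to time \<open>u - \<delta>\<close>, and \<open>occupation_bound\<close> applies.
\<close>

lemma expected_gain: "(\<integral>\<^sup>+\<omega>. gain n \<omega> \<partial>P) \<le> ennreal (exp (- l / 2) ^ n)"
proof (induction n)
  case 0
  show ?case using emeasure_space_1 by (simp add: gain_def)
next
  case (Suc n)
  define \<eta> where "\<eta> = 8 * DIM('a) * \<delta> * \<sigma>\<^sup>2 / m\<^sup>2 + ((R + 1) + 1) / (\<sigma> * sqrt \<delta>)"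
  have \<eta>: "0 \<le> \<eta>" using \<delta> \<sigma>_pos R_pos by (auto simp: \<eta>_def intro!: add_nonneg_nonneg)
  let ?w = "\<lambda>u. indicator {real n..real n + \<delta>} u + ennreal \<eta> * indicator {real n..real n + 1} u"
  let ?f = "\<lambda>\<omega> u. ennreal (bump (\<phi> (max 0 u) \<omega> 0)) * indicator {real n..real n + 1} u"
  define E where "E = (\<integral>\<^sup>+\<omega>. gain n \<omega> \<partial>P)"
  interpret pair_sigma_finite P lborel ..
  have gm: "gain n \<in> borel_measurable P" and om: "occupation_time n \<in> borel_measurable P"
    using gain_measurable occupation_time_measurable by (simp_all cong: measurable_cong_sets)
  define H where "H = (\<lambda>\<omega> u. gain n \<omega> * (?f \<omega> u))"
  have Hm: "case_prod H \<in> borel_measurable (P \<Otimes>\<^sub>M lborel)"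
  proof -
    have "(\<lambda>z. gain n (fst z)) \<in> borel_measurable (P \<Otimes>\<^sub>M lborel)"
      by (rule measurable_compose[OF measurable_fst gm])
    moreover have "(\<lambda>(\<omega>, u). ?f \<omega> u) \<in> borel_measurable (P \<Otimes>\<^sub>M lborel)"
      using bump_flow_measurable by (simp cong: measurable_cong_sets sets_pair_measure_cong)
    ultimately show ?thesis unfolding H_def case_prod_beta by (rule borel_measurable_times_ennreal)
  qed
  have slice: "(\<integral>\<^sup>+\<omega>. H \<omega> u \<partial>P) \<le> E * ?w u" for u
  proof (cases "u \<in> {real n..real n + 1}")
    case False thus ?thesis by (simp add: H_def)
  next
    case True
    hence u0: "max 0 u = u" by simp
    show ?thesis
    proof (cases "u \<le> real n + \<delta>")
      case le: True
      have "(\<integral>\<^sup>+\<omega>. H \<omega> u \<partial>P) \<le> (\<integral>\<^sup>+\<omega>. gain n \<omega> * 1 \<partial>P)"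
        unfolding H_def using bump_range True by (intro nn_integral_mono mult_left_mono) (auto simp: indicator_def)
      also have "\<dots> = E * 1" by (simp add: E_def)
      also have "\<dots> \<le> E * ?w u"
        using True le by (intro mult_left_mono) auto
      finally show ?thesis .
    next
      case gt: False
      define t where "t = u - \<delta>"
      have t: "real n \<le> t" "u = t + \<delta>" using gt by (auto simp: t_def)
      have "(\<integral>\<^sup>+\<omega>. H \<omega> u \<partial>P) \<le> (\<integral>\<^sup>+\<omega>. gain n \<omega> * indicator {..R + 1} (norm (\<phi> (t + \<delta>) \<omega> 0)) \<partial>P)"
        unfolding H_def u0 using True bump_le_indicator
        by (intro nn_integral_mono mult_left_mono) (auto simp: t(2) indicator_def)
      also have "\<dots> \<le> ennreal \<eta> * E" unfolding \<eta>_def E_def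
      proof (rule occupation_bound[where \<rho> = \<rho> and K = K])
        show "gain n \<omega> = gain n \<omega>'" if "\<And>u. u \<in> {0..t} \<Longrightarrow> \<phi> u \<omega> 0 = \<phi> u \<omega>' 0" for \<omega> \<omega>'
          using gain_depends[OF that t(1)] .
      qed (use t \<delta> m_pos R_pos K \<rho> gain_measurable in auto)
      also have "\<dots> \<le> E * ?w u"
        using True by (subst mult.commute) (intro mult_left_mono, auto)
      finally show ?thesis .
    qed
  qed
  have "(\<integral>\<^sup>+\<omega>. gain n \<omega> * occupation_time n \<omega> \<partial>P) = (\<integral>\<^sup>+\<omega>. (\<integral>\<^sup>+u. H \<omega> u \<partial>lborel) \<partial>P)"
  proof (rule nn_integral_cong)
    fix \<omega> assume "\<omega> \<in> space P"
    hence "(\<lambda>u. ?f \<omega> u) \<in> borel_measurable lborel"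
      using measurable_compose[OF measurable_Pair1' bump_flow_measurable[of "real n" "real n + 1"], of \<omega>] by simp
    thus "gain n \<omega> * occupation_time n \<omega> = (\<integral>\<^sup>+u. H \<omega> u \<partial>lborel)"
      unfolding H_def occupation_time_def by (rule nn_integral_cmult[symmetric])
  qed
  also have "\<dots> = (\<integral>\<^sup>+u. (\<integral>\<^sup>+\<omega>. H \<omega> u \<partial>P) \<partial>lborel)" by (rule Fubini'[OF Hm, symmetric])
  also have "\<dots> \<le> (\<integral>\<^sup>+u. E * ?w u \<partial>lborel)"
    by (intro nn_integral_mono slice)
  also have "\<dots> = E * (ennreal \<delta> + ennreal \<eta>)"
    using \<delta> by (subst nn_integral_cmult, simp, subst nn_integral_add, simp, simp, subst nn_integral_cmult) auto
  finally have occE: "(\<integral>\<^sup>+\<omega>. gain n \<omega> * occupation_time n \<omega> \<partial>P) \<le> E * ennreal (\<delta> + \<eta>)" using \<delta> \<eta> by simp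
  have "(\<integral>\<^sup>+\<omega>. gain (Suc n) \<omega> \<partial>P) = (\<integral>\<^sup>+\<omega>. ennreal (exp (- l)) * (gain n \<omega> + ennreal \<kappa> * (gain n \<omega> * occupation_time n \<omega>)) \<partial>P)"
    by (intro nn_integral_cong) (simp add: gain_def algebra_simps)
  also have "\<dots> = ennreal (exp (- l)) * (E + ennreal \<kappa> * (\<integral>\<^sup>+\<omega>. gain n \<omega> * occupation_time n \<omega> \<partial>P))"
    unfolding E_def using gm om
    by (subst nn_integral_cmult, simp, subst nn_integral_add, simp, simp, subst nn_integral_cmult) auto
  also have "\<dots> \<le> ennreal (exp (- l)) * (E + ennreal \<kappa> * (E * ennreal (\<delta> + \<eta>)))"
    by (intro mult_left_mono add_left_mono occE) auto
  also have "\<dots> = E * ennreal (exp (- l) * (1 + \<kappa> * (\<delta> + \<eta>)))"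
  proof -
    have "ennreal (exp (- l) * (1 + \<kappa> * (\<delta> + \<eta>))) = ennreal (exp (- l)) * (1 + ennreal \<kappa> * ennreal (\<delta> + \<eta>))"
      using \<kappa>_nonneg \<delta> \<eta> by (simp add: ennreal_mult del: ennreal_plus) (simp add: ennreal_mult)
    thus ?thesis by (simp add: algebra_simps del: ennreal_plus)
  qed
  also have "\<dots> \<le> ennreal (exp (- l / 2) ^ n) * ennreal (exp (- l / 2))"
    using Suc rate unfolding E_def \<kappa>_def \<eta>_def by (intro mult_mono ennreal_leI) auto
  also have "\<dots> = ennreal (exp (- l / 2) ^ Suc n)" by (simp add: ennreal_mult mult.commute)
  finally show ?case .
qed

lemma AE_flow_contraction:
  "AE \<omega> in P. \<forall>n y. ennreal (norm (\<phi> (real n) \<omega> y - \<phi> (real n) \<omega> 0)) \<le> ennreal (norm y) * gain n \<omega>"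
proof -
  have "continuous_on UNIV rate_at" unfolding rate_at_def by (intro continuous_intros cont_bump)
  from AE_flow_distance[OF this rate_at_bound] AE_solution[of 0]
  show ?thesis
  proof eventually_elim
    case (elim \<omega>)
    define X where "X = (\<lambda>s. \<phi> s \<omega> 0)"
    let ?J = "\<lambda>n. integral {0..real n} (\<lambda>s. rate_at (X s))"
    have cX: "continuous_on {0..T} X" if "0 \<le> T" for T
      using elim(2) that by (simp add: solution_def solves_on_def X_def)
    have cb: "continuous_on {u..v} (\<lambda>s. bump (X s))" if "0 \<le> u" "0 \<le> v" for u v
      using that by (intro continuous_on_compose2[OF cont_bump[of UNIV] continuous_on_subset[OF cX[of v]]]) auto
    have bound: "ennreal (exp (?J n)) \<le> gain n \<omega>" for n
    proof (induction n)
      case 0 show ?case by (simp add: gain_def)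
    next
      case (Suc n)
      define \<tau> where "\<tau> = integral {real n..real n + 1} (\<lambda>s. bump (X s))"
      have int: "(\<lambda>s. bump (X s)) integrable_on {real n..real n + 1}"
        by (intro integrable_continuous_real cb) auto
      have \<tau>0: "0 \<le> \<tau>" unfolding \<tau>_def by (intro integral_nonneg int bump_range)
      have \<tau>1: "\<tau> \<le> 1"
      proof -
        have "\<tau> \<le> integral {real n..real n + 1} (\<lambda>s. 1)" unfolding \<tau>_def
          by (intro integral_le int bump_range) auto
        thus ?thesis by simp
      qed
      have occupation_time\<tau>: "occupation_time n \<omega> = ennreal \<tau>"
      proof -
        have "occupation_time n \<omega> = (\<integral>\<^sup>+u. ennreal (bump (X u)) * indicator {real n..real n + 1} u \<partial>lborel)"
          unfolding occupation_time_def X_def by (intro nn_integral_cong) (auto simp: indicator_def)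
        also have "\<dots> = ennreal \<tau>" unfolding \<tau>_def
          by (intro nn_integral_has_integral_lebesgue' bump_range integrable_integral int)
        finally show ?thesis .
      qed
      have intr: "(\<lambda>s. rate_at (X s)) integrable_on {0..real (Suc n)}" unfolding rate_at_def
        by (intro integrable_continuous_real continuous_intros cb) auto
      have "?J (Suc n) =
          ?J n + integral {real n..real (Suc n)} (\<lambda>s. rate_at (X s))"
        by (rule Henstock_Kurzweil_Integration.integral_combine[symmetric]) (use intr in auto)
      also have "integral {real n..real (Suc n)} (\<lambda>s. rate_at (X s)) = - l + (\<Lambda> + l) * \<tau>"
      proof -
        have "((\<lambda>s. - l + (\<Lambda> + l) * bump (X s)) has_integral (- l * 1 + (\<Lambda> + l) * \<tau>)) {real n..real n + 1}"
          unfolding \<tau>_def using has_integral_const_real[of "- l" "real n" "real n + 1"]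
          by (intro has_integral_add has_integral_mult_right integrable_integral int) simp
        thus ?thesis unfolding rate_at_def by (simp add: integral_unique add.commute)
      qed
      finally have "exp (?J (Suc n)) =
          exp (?J n) * (exp (- l) * exp ((\<Lambda> + l) * \<tau>))"
        by (simp only: exp_add)
      also have "\<dots> \<le> exp (?J n) * (exp (- l) * (1 + \<kappa> * \<tau>))"
        unfolding \<kappa>_def by (intro mult_left_mono exp_chord \<tau>0 \<tau>1) auto
      finally have "ennreal (exp (?J (Suc n)))
          \<le> ennreal (exp (?J n) * (exp (- l) * (1 + \<kappa> * \<tau>)))"
        by (rule ennreal_leI)
      also have "\<dots> = ennreal (exp (?J n)) * (ennreal (exp (- l)) * (1 + ennreal \<kappa> * ennreal \<tau>))"
        using \<kappa>_nonneg \<tau>0 by (simp add: ennreal_mult)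
      also have "\<dots> \<le> gain n \<omega> * (ennreal (exp (- l)) * (1 + ennreal \<kappa> * ennreal \<tau>))"
        by (intro mult_right_mono Suc) simp
      also have "\<dots> = gain (Suc n) \<omega>" by (simp add: gain_def occupation_time\<tau>)
      finally show ?case .
    qed
    show ?case
    proof (intro allI)
      fix n :: nat and y :: 'a
      have "norm (\<phi> (real n) \<omega> y - \<phi> (real n) \<omega> 0) \<le> norm y * exp (?J n)"
        using elim(1) by (simp add: X_def)
      hence "ennreal (norm (\<phi> (real n) \<omega> y - \<phi> (real n) \<omega> 0)) \<le> ennreal (norm y * exp (?J n))"
        by (rule ennreal_leI)
      also have "\<dots> = ennreal (norm y) * ennreal (exp (?J n))" by (simp add: ennreal_mult)
      also have "\<dots> \<le> ennreal (norm y) * gain n \<omega>" by (intro mult_left_mono bound) simp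
      finally show "ennreal (norm (\<phi> (real n) \<omega> y - \<phi> (real n) \<omega> 0)) \<le> ennreal (norm y) * gain n \<omega>" .
    qed
  qed
qed

end

section \<open>Convergence of the pullback points\<close>

lemma convergent_if_increments_geometric:
  fixes x :: "nat \<Rightarrow> 'a::banach"
  assumes "\<forall>\<^sub>F n in sequentially. norm (x (Suc n) - x n) \<le> C * \<theta> ^ n" "0 \<le> \<theta>" "\<theta> < 1"
  shows "convergent x"
proof -
  obtain N where N: "\<And>n. n \<ge> N \<Longrightarrow> norm (x (Suc n) - x n) \<le> C * \<theta> ^ n"
    using assms(1) by (auto simp: eventually_sequentially)
  have "summable (\<lambda>n. C * \<theta> ^ n)" using assms by (intro summable_mult summable_geometric) auto
  hence "summable (\<lambda>n. x (Suc n) - x n)" using N by (rule summable_comparison_test')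
  hence "convergent (\<lambda>n. \<Sum>i<n. x (Suc i) - x i)" by (simp add: summable_iff_convergent)
  hence "convergent (\<lambda>n. (x n - x 0) + x 0)" unfolding sum_lessThan_telescope
    by (intro convergent_add convergent_const)
  thus ?thesis by simp
qed

context prob_space
begin

lemma measure_le_AE:
  assumes "AE x in M. x \<in> S \<longrightarrow> x \<in> T" "T \<in> events"
  shows "prob S \<le> prob T"
proof -
  have "emeasure M S \<le> emeasure M T" by (rule emeasure_mono_AE[OF assms])
  thus ?thesis unfolding measure_def by (rule enn2real_mono) (simp add: emeasure_eq_measure)
qed

lemma AE_tendsto_imp_in_prob:
  fixes X :: "nat \<Rightarrow> 'a \<Rightarrow> 'b::{metric_space, second_countable_topology}"
  assumes X: "\<And>n. X n \<in> borel_measurable M" and Y: "Y \<in> borel_measurable M"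
    and lim: "AE x in M. (\<lambda>n. X n x) \<longlonglongrightarrow> Y x" and e: "0 < e"
  shows "(\<lambda>n. prob {x \<in> space M. e < dist (X n x) (Y x)}) \<longlonglongrightarrow> 0"
proof -
  define E where "E n = {x \<in> space M. e < dist (X n x) (Y x)}" for n
  have E: "E n \<in> events" for n unfolding E_def using X Y by measurable
  have "(\<lambda>n. integral\<^sup>L M (indicator (E n) :: 'a \<Rightarrow> real)) \<longlonglongrightarrow> integral\<^sup>L M (\<lambda>_. 0 :: real)"
  proof (rule integral_dominated_convergence[where w = "\<lambda>_. 1"])
    show "AE x in M. (\<lambda>n. indicator (E n) x :: real) \<longlonglongrightarrow> 0"
      using lim
    proof eventually_elim
      case (elim x)
      have "(\<lambda>n. dist (X n x) (Y x)) \<longlonglongrightarrow> 0"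
        using tendsto_dist[OF elim tendsto_const[of "Y x"]] by simp
      hence "\<forall>\<^sub>F n in sequentially. dist (X n x) (Y x) < e" using e by (rule order_tendstoD)
      hence "\<forall>\<^sub>F n in sequentially. indicator (E n) x = (0 :: real)"
        by eventually_elim (auto simp: E_def)
      thus ?case by (rule tendsto_eventually)
    qed
  qed (use E in \<open>auto simp: indicator_def\<close>)
  thus ?thesis using E by (simp add: E_def)
qed

lemma limit_in_prob_unique:
  fixes X :: "nat \<Rightarrow> 'a \<Rightarrow> 'b::{metric_space, second_countable_topology}"
  assumes X: "\<And>n. X n \<in> borel_measurable M" and Y: "Y \<in> borel_measurable M" and Z: "Z \<in> borel_measurable M"
    and XY: "\<And>e. 0 < e \<Longrightarrow> (\<lambda>n. prob {x \<in> space M. e < dist (X n x) (Y x)}) \<longlonglongrightarrow> 0"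
    and XZ: "\<And>e. 0 < e \<Longrightarrow> (\<lambda>n. prob {x \<in> space M. e < dist (X n x) (Z x)}) \<longlonglongrightarrow> 0"
  shows "AE x in M. Y x = Z x"
proof -
  have "AE x in M. dist (Y x) (Z x) \<le> 2 * (1 / Suc k)" for k
  proof -
    define e where "e = 1 / real (Suc k)"
    have e: "0 < e" by (simp add: e_def)
    define E where "E U V = {x \<in> space M. e < dist (U x) (V x)}" for U V :: "'a \<Rightarrow> 'b"
    have Em: "E U V \<in> events" if "U \<in> borel_measurable M" "V \<in> borel_measurable M" for U V
      unfolding E_def using that by measurable
    define S where "S = {x \<in> space M. 2 * e < dist (Y x) (Z x)}"
    have S: "S \<in> events" unfolding S_def using Y Z by measurable
    have "prob S \<le> prob (E (X n) Y) + prob (E (X n) Z)" for n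
    proof -
      have "S \<subseteq> E (X n) Y \<union> E (X n) Z"
      proof
        fix x assume x: "x \<in> S"
        have "dist (Y x) (Z x) \<le> dist (X n x) (Y x) + dist (X n x) (Z x)"
          by (rule dist_triangle3)
        thus "x \<in> E (X n) Y \<union> E (X n) Z" using x by (auto simp: S_def E_def)
      qed
      hence "prob S \<le> prob (E (X n) Y \<union> E (X n) Z)" using Em X Y Z by (intro finite_measure_mono) auto
      also have "\<dots> \<le> prob (E (X n) Y) + prob (E (X n) Z)" using Em X Y Z by (intro measure_Un_le) auto
      finally show ?thesis .
    qed
    moreover have "(\<lambda>n. prob (E (X n) Y) + prob (E (X n) Z)) \<longlonglongrightarrow> 0 + 0"
      unfolding E_def by (intro tendsto_add XY XZ e)
    ultimately have "prob S \<le> 0 + 0" by (intro LIMSEQ_le_const) auto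
    hence "S \<in> null_sets M" using S by (simp add: null_sets_def emeasure_eq_measure measure_le_0_iff)
    hence "AE x in M. x \<notin> S" by (rule AE_not_in)
    with AE_space show ?thesis by eventually_elim (auto simp: S_def e_def)
  qed
  hence "AE x in M. \<forall>k. dist (Y x) (Z x) \<le> 2 * (1 / Suc k)" by (simp add: AE_all_countable)
  thus ?thesis
  proof eventually_elim
    case (elim x)
    have "(\<lambda>k. 2 * (1 / real (Suc k))) \<longlonglongrightarrow> 2 * 0"
      using LIMSEQ_inverse_real_of_nat by (intro tendsto_mult tendsto_const) (simp add: inverse_eq_divide)
    hence "dist (Y x) (Z x) \<le> 2 * 0" by (rule LIMSEQ_le_const) (use elim in auto)
    thus ?case by simp
  qed
qed

end

context contracting_flow
begin

definition pullback :: "nat \<Rightarrow> (real \<Rightarrow> 'a) \<Rightarrow> 'a" where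
  "pullback n \<omega> = \<phi> (real n) (shift (- real n) \<omega>) 0"

lemma flow_shift_measurable: "0 \<le> t \<Longrightarrow> (\<lambda>\<omega>. \<phi> t (shift s \<omega>) x) \<in> borel_measurable P"
proof (rule flow_measurable)
  show "shift s \<in> P \<rightarrow>\<^sub>M path_borel" by (simp add: measurable_cong_sets[OF sets_P refl])
qed simp_all

lemma pullback_measurable: "pullback n \<in> borel_measurable P"
  unfolding pullback_def by (rule flow_shift_measurable) simp

lemma gain_tail:
  assumes "0 < c"
  shows "prob {\<omega> \<in> paths. ennreal c < gain n \<omega>} \<le> exp (- l / 2) ^ n / c"
    and "{\<omega> \<in> paths. ennreal c < gain n \<omega>} \<in> sets path_borel"
proof -
  let ?S = "{\<omega> \<in> paths. ennreal c < gain n \<omega>}"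
  have "{\<omega> \<in> space path_borel. ennreal c < gain n \<omega>} \<in> sets path_borel"
    using gain_measurable[of n] by measurable
  thus S: "?S \<in> sets path_borel" by simp
  have "ennreal (prob ?S) = (\<integral>\<^sup>+\<omega>. indicator ?S \<omega> \<partial>P)" using S by (simp add: emeasure_eq_measure)
  also have "\<dots> \<le> (\<integral>\<^sup>+\<omega>. ennreal (1 / c) * gain n \<omega> \<partial>P)"
  proof (rule nn_integral_mono)
    fix \<omega>
    have "1 \<le> ennreal (1 / c) * gain n \<omega>" if "ennreal c < gain n \<omega>"
    proof -
      have "1 = ennreal (1 / c) * ennreal c" using assms by (simp flip: ennreal_mult)
      also have "\<dots> \<le> ennreal (1 / c) * gain n \<omega>" using that by (intro mult_left_mono) auto
      finally show ?thesis .
    qed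
    thus "indicator ?S \<omega> \<le> ennreal (1 / c) * gain n \<omega>" by (auto simp: indicator_def)
  qed
  also have "\<dots> = ennreal (1 / c) * (\<integral>\<^sup>+\<omega>. gain n \<omega> \<partial>P)"
    using gain_measurable by (intro nn_integral_cmult) (simp cong: measurable_cong_sets)
  also have "\<dots> \<le> ennreal (1 / c) * ennreal (exp (- l / 2) ^ n)" by (intro mult_left_mono expected_gain) simp
  also have "\<dots> = ennreal (exp (- l / 2) ^ n / c)" using assms by (simp flip: ennreal_mult)
  finally show "prob ?S \<le> exp (- l / 2) ^ n / c" using assms by (subst (asm) ennreal_le_iff) auto
qed

text \<open>
  The initial values \<open>x\<close> may grow exponentially with \<open>n\<close>, so that every bounded set of them is covered from some \<open>n\<close> on.
\<close>

definition close_to_pullback :: "real \<Rightarrow> real \<Rightarrow> nat \<Rightarrow> real \<Rightarrow> (real \<Rightarrow> 'a) set \<Rightarrow> bool" where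
  "close_to_pullback C \<theta> n r Bad \<longleftrightarrow> prob Bad \<le> C * \<theta> ^ n \<and>
    (AE \<omega> in P. \<omega> \<notin> Bad \<longrightarrow> (\<forall>x. norm x \<le> (1 / \<theta>) ^ n \<longrightarrow>
       norm (\<phi> (real n + r) (shift (- (real n + r)) \<omega>) x - pullback n \<omega>) \<le> C * \<theta> ^ n))"

text \<open>
  Between the times \<open>- (n + r)\<close> and \<open>- n\<close> the flow makes a step of size at most polynomial in \<open>(1 / \<theta>) ^ n\<close>, unless
  the noise oscillates exceptionally; afterwards it contracts, unless the gain is far above its
  expectation. For \<open>r = 1\<close> and \<open>x = 0\<close> this compares consecutive pullback points; the other cases give
  attraction.
\<close>

lemma pullback_rate:
  assumes growth: "\<And>x. norm (b x) \<le> C0 * (1 + norm x) ^ r0" and C0: "0 \<le> C0"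
  shows "\<exists>C \<theta>. 0 \<le> C \<and> 0 < \<theta> \<and> \<theta> < 1 \<and> (\<forall>n. \<forall>r\<in>{0..1}. \<exists>Bad\<in>sets P. close_to_pullback C \<theta> n r Bad)"
proof -
  define p where "p = r0 + 1"
  obtain C' where C': "0 \<le> C'" "AE \<omega> in P. \<forall>L y t. 1 \<le> L \<longrightarrow> norm y \<le> L \<longrightarrow> \<omega> \<notin> oscillates 0 1 L \<longrightarrow> t \<in> {0..1} \<longrightarrow>
      norm (\<phi> t \<omega> y) \<le> C' * L ^ p"
    using AE_flow_bound[OF growth C0] unfolding p_def by blast
  \<comment> \<open>Of the \<open>p + 2\<close> factors \<open>\<theta> ^ n\<close> in the bound of the expected gain, one becomes the probability in
    Markov's inequality, \<open>p\<close> compensate the unit step, and one remains as the rate.\<close>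
  define \<theta> where "\<theta> = exp (- l / (2 * (p + 2)))"
  have \<theta>: "0 < \<theta>" "\<theta> < 1" using l_pos by (auto simp: \<theta>_def)
  have q: "exp (- l / 2) = \<theta> ^ (p + 2)"
  proof -
    have "\<theta> ^ (p + 2) = exp (real (p + 2) * (- l / (2 * (p + 2))))" unfolding \<theta>_def by (rule exp_of_nat_mult[symmetric])
    also have "real (p + 2) * (- l / (2 * (p + 2))) = - l / 2" by (simp add: field_simps)
    finally show ?thesis by simp
  qed
  define C where "C = C' + 8 * DIM('a) + 1"
  have "\<exists>Bad\<in>sets P. close_to_pullback C \<theta> n r Bad"
    if r: "r \<in> {0..1}" for n r
  proof -
    define L where "L = (1 / \<theta>) ^ n"
    have L1: "1 \<le> L" unfolding L_def using \<theta> by (intro one_le_power) auto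
    define c where "c = \<theta> ^ (n * (p + 1))"
    have c: "0 < c" using \<theta> by (simp add: c_def)
    define t where "t = - (real n + r)"
    define B1 where "B1 = oscillates 0 1 L"
    define B2 where "B2 = {\<omega> \<in> paths. ennreal c < gain n \<omega>}"
    have B1: "B1 \<in> events" and B2: "B2 \<in> events"
      using oscillates_measurable[of 1 0 L] gain_tail(2)[OF c] by (auto simp: B1_def B2_def)
    define Bad where "Bad = (shift t -` B1 \<inter> space P) \<union> (shift (- real n) -` B2 \<inter> space P)"
    have sm: "shift s \<in> P \<rightarrow>\<^sub>M P" for s by simp
    have Bads: "shift t -` B1 \<inter> space P \<in> events" "shift (- real n) -` B2 \<inter> space P \<in> events"
      using measurable_sets[OF sm B1] measurable_sets[OF sm B2] by blast+
    have "prob Bad \<le> prob (shift t -` B1 \<inter> space P) + prob (shift (- real n) -` B2 \<inter> space P)"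
      unfolding Bad_def using Bads by (rule measure_Un_le)
    also have "\<dots> = prob B1 + prob B2" using B1 B2 by (simp only: prob_shift)
    also have "\<dots> \<le> 8 * DIM('a) * \<theta> ^ n + \<theta> ^ n"
    proof (rule add_mono)
      have "prob B1 \<le> 8 * real DIM('a) * 1 / L\<^sup>2" unfolding B1_def using L1 oscillation_tail[of 1 L 0] by simp
      also have "\<dots> \<le> 8 * real DIM('a) * 1 / L" using L1 by (intro divide_left_mono) (auto simp: power2_eq_square)
      also have "\<dots> = 8 * DIM('a) * \<theta> ^ n" by (simp add: L_def power_divide)
      finally show "prob B1 \<le> 8 * DIM('a) * \<theta> ^ n" .
      have "prob B2 \<le> exp (- l / 2) ^ n / c" unfolding B2_def by (rule gain_tail(1)[OF c])
      also have "exp (- l / 2) ^ n = \<theta> ^ (n * (p + 1)) * \<theta> ^ n"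
        unfolding q power_mult[symmetric] power_add[symmetric] by (simp add: algebra_simps)
      also have "\<dots> / c = \<theta> ^ n" unfolding c_def[symmetric] using c by simp
      finally show "prob B2 \<le> \<theta> ^ n" .
    qed
    also have "\<dots> \<le> C * \<theta> ^ n"
    proof -
      have "C * \<theta> ^ n = C' * \<theta> ^ n + 8 * DIM('a) * \<theta> ^ n + \<theta> ^ n" by (simp add: C_def distrib_right)
      moreover have "0 \<le> C' * \<theta> ^ n" using C'(1) \<theta> by simp
      ultimately show ?thesis by linarith
    qed
    finally have pB: "prob Bad \<le> C * \<theta> ^ n" .
    have "AE \<omega> in P. \<omega> \<notin> Bad \<longrightarrow> (\<forall>x. norm x \<le> (1 / \<theta>) ^ n \<longrightarrow>
       norm (\<phi> (real n + r) (shift (- (real n + r)) \<omega>) x - pullback n \<omega>) \<le> C * \<theta> ^ n)"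
      using AE_shift[OF C'(2), of t] AE_shift[OF AE_flow_contraction, of "- real n"] AE_space
    proof eventually_elim
      case (elim \<omega>)
      hence w: "\<omega> \<in> paths" by simp
      show ?case
      proof (intro impI allI)
        fix x :: 'a assume nb: "\<omega> \<notin> Bad" and x: "norm x \<le> (1 / \<theta>) ^ n"
        have nB: "shift t \<omega> \<notin> B1" "shift (- real n) \<omega> \<notin> B2" using nb w by (auto simp: Bad_def)
        define y where "y = \<phi> r (shift t \<omega>) x"
        have y: "norm y \<le> C' * L ^ p" unfolding y_def
          using elim(1) L1 x nB(1) r by (simp add: L_def B1_def)
        have "shift r (shift t \<omega>) = shift (- real n) \<omega>" by (simp add: shift_shift t_def)
        hence eq: "\<phi> (real n + r) (shift t \<omega>) x = \<phi> (real n) (shift (- real n) \<omega>) y"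
          using cocycle[of r "real n" "shift t \<omega>" x] r w by (simp add: y_def)
        have gn: "gain n (shift (- real n) \<omega>) \<le> ennreal c" using nB(2) w by (simp add: B2_def not_less)
        have "ennreal (norm (\<phi> (real n + r) (shift t \<omega>) x - pullback n \<omega>)) \<le> ennreal (norm y) * gain n (shift (- real n) \<omega>)"
          unfolding eq pullback_def using elim(2) by simp
        also have "\<dots> \<le> ennreal (C' * L ^ p) * ennreal c" using y gn by (intro mult_mono ennreal_leI) auto
        also have "\<dots> = ennreal (C' * L ^ p * c)" using C'(1) L1 c by (simp flip: ennreal_mult)
        also have "C' * L ^ p * c = C' * \<theta> ^ n"
        proof -
          have "L ^ p * c = (1 / \<theta>) ^ (n * p) * (\<theta> ^ (n * p) * \<theta> ^ n)"
          proof -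
            have "c = \<theta> ^ (n * p) * \<theta> ^ n" unfolding c_def power_add[symmetric] by (simp add: algebra_simps)
            moreover have "L ^ p = (1 / \<theta>) ^ (n * p)" unfolding L_def by (rule power_mult[symmetric])
            ultimately show ?thesis by (simp only:)
          qed
          also have "\<dots> = ((1 / \<theta>) * \<theta>) ^ (n * p) * \<theta> ^ n" by (simp only: power_mult_distrib mult.assoc)
          finally show ?thesis using \<theta> by simp
        qed
        also have "ennreal (C' * \<theta> ^ n) \<le> ennreal (C * \<theta> ^ n)"
          using \<theta> by (intro ennreal_leI mult_right_mono) (auto simp: C_def)
        finally show "norm (\<phi> (real n + r) (shift (- (real n + r)) \<omega>) x - pullback n \<omega>) \<le> C * \<theta> ^ n"
          using C'(1) \<theta> by (subst (asm) ennreal_le_iff) (auto simp: C_def t_def)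
      qed
    qed
    moreover have "Bad \<in> sets P" unfolding Bad_def using Bads by (rule sets.Un)
    ultimately show ?thesis using pB unfolding close_to_pullback_def by blast
  qed
  moreover have "0 \<le> C" using C'(1) by (simp add: C_def)
  ultimately show ?thesis using \<theta> by blast
qed

definition attractor_point :: "(real \<Rightarrow> 'a) \<Rightarrow> 'a" where
  "attractor_point \<omega> = lim (\<lambda>n. pullback n \<omega>)"

lemma attractor_point_measurable: "attractor_point \<in> borel_measurable P"
  unfolding attractor_point_def by (rule borel_measurable_lim_metric) (rule pullback_measurable)

text \<open>
  The exceptional events for consecutive pullback points have summable probabilities, so by the
  Borel-Cantelli lemma the increments eventually decay geometrically.
\<close>

lemma AE_pullback_tendsto:
  assumes rate: "\<And>n r. r \<in> {0..1} \<Longrightarrow> \<exists>Bad\<in>sets P. close_to_pullback C \<theta> n r Bad"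
    and \<theta>: "0 < \<theta>" "\<theta> < 1"
  shows "AE \<omega> in P. (\<lambda>n. pullback n \<omega>) \<longlonglongrightarrow> attractor_point \<omega>"
proof -
  have "\<forall>n. \<exists>Bad. Bad \<in> sets P \<and> prob Bad \<le> C * \<theta> ^ n \<and>
    (AE \<omega> in P. \<omega> \<notin> Bad \<longrightarrow> norm (pullback (Suc n) \<omega> - pullback n \<omega>) \<le> C * \<theta> ^ n)"
    (is "\<forall>n. \<exists>Bad. ?good n Bad")
  proof
    fix n
    obtain Bad where Bad: "Bad \<in> sets P" "prob Bad \<le> C * \<theta> ^ n"
      "AE \<omega> in P. \<omega> \<notin> Bad \<longrightarrow> (\<forall>x. norm x \<le> (1 / \<theta>) ^ n \<longrightarrow>
       norm (\<phi> (real n + 1) (shift (- (real n + 1)) \<omega>) x - pullback n \<omega>) \<le> C * \<theta> ^ n)"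
      using rate[of 1 n] unfolding close_to_pullback_def by auto
    have "AE \<omega> in P. \<omega> \<notin> Bad \<longrightarrow> norm (pullback (Suc n) \<omega> - pullback n \<omega>) \<le> C * \<theta> ^ n"
      using Bad(3)
    proof eventually_elim
      case (elim \<omega>)
      have "pullback (Suc n) \<omega> = \<phi> (real n + 1) (shift (- (real n + 1)) \<omega>) 0"
        by (simp add: pullback_def add.commute)
      moreover have "norm (0 :: 'a) \<le> (1 / \<theta>) ^ n" using \<theta> by simp
      ultimately show ?case using elim by metis
    qed
    thus "\<exists>Bad. ?good n Bad"
      using Bad by blast
  qed
  from choice[OF this] obtain Bad where Bad: "\<And>n. Bad n \<in> sets P" "\<And>n. prob (Bad n) \<le> C * \<theta> ^ n"
      "\<And>n. AE \<omega> in P. \<omega> \<notin> Bad n \<longrightarrow> norm (pullback (Suc n) \<omega> - pullback n \<omega>) \<le> C * \<theta> ^ n"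
    by blast
  have "summable (\<lambda>n. C * \<theta> ^ n)" using \<theta> by (intro summable_mult summable_geometric) auto
  hence "summable (\<lambda>n. prob (Bad n))"
    by (rule summable_comparison_test'[where N = 0]) (use Bad(2) in simp)
  hence "AE \<omega> in P. \<forall>\<^sub>F n in sequentially. \<omega> \<in> space P - Bad n"
    using Bad(1) by (intro borel_cantelli_AE1) (auto simp: emeasure_eq_measure)
  moreover have "AE \<omega> in P. \<forall>n. \<omega> \<notin> Bad n \<longrightarrow> norm (pullback (Suc n) \<omega> - pullback n \<omega>) \<le> C * \<theta> ^ n"
    using Bad(3) by (simp add: AE_all_countable)
  ultimately show ?thesis
  proof eventually_elim
    case (elim \<omega>)
    have "\<forall>\<^sub>F n in sequentially. norm (pullback (Suc n) \<omega> - pullback n \<omega>) \<le> C * \<theta> ^ n"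
      using elim(1) by eventually_elim (use elim(2) in blast)
    hence "convergent (\<lambda>n. pullback n \<omega>)" using \<theta> by (intro convergent_if_increments_geometric) auto
    thus ?case by (simp add: attractor_point_def convergent_LIMSEQ_iff)
  qed
qed

text \<open>
  The time is written as \<open>t = n + r\<close> with \<open>n\<close> integer; off a small event the image of \<open>B\<close> is close to the pullback point of
  index \<open>n\<close>, which is close to its limit.
\<close>

lemma pullback_attraction:
  assumes rate: "\<And>n r. r \<in> {0..1} \<Longrightarrow> \<exists>Bad\<in>sets P. close_to_pullback C \<theta> n r Bad"
    and \<theta>: "0 < \<theta>" "\<theta> < 1"
    and lim: "AE \<omega> in P. (\<lambda>n. pullback n \<omega>) \<longlonglongrightarrow> attractor_point \<omega>"
    and B: "compact B" "B \<noteq> {}" and \<epsilon>: "0 < \<epsilon>"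
  shows "((\<lambda>t. prob {\<omega> \<in> space P. \<epsilon> <
    (SUP x\<in>B. infdist (\<phi> t (shift (- t) \<omega>) x) {attractor_point \<omega>})}) \<longlongrightarrow> 0) at_top"
proof -
  obtain M where M: "\<And>x. x \<in> B \<Longrightarrow> norm x \<le> M" using compact_imp_bounded[OF B(1)] by (auto simp: bounded_iff)
  define S where "S t = {\<omega> \<in> space P. \<epsilon> < (SUP x\<in>B. infdist (\<phi> t (shift (- t) \<omega>) x) {attractor_point \<omega>})}" for t
  define D where "D n = {\<omega> \<in> space P. \<epsilon> / 2 < dist (pullback n \<omega>) (attractor_point \<omega>)}" for n
  have D: "D n \<in> events" for n unfolding D_def
    using pullback_measurable attractor_point_measurable by measurable
  define u where "u n = C * \<theta> ^ n + prob (D n)" for n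
  have Cpow: "(\<lambda>n. C * \<theta> ^ n) \<longlonglongrightarrow> 0"
  proof -
    have "(\<lambda>n. \<theta> ^ n) \<longlonglongrightarrow> 0" using \<theta> by (intro LIMSEQ_power_zero) auto
    from tendsto_mult_left[OF this, of C] show ?thesis by simp
  qed
  have u: "u \<longlonglongrightarrow> 0"
  proof -
    have "(\<lambda>n. C * \<theta> ^ n + prob (D n)) \<longlonglongrightarrow> 0 + 0"
      unfolding D_def using \<epsilon> by (intro tendsto_add Cpow
        AE_tendsto_imp_in_prob[OF pullback_measurable attractor_point_measurable lim]) simp
    thus ?thesis by (simp add: u_def[abs_def])
  qed
  have floor: "filterlim (\<lambda>t::real. nat \<lfloor>t\<rfloor>) sequentially at_top"
    unfolding filterlim_at_top
  proof
    fix N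
    show "\<forall>\<^sub>F t::real in at_top. N \<le> nat \<lfloor>t\<rfloor>"
      using eventually_ge_at_top[of "real N"] by eventually_elim linarith
  qed
  have "\<forall>\<^sub>F n in sequentially. C * \<theta> ^ n < \<epsilon> / 2" using Cpow by (rule order_tendstoD) (use \<epsilon> in simp)
  moreover have "\<forall>\<^sub>F n in sequentially. M \<le> (1 / \<theta>) ^ n"
  proof -
    have gt1: "1 < 1 / \<theta>" using \<theta> by simp
    obtain N where N: "M < (1 / \<theta>) ^ N" using real_arch_pow[OF gt1] by blast
    show ?thesis using eventually_ge_at_top[of N]
    proof eventually_elim
      case (elim n)
      have "(1 / \<theta>) ^ N \<le> (1 / \<theta>) ^ n" using gt1 elim by (intro power_increasing) auto
      thus ?case using N by linarith
    qed
  qed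
  ultimately have good: "\<forall>\<^sub>F n in sequentially. C * \<theta> ^ n < \<epsilon> / 2 \<and> M \<le> (1 / \<theta>) ^ n"
    by (rule eventually_conj)
  have "\<forall>\<^sub>F t::real in at_top. C * \<theta> ^ nat \<lfloor>t\<rfloor> < \<epsilon> / 2 \<and> M \<le> (1 / \<theta>) ^ nat \<lfloor>t\<rfloor>"
    using eventually_compose_filterlim[OF good floor] .
  hence bound: "\<forall>\<^sub>F t in at_top. prob (S t) \<le> u (nat \<lfloor>t\<rfloor>)"
    using eventually_ge_at_top[of 0]
  proof eventually_elim
    case (elim t)
    define n where "n = nat \<lfloor>t\<rfloor>"
    define r where "r = t - real n"
    have r: "r \<in> {0..1}" "t = real n + r" using elim(2) by (auto simp: r_def n_def) linarith
    obtain Bad where Bad: "Bad \<in> sets P" "prob Bad \<le> C * \<theta> ^ n"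
      "AE \<omega> in P. \<omega> \<notin> Bad \<longrightarrow> (\<forall>x. norm x \<le> (1 / \<theta>) ^ n \<longrightarrow>
       norm (\<phi> t (shift (- t) \<omega>) x - pullback n \<omega>) \<le> C * \<theta> ^ n)"
      using rate[OF r(1), of n] unfolding close_to_pullback_def r(2)[symmetric] by blast
    have "prob (S t) \<le> prob (Bad \<union> D n)"
    proof (rule measure_le_AE)
      show "AE \<omega> in P. \<omega> \<in> S t \<longrightarrow> \<omega> \<in> Bad \<union> D n"
        using Bad(3) AE_space
      proof eventually_elim
        case (elim \<omega>)
        show ?case
        proof (rule impI, rule ccontr)
          assume wS: "\<omega> \<in> S t" and "\<omega> \<notin> Bad \<union> D n"
          hence nb: "\<omega> \<notin> Bad" and nd: "dist (pullback n \<omega>) (attractor_point \<omega>) \<le> \<epsilon> / 2"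
            using elim(2) by (auto simp: D_def not_less)
          have "(SUP x\<in>B. infdist (\<phi> t (shift (- t) \<omega>) x) {attractor_point \<omega>}) \<le> \<epsilon>"
          proof (rule cSUP_least[OF B(2)])
            fix x assume "x \<in> B"
            hence "norm x \<le> (1 / \<theta>) ^ n" using M \<open>C * \<theta> ^ nat \<lfloor>t\<rfloor> < \<epsilon> / 2 \<and> M \<le> (1 / \<theta>) ^ nat \<lfloor>t\<rfloor>\<close>
              unfolding n_def[symmetric] by (meson order_trans)
            hence "dist (\<phi> t (shift (- t) \<omega>) x) (pullback n \<omega>) \<le> C * \<theta> ^ n"
              using elim(1) nb by (simp add: dist_norm)
            moreover have "C * \<theta> ^ n < \<epsilon> / 2"
              using \<open>C * \<theta> ^ nat \<lfloor>t\<rfloor> < \<epsilon> / 2 \<and> M \<le> (1 / \<theta>) ^ nat \<lfloor>t\<rfloor>\<close> by (simp add: n_def)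
            moreover have "dist (\<phi> t (shift (- t) \<omega>) x) (attractor_point \<omega>) \<le>
                dist (\<phi> t (shift (- t) \<omega>) x) (pullback n \<omega>) + dist (pullback n \<omega>) (attractor_point \<omega>)"
              by (rule dist_triangle)
            ultimately show "infdist (\<phi> t (shift (- t) \<omega>) x) {attractor_point \<omega>} \<le> \<epsilon>" using nd by simp
          qed
          thus False using wS by (simp add: S_def)
        qed
      qed
      show "Bad \<union> D n \<in> events" using Bad(1) D by blast
    qed
    also have "\<dots> \<le> prob Bad + prob (D n)" using Bad(1) D by (intro measure_Un_le) auto
    also have "\<dots> \<le> u n" using Bad(2) by (simp add: u_def)
    finally show ?case by (simp add: n_def)
  qed
  have "((\<lambda>t::real. u (nat \<lfloor>t\<rfloor>)) \<longlongrightarrow> 0) at_top" by (rule filterlim_compose[OF u floor])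
  from tendsto_sandwich[OF _ bound tendsto_const this]
  show ?thesis unfolding S_def by simp
qed

text \<open>
  The image \<open>\<phi> t \<omega> (pullback n \<omega>)\<close> is, for the shifted noise, the pullback from time \<open>- (t + n)\<close>. It
  converges to \<open>\<phi> t \<omega> (attractor_point \<omega>)\<close> by continuity and to \<open>attractor_point (shift t \<omega>)\<close> by
  attraction.
\<close>

lemma attractor_point_invariant:
  assumes lim: "AE \<omega> in P. (\<lambda>n. pullback n \<omega>) \<longlonglongrightarrow> attractor_point \<omega>"
    and attr: "\<And>e. 0 < e \<Longrightarrow>
      ((\<lambda>t. prob {\<omega> \<in> space P. e < dist (\<phi> t (shift (- t) \<omega>) 0) (attractor_point \<omega>)}) \<longlongrightarrow> 0) at_top"
    and t: "0 \<le> t"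
  shows "AE \<omega> in P. \<phi> t \<omega> (attractor_point \<omega>) = attractor_point (shift t \<omega>)"
proof -
  define Z where "Z n \<omega> = \<phi> (t + real n) (shift (- real n) \<omega>) 0" for n \<omega>
  have Zm: "Z n \<in> borel_measurable P" for n unfolding Z_def using t by (intro flow_shift_measurable) simp
  have Ym: "(\<lambda>\<omega>. \<phi> t \<omega> (attractor_point \<omega>)) \<in> borel_measurable P"
  proof (rule flow_measurable[where T = "\<lambda>_. t" and w = "\<lambda>\<omega>. \<omega>"])
    show "(\<lambda>\<omega>. \<omega>) \<in> P \<rightarrow>\<^sub>M path_borel" by (rule measurable_ident_sets) simp
  qed (use t attractor_point_measurable in simp_all)
  have am: "(\<lambda>\<omega>. attractor_point (shift t \<omega>)) \<in> borel_measurable P"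
    by (rule measurable_compose[OF _ attractor_point_measurable]) simp
  have Zlim: "AE \<omega> in P. (\<lambda>n. Z n \<omega>) \<longlonglongrightarrow> \<phi> t \<omega> (attractor_point \<omega>)"
    using lim AE_zero AE_space
  proof eventually_elim
    case (elim \<omega>)
    hence w: "\<omega> \<in> paths" by simp
    have "shift (real n) (shift (- real n) \<omega>) = \<omega>" for n
      unfolding shift_shift using elim(2) by (simp add: shift_def)
    hence Z: "Z n \<omega> = \<phi> t \<omega> (pullback n \<omega>)" for n
      using cocycle[of "real n" t "shift (- real n) \<omega>" 0] t w by (simp add: Z_def pullback_def)
    have "isCont (\<phi> t \<omega>) (attractor_point \<omega>)" using cont_flow[OF t w] by (simp add: continuous_on_eq_continuous_at)
    thus ?case unfolding Z using elim(1) by (rule isCont_tendsto_compose)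
  qed
  have Zprob: "(\<lambda>n. prob {\<omega> \<in> space P. e < dist (Z n \<omega>) (attractor_point (shift t \<omega>))}) \<longlonglongrightarrow> 0" if e: "0 < e" for e
  proof -
    define T where "T s = {\<omega> \<in> space P. e < dist (\<phi> s (shift (- s) \<omega>) 0) (attractor_point \<omega>)}" for s
    have "((\<lambda>s. prob (T s)) \<longlongrightarrow> 0) at_top" unfolding T_def by (rule attr[OF e])
    moreover have "filterlim (\<lambda>n. t + real n) at_top sequentially"
      by (intro filterlim_tendsto_add_at_top[OF tendsto_const] filterlim_real_sequentially)
    ultimately have "(\<lambda>n. prob (T (t + real n))) \<longlonglongrightarrow> 0" by (rule filterlim_compose)
    moreover have "prob {\<omega> \<in> space P. e < dist (Z n \<omega>) (attractor_point (shift t \<omega>))} = prob (T (t + real n))" for n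
    proof -
      note attractor_point_measurable [measurable]
      have [measurable]: "(\<lambda>\<omega>. \<phi> (t + real n) (shift (- (t + real n)) \<omega>) 0) \<in> borel_measurable P"
        by (rule flow_shift_measurable) (use t in simp)
      have Tm: "T (t + real n) \<in> events" unfolding T_def by measurable
      have "{\<omega> \<in> space P. e < dist (Z n \<omega>) (attractor_point (shift t \<omega>))} = shift t -` T (t + real n) \<inter> space P"
        by (auto simp: T_def Z_def shift_shift)
      thus ?thesis using prob_shift[OF Tm, of t] by simp
    qed
    ultimately show ?thesis by simp
  qed
  show ?thesis
    by (rule limit_in_prob_unique[OF Zm Ym am _ Zprob])
      (rule AE_tendsto_imp_in_prob[OF Zm Ym Zlim])
qed

lemma synchronization_if_growth:
  assumes growth: "\<And>x. norm (b x) \<le> C0 * (1 + norm x) ^ r0" and C0: "0 \<le> C0"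
  shows "synchronization P \<phi>"
proof -
  obtain C \<theta> where \<theta>: "0 < \<theta>" "\<theta> < 1"
    and rate: "\<And>n r. r \<in> {0..1} \<Longrightarrow> \<exists>Bad\<in>sets P. close_to_pullback C \<theta> n r Bad"
    using pullback_rate[OF growth C0] by blast
  have lim: "AE \<omega> in P. (\<lambda>n. pullback n \<omega>) \<longlonglongrightarrow> attractor_point \<omega>"
    by (rule AE_pullback_tendsto[OF rate \<theta>])
  have attr: "((\<lambda>t. prob {\<omega> \<in> space P. e <
      (SUP x\<in>B. infdist (\<phi> t (shift (- t) \<omega>) x) {attractor_point \<omega>})}) \<longlongrightarrow> 0) at_top"
    if "compact B" "B \<noteq> {}" "0 < e" for B e
    using that by (intro pullback_attraction[OF rate \<theta> lim])
  have attr0: "((\<lambda>t. prob {\<omega> \<in> space P. e < dist (\<phi> t (shift (- t) \<omega>) 0) (attractor_point \<omega>)}) \<longlongrightarrow> 0) at_top"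
    if "0 < e" for e using attr[of "{0}" e] that by simp
  have inv: "AE \<omega> in P. \<phi> t \<omega> (attractor_point \<omega>) = attractor_point (shift t \<omega>)" if "0 \<le> t" for t
    using that by (intro attractor_point_invariant[OF lim attr0])
  define A where "A \<omega> = {attractor_point \<omega>}" for \<omega>
  have "random_compact_set P A"
    unfolding random_compact_set_def
  proof (intro conjI allI ballI)
    show "AE \<omega> in P. compact (A \<omega>)" by (simp add: A_def)
    fix x
    have "(\<lambda>\<omega>. dist x (attractor_point \<omega>)) \<in> borel_measurable P" using attractor_point_measurable by measurable
    thus "(\<lambda>\<omega>. infdist x (A \<omega>)) \<in> borel_measurable P" by (simp add: A_def)
  qed (simp add: A_def)
  moreover have "AE \<omega> in P. \<phi> t \<omega> ` A \<omega> = A (shift t \<omega>)" if "0 \<le> t" for t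
    using inv[OF that] by eventually_elim (simp add: A_def)
  ultimately have "weak_attractor P \<phi> A" using attr by (simp add: weak_attractor_def A_def)
  moreover have "AE \<omega> in P. is_singleton (A \<omega>)" by (simp add: A_def)
  ultimately show ?thesis unfolding synchronization_def by blast
qed

end

section \<open>Synchronization for strong noise\<close>

theorem theorem3p14:
  fixes b :: "'a::euclidean_space \<Rightarrow> 'a"
    and Db :: "'a \<Rightarrow> 'a \<Rightarrow>\<^sub>L 'a"
    and D2b :: "'a \<Rightarrow> 'a \<Rightarrow>\<^sub>L ('a \<Rightarrow>\<^sub>L 'a)"
    and P :: "(real \<Rightarrow> 'a) measure"
  assumes "C2_with_derivatives b Db D2b"
    and "\<exists>\<Lambda>>0. \<forall>x y. (b x - b y) \<bullet> (x - y) \<le> \<Lambda> * (norm (x - y))\<^sup>2"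
    and "\<exists>M::nat. \<exists>C\<ge>0. \<forall>x. norm (D2b x) \<le> C * (norm x ^ M + 1)"
    and "eventually_strictly_monotone b"
    and "two_sided_wiener_measure P"
  shows "\<exists>\<sigma>0>0. \<forall>\<sigma>\<ge>\<sigma>0. \<forall>\<phi>. sde_rds b \<sigma> P \<phi> \<longrightarrow> synchronization P \<phi>"
proof -
  obtain \<Lambda> where \<Lambda>: "0 < \<Lambda>" "\<And>x y. (b x - b y) \<bullet> (x - y) \<le> \<Lambda> * (norm (x - y))\<^sup>2"
    using assms(2) by blast
  obtain M :: nat and C where D2b: "0 \<le> C" "\<And>x. norm (D2b x) \<le> C * (norm x ^ M + 1)"
    using assms(3) by blast
  obtain R0 l0 where mono: "0 < R0" "0 < l0"
    "\<And>x y. norm x > R0 \<Longrightarrow> norm y > R0 \<Longrightarrow> (b x - b y) \<bullet> (x - y) \<le> - l0 * (norm (x - y))\<^sup>2"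
    using assms(4) unfolding eventually_strictly_monotone_def by blast
  obtain C' where growth: "0 \<le> C'" "\<And>x. norm (b x) \<le> C' * (1 + norm x) ^ (M + 2)"
    using polynomial_growth_of_C2[OF assms(1) D2b(2,1)] by blast
  have cont_b: "continuous_on UNIV b"
    using assms(1) unfolding C2_with_derivatives_def
    by (intro continuous_at_imp_continuous_on ballI) (blast intro: has_derivative_continuous)
  define l where "l = l0 / 2"
  define R where "R = R0 + 4 * R0 * (\<Lambda> + l0) / l0"
  have l: "0 < l" using mono by (simp add: l_def)
  have R: "0 < R" using mono \<Lambda>(1) by (auto simp: R_def intro!: add_pos_pos)
  have far: "(b x - b y) \<bullet> (x - y) \<le> - l * (norm (x - y))\<^sup>2" if "R < norm x" for x y
    using monotone_if_one_point_far[OF cont_b \<Lambda>(2,1) mono, of x y] that by (simp add: R_def l_def)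
  \<comment> \<open>An expected occupation time \<open>\<epsilon>\<close> is small enough for contraction. It is split equally between the
    time lag \<open>\<delta>\<close>, large oscillations (made rare by \<open>m\<close>), and the Gaussian increment hitting a small
    ball (made rare by \<open>r\<close>). The choice of \<open>\<sigma>0\<close> comes last, since \<open>K\<close> depends on \<open>m\<close>.\<close>
  define k where "k = exp (\<Lambda> + l) - 1"
  have k: "0 < k" using \<Lambda>(1) l by (simp add: k_def)
  define \<epsilon> where "\<epsilon> = (exp (l / 2) - 1) / k"
  have \<epsilon>: "0 < \<epsilon>" using l k by (simp add: \<epsilon>_def)
  define r where "r = 3 * (R + 2) / \<epsilon>"
  have r: "0 < r" using R \<epsilon> by (simp add: r_def)
  define m where "m = r * sqrt (24 * DIM('a) / \<epsilon>)"
  have m: "0 < m" using r \<epsilon> by (simp add: m_def)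
  have m2: "8 * DIM('a) * r\<^sup>2 / m\<^sup>2 = \<epsilon> / 3"
    using r \<epsilon> by (simp add: m_def power_mult_distrib)
  define \<rho> where "\<rho> = (R + 1) + 2 * m + 2"
  define K where "K = C' * (1 + \<rho>) ^ (M + 2)"
  have K0: "0 \<le> K" using growth(1) R m by (simp add: K_def \<rho>_def)
  have K: "norm (b z) \<le> K" if "norm z \<le> \<rho>" for z
  proof -
    have "C' * (1 + norm z) ^ (M + 2) \<le> K" unfolding K_def
      using that growth(1) by (intro mult_left_mono power_mono) auto
    thus ?thesis using growth(2)[of z] by linarith
  qed
  define s where "s = min (\<epsilon> / 3) (min (1 / (K + 1)) (1 / 2))"
  have s: "0 < s" "s \<le> \<epsilon> / 3" "s \<le> 1 / (K + 1)" "s < 1" using \<epsilon> K0 by (auto simp: s_def)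
  define \<sigma>0 where "\<sigma>0 = r / sqrt s"
  have \<sigma>0: "0 < \<sigma>0" using r s by (simp add: \<sigma>0_def)
  have "synchronization P \<phi>" if \<sigma>: "\<sigma>0 \<le> \<sigma>" and rds: "sde_rds b \<sigma> P \<phi>" for \<sigma> \<phi>
  proof -
    have \<sigma>_pos: "0 < \<sigma>" using \<sigma> \<sigma>0 by simp
    define \<delta> where "\<delta> = r\<^sup>2 / \<sigma>\<^sup>2"
    have \<delta>0: "0 < \<delta>" using r \<sigma>_pos by (simp add: \<delta>_def)
    have \<delta>s: "\<delta> \<le> s"
    proof -
      have "r\<^sup>2 / \<sigma>\<^sup>2 \<le> r\<^sup>2 / \<sigma>0\<^sup>2"
        using \<sigma> \<sigma>0 by (intro divide_left_mono power_mono mult_pos_pos zero_less_power) auto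
      also have "\<dots> = s" using r s by (simp add: \<sigma>0_def power_divide)
      finally show ?thesis by (simp add: \<delta>_def)
    qed
    have scale: "\<sigma> * sqrt \<delta> = r" using r \<sigma>_pos by (simp add: \<delta>_def real_sqrt_divide)
    have scale2: "8 * DIM('a) * \<delta> * \<sigma>\<^sup>2 / m\<^sup>2 = \<epsilon> / 3"
      using m2 \<sigma>_pos by (simp add: \<delta>_def)
    have "(R + 1 + 1) / r = \<epsilon> / 3" using R \<epsilon> by (simp add: r_def field_simps)
    define \<eta> where "\<eta> = 8 * DIM('a) * \<delta> * \<sigma>\<^sup>2 / m\<^sup>2 + (R + 1 + 1) / (\<sigma> * sqrt \<delta>)"
    have sum: "\<delta> + \<eta> \<le> \<epsilon>"
      unfolding \<eta>_def scale scale2 using \<open>(R + 1 + 1) / r = \<epsilon> / 3\<close> \<delta>s s(2) by linarith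
    have rate: "exp (- l) * (1 + k * (\<delta> + \<eta>)) \<le> exp (- l / 2)"
    proof -
      have "exp (- l) * (1 + k * (\<delta> + \<eta>)) \<le> exp (- l) * (1 + k * \<epsilon>)"
        using sum k by (intro mult_left_mono add_left_mono) auto
      also have "1 + k * \<epsilon> = exp (l / 2)" using k by (simp add: \<epsilon>_def)
      also have "exp (- l) * exp (l / 2) = exp (- l / 2)" by (simp add: mult_exp_exp)
      finally show ?thesis .
    qed
    interpret contracting_flow P b \<Lambda> \<sigma> \<phi> R l \<delta> m \<rho> K
    proof
      show "K * \<delta> \<le> 1"
      proof -
        have "K * \<delta> \<le> K * (1 / (K + 1))" using \<delta>s s(3) K0 by (intro mult_left_mono) auto
        also have "\<dots> \<le> 1" using K0 by simp
        finally show ?thesis .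
      qed
      show "\<delta> < 1" using \<delta>s s(4) by simp
    qed (use assms(5) cont_b \<Lambda> \<sigma>_pos rds far R l \<delta>0 m K K0 rate in \<open>auto simp: \<rho>_def k_def \<eta>_def\<close>)
    show ?thesis by (rule synchronization_if_growth[OF growth(2,1)])
  qed
  thus ?thesis using \<sigma>0 by blast
qed

end
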